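(* Let $\alpha\in(0,2]$, let $d\ge1$ be an integer, and let $Z_\alpha^d$ be the $d$-dimensional $\alpha$-stable sheet on $[0,1]^d$. Then, for every $q\in[1,\infty)$, as $\varepsilon\to0$, $$-\log\mathbb{P}\left(\|Z_\alpha^d\|_{L_q[0,1]^d}<\varepsilon\right)\preceq\varepsilon^{-\alpha}\log(1/\varepsilon)^{\alpha(d-1/2)} .$$
   Context: The $d$-dimensional $\alpha$-stable sheet $Z_\alpha^d=(Z_\alpha^d(t))_{t\in[0,1]^d}$ is the symmetric $\alpha$-stable process generated by the operator $u:L_p[0,1]^d\to L_\alpha[0,1]^d$ ($1/p+1/q=1$), $(uf)(s):=\int_{s_1}^1\cdots\int_{s_d}^1f(t)\,dt_d\cdots dt_1$, i.e. $\mathbf{E}e^{i\langle f,Z_\alpha^d\rangle}=e^{-\|u(f)\|_\alpha^\alpha}$ for $f\in L_p[0,1]^d$. Equivalently, it is the process (in a measurable version, with paths regarded in $L_q[0,1]^d$) with $\mathbf{E}\exp(i\sum_j\lambda_jZ_\alpha^d(t_j))=\exp\left(-\int_{[0,1]^d}|\sum_j\lambda_j\mathbf{1}_{[0,t_j]}(s)|^\alpha ds\right)$, where $[0,t]=[0,t_1]\times\cdots\times[0,t_d]$ for $t\in[0,1]^d$. For $\alpha=2$ it is (up to a constant factor) the Brownian sheet. $f\preceq g$ means $\limsup f/g<\infty$. *)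

theory Defs
  imports "HOL-Probability.Probability"
begin

abbreviation unit_cube :: "(real ^ 'd) set" where
  "unit_cube \<equiv> cbox 0 1"

text \<open>The index set of \<open>Z\<close> is the unit cube; values of \<open>Z t\<close> for \<open>t\<close> outside of it are
  irrelevant. Measurability is joint in \<open>(t, \<omega>)\<close>.\<close>

definition stable_sheet ::
  "real \<Rightarrow> 'w measure \<Rightarrow> (real ^ 'd \<Rightarrow> 'w \<Rightarrow> real) \<Rightarrow> bool" where
  "stable_sheet \<alpha> M Z \<longleftrightarrow>
     (\<lambda>(t, \<omega>). Z t \<omega>) \<in> borel_measurable (restrict_space borel unit_cube \<Otimes>\<^sub>M M) \<and>
     (\<forall>(n::nat) (t :: nat \<Rightarrow> real ^ 'd) (l :: nat \<Rightarrow> real).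
        (\<forall>j<n. t j \<in> unit_cube) \<longrightarrow>
        (LINT \<omega>|M. iexp (\<Sum>j<n. l j * Z (t j) \<omega>)) =
        complex_of_real (exp (-
          (LINT s:unit_cube|lborel. \<bar>\<Sum>j<n. l j * indicator (cbox 0 (t j)) s\<bar> powr \<alpha>))))"

text \<open>The norm takes values in the extended reals, so that it is \<open>\<infinity>\<close>, rather than a junk value,
  on functions that are not \<open>q\<close>-integrable over the cube.\<close>

definition Lq_norm :: "real \<Rightarrow> (real ^ 'd \<Rightarrow> real) \<Rightarrow> ennreal" where
  "Lq_norm q f =
     (let I = (\<integral>\<^sup>+t\<in>unit_cube. ennreal (\<bar>f t\<bar> powr q) \<partial>lborel)
      in if I = \<infinity> then \<infinity> else ennreal (enn2real I powr (1 / q)))"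

text \<open>HOL has \<open>ln 0 = 0\<close>; here \<open>-log 0 = \<infinity>\<close>.\<close>

definition neg_log :: "real \<Rightarrow> ereal" where
  "neg_log p = (if p = 0 then \<infinity> else ereal (- ln p))"

definition asymp_le :: "'a filter \<Rightarrow> ('a \<Rightarrow> ereal) \<Rightarrow> ('a \<Rightarrow> ereal) \<Rightarrow> bool" where
  "asymp_le F f g \<longleftrightarrow> Limsup F (\<lambda>x. f x / g x) < \<infinity>"

end

theory Submission
  imports Defs
begin

text \<open>
  The lower bound on the probability of a small ball comes from a pigeonhole argument that uses
  stability instead of a correlation inequality. If \<open>S\<close> and \<open>S'\<close> are independent copies of the
  sheet, then \<open>S - S'\<close> has the law of \<open>2 powr (1/\<alpha>) * Z\<close>. So it suffices to exhibit a set of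
  paths of small diameter that \<open>S\<close> hits with probability at least \<open>p\<close>: then \<open>S\<close> and \<open>S'\<close> both lie
  in it with probability at least \<open>p\<^sup>2\<close>, and \<open>Z\<close> is small on an event of that probability.

  To find such a set, restrict the sheet to a dyadic grid of mesh \<open>2^-m\<close>. There it is a sum of
  independent increments \<open>\<omega> c\<close> over the cells \<open>c\<close> in \<open>[0, x)\<close>. All increments are bounded by
  \<open>\<delta>\<close> with probability at least \<open>exp (- 16 * \<delta> powr (-\<alpha>))\<close>, and under this truncation they are
  centred with variance of order \<open>\<delta> powr (2 - \<alpha>)\<close> per unit of volume, with exponential moments
  to match. Binary expansion of the coordinates splits \<open>[0, x)\<close> into disjoint dyadic rectangles of
  volume \<open>2^-|k|\<close>, one for each level vector \<open>k\<close>. The levels with \<open>|k| > N\<close> occupy a set of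
  volume of order \<open>N^(d-1) * 2^-N\<close>, so their total contribution is typically of size
  \<open>\<epsilon>\<close> at every \<open>x\<close>, hence in \<open>L\<^sub>q\<close> for every finite \<open>q\<close>. The levels with \<open>|k| \<le> N\<close> involve only
  \<open>n\<close> rectangles, \<open>n\<close> of order \<open>N^(d-1) * 2^N\<close>; recording the increment over each of them up to a
  small error leaves \<open>exp (O(n * log (1/\<epsilon>)))\<close> classes, one of which must be hit with at least the
  average probability. Two samples in the same class differ by \<open>O(\<epsilon>)\<close> in \<open>L\<^sub>q\<close>
  (\<open>small_ball_of_two_scale_decomposition\<close>, \<open>grid_small_ball\<close>).

  The cost is \<open>\<delta> powr (-\<alpha>) + n * log (1/\<epsilon>)\<close> under the constraint
  \<open>\<delta> powr (2 - \<alpha>) * N^(d-1) * 2^-N = O(\<epsilon>\<^sup>2)\<close>. Balancing the two terms gives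
  \<open>\<delta> = \<epsilon> * log (1/\<epsilon>) powr (-(d - 1/2))\<close> and the stated rate \<open>\<delta> powr (-\<alpha>)\<close>
  (\<open>parameter_choice\<close>).

  None of the constants depends on \<open>m\<close>. The passage from grid to sheet therefore needs only that
  joint characteristic functions determine the law of finitely many values (\<open>char_unique_PiM\<close>) and
  that the step functions built from the grid values converge almost everywhere, combined with
  Fatou's lemma (\<open>grid_interpolation_converges\<close>, \<open>stable_sheet_probability_of_grid\<close>).
\<close>

section \<open>Joint characteristic functions determine joint laws\<close>

text \<open>
  Normalising the weights turns them into probability densities, and Levy's uniqueness theorem
  applies to the laws of \<open>X\<close> and \<open>Y\<close> under the reweighted measures.
\<close>

lemma char_unique_positive_weight:
  fixes X :: "'a \<Rightarrow> real" and Y :: "'b \<Rightarrow> real" and f :: "'a \<Rightarrow> real" and g :: "'b \<Rightarrow> real"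
  assumes M: "prob_space M" and N: "prob_space N"
    and [measurable]: "X \<in> borel_measurable M" "f \<in> borel_measurable M"
      "Y \<in> borel_measurable N" "g \<in> borel_measurable N"
    and f: "\<And>\<omega>. 1 \<le> f \<omega>" "\<And>\<omega>. f \<omega> \<le> K" and g: "\<And>\<omega>. 1 \<le> g \<omega>" "\<And>\<omega>. g \<omega> \<le> K"
    and eq: "\<And>\<theta>. (LINT \<omega>|M. f \<omega> *\<^sub>R iexp (\<theta> * X \<omega>)) = (LINT \<omega>|N. g \<omega> *\<^sub>R iexp (\<theta> * Y \<omega>))"
    and B[measurable]: "B \<in> sets borel"
  shows "(LINT \<omega>|M. f \<omega> * indicator B (X \<omega>)) = (LINT \<omega>|N. g \<omega> * indicator B (Y \<omega>))"
proof -
  interpret M: prob_space M by fact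
  interpret N: prob_space N by fact
  have intf: "integrable M f" using f by (intro M.integrable_const_bound[of _ K] AE_I2) (simp_all add: abs_le_iff, smt (verit))
  have intg: "integrable N g" using g by (intro N.integrable_const_bound[of _ K] AE_I2) (simp_all add: abs_le_iff, smt (verit))
  define c where "c = (LINT \<omega>|M. f \<omega>)"
  have c': "c = (LINT \<omega>|N. g \<omega>)"
  proof -
    have "complex_of_real c = (LINT \<omega>|M. f \<omega> *\<^sub>R iexp (0 * X \<omega>))"
      by (simp add: c_def scaleR_conv_of_real)
    also have "\<dots> = complex_of_real (LINT \<omega>|N. g \<omega>)"
      unfolding eq by (simp add: scaleR_conv_of_real)
    finally show ?thesis by (metis of_real_eq_iff)
  qed
  have "(LINT \<omega>|M. 1) \<le> c" unfolding c_def using intf f by (intro integral_mono) auto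
  hence c1: "c \<ge> 1" using M.prob_space by simp
  have *: "real_distribution (distr (density P (\<lambda>\<omega>. ennreal (h \<omega> / c))) borel V) \<and>
      (\<forall>\<theta>. char (distr (density P (\<lambda>\<omega>. ennreal (h \<omega> / c))) borel V) \<theta> = (LINT \<omega>|P. h \<omega> *\<^sub>R iexp (\<theta> * V \<omega>)) / c)
      \<and> (LINT \<omega>|P. h \<omega> * indicator B (V \<omega>)) = c * measure (distr (density P (\<lambda>\<omega>. ennreal (h \<omega> / c))) borel V) B"
    if P: "prob_space P" and [measurable]: "V \<in> borel_measurable P" "h \<in> borel_measurable P"
     and h: "integrable P h" "\<And>\<omega>. 1 \<le> h \<omega>" and hc: "c = (LINT \<omega>|P. h \<omega>)" for P :: "'c measure" and h V
  proof -
    let ?D = "density P (\<lambda>\<omega>. ennreal (h \<omega> / c))"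
    have pos: "0 \<le> h \<omega> / c" for \<omega> using h(2)[of \<omega>] c1 by auto
    have "emeasure ?D (space ?D) = (\<integral>\<^sup>+ \<omega>. ennreal (h \<omega> / c) \<partial>P)" by (simp add: emeasure_density)
    also have "\<dots> = ennreal (LINT \<omega>|P. h \<omega> / c)"
      using h(1) pos by (intro nn_integral_eq_integral) auto
    also have "(LINT \<omega>|P. h \<omega> / c) = 1" using hc c1 by simp
    finally have D: "prob_space ?D" by (intro prob_spaceI) simp
    interpret D: prob_space ?D by fact
    have 1: "real_distribution (distr ?D borel V)"
      by (intro D.real_distribution_distr) simp
    have 2: "char (distr ?D borel V) \<theta> = (LINT \<omega>|P. h \<omega> *\<^sub>R iexp (\<theta> * V \<omega>)) / c" for \<theta>
    proof -
      have "char (distr ?D borel V) \<theta> = (LINT \<omega>|?D. iexp (\<theta> * V \<omega>))"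
        unfolding char_def by (subst integral_distr) auto
      also have "\<dots> = (LINT \<omega>|P. (h \<omega> / c) *\<^sub>R iexp (\<theta> * V \<omega>))"
        using pos by (subst integral_density) auto
      also have "\<dots> = (LINT \<omega>|P. (h \<omega> *\<^sub>R iexp (\<theta> * V \<omega>)) / complex_of_real c)"
        by (simp add: scaleR_conv_of_real)
      finally show ?thesis by simp
    qed
    have "measure (distr ?D borel V) B = measure ?D (V -` B \<inter> space P)"
      by (subst measure_distr) auto
    also have "\<dots> = (LINT \<omega>|?D. indicator (V -` B \<inter> space P) \<omega>)"
      by simp
    also have "\<dots> = (LINT \<omega>|P. (h \<omega> / c) * indicator (V -` B \<inter> space P) \<omega>)"
      using pos by (subst integral_density) auto
    also have "\<dots> = (LINT \<omega>|P. (h \<omega> * indicator B (V \<omega>)) / c)"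
      by (intro Bochner_Integration.integral_cong) (auto simp: indicator_def)
    finally have "(LINT \<omega>|P. h \<omega> * indicator B (V \<omega>)) = c * measure (distr ?D borel V) B"
      using c1 by simp
    with 1 2 show ?thesis by blast
  qed
  note a = *[OF M, of X f] and b = *[OF N, of Y g]
  have "distr (density M (\<lambda>\<omega>. ennreal (f \<omega> / c))) borel X = distr (density N (\<lambda>\<omega>. ennreal (g \<omega> / c))) borel Y"
    using a b eq f g intf intg c_def c' by (intro Levy_uniqueness) (auto simp: fun_eq_iff)
  then show ?thesis using a b f g intf intg c_def c' by auto
qed

text \<open>
  A weight with values in \<open>[-1, 1]\<close> becomes positive after adding 2; the added constant is harmless
  because \<open>X\<close> and \<open>Y\<close> have the same law.
\<close>

lemma char_unique_bounded_weight:
  fixes X :: "'a \<Rightarrow> real" and Y :: "'b \<Rightarrow> real" and f :: "'a \<Rightarrow> real" and g :: "'b \<Rightarrow> real"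
  assumes M: "prob_space M" and N: "prob_space N"
    and [measurable]: "X \<in> borel_measurable M" "f \<in> borel_measurable M"
      "Y \<in> borel_measurable N" "g \<in> borel_measurable N"
    and f: "\<And>\<omega>. \<bar>f \<omega>\<bar> \<le> 1" and g: "\<And>\<omega>. \<bar>g \<omega>\<bar> \<le> 1"
    and eq1: "\<And>\<theta>. (LINT \<omega>|M. iexp (\<theta> * X \<omega>)) = (LINT \<omega>|N. iexp (\<theta> * Y \<omega>))"
    and eq: "\<And>\<theta>. (LINT \<omega>|M. f \<omega> *\<^sub>R iexp (\<theta> * X \<omega>)) = (LINT \<omega>|N. g \<omega> *\<^sub>R iexp (\<theta> * Y \<omega>))"
    and B[measurable]: "B \<in> sets borel"
  shows "(LINT \<omega>|M. f \<omega> * indicator B (X \<omega>)) = (LINT \<omega>|N. g \<omega> * indicator B (Y \<omega>))"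
proof -
  interpret M: prob_space M by fact
  interpret N: prob_space N by fact
  have i1: "integrable M (\<lambda>\<omega>. iexp (\<theta> * X \<omega>))" "integrable M (\<lambda>\<omega>. f \<omega> *\<^sub>R iexp (\<theta> * X \<omega>))"
     "integrable M (\<lambda>\<omega>. f \<omega> * indicator B (X \<omega>))" "integrable M (\<lambda>\<omega>. indicator B (X \<omega>) :: real)" for \<theta>
    using f by (auto intro!: M.integrable_const_bound[of _ 1] simp: indicator_def)
  have i2: "integrable N (\<lambda>\<omega>. iexp (\<theta> * Y \<omega>))" "integrable N (\<lambda>\<omega>. g \<omega> *\<^sub>R iexp (\<theta> * Y \<omega>))"
    "integrable N (\<lambda>\<omega>. g \<omega> * indicator B (Y \<omega>))" "integrable N (\<lambda>\<omega>. indicator B (Y \<omega>) :: real)" for \<theta>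
    using g by (auto intro!: N.integrable_const_bound[of _ 1] simp: indicator_def)
  have a: "(LINT \<omega>|M. 1 * indicator B (X \<omega>)) = (LINT \<omega>|N. 1 * indicator B (Y \<omega>) :: real)"
    by (rule char_unique_positive_weight[OF M N, of _ _ _ _ 1]) (use eq1 in auto)
  have b: "(LINT \<omega>|M. (2 + f \<omega>) * indicator B (X \<omega>)) = (LINT \<omega>|N. (2 + g \<omega>) * indicator B (Y \<omega>))"
  proof (rule char_unique_positive_weight[OF M N, of _ _ _ _ 3])
    fix \<theta>
    show "(LINT \<omega>|M. (2 + f \<omega>) *\<^sub>R iexp (\<theta> * X \<omega>)) = (LINT \<omega>|N. (2 + g \<omega>) *\<^sub>R iexp (\<theta> * Y \<omega>))"
      using i1 i2 eq1 eq by (simp add: scaleR_add_left)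
  qed (use f g in \<open>auto simp: abs_le_iff\<close>, (smt (verit) f g)+)
  show ?thesis using a b i1 i2 by (simp add: distrib_right)
qed

text \<open>
  Multivariate version of Levy's uniqueness theorem, by induction: one coordinate at a time, the
  exponential is replaced by the indicator function of a Borel set. The factors that belong to the
  other coordinates act as a weight, of which the real and the imaginary part are treated
  separately.
\<close>

lemma char_unique_PiM:
  fixes X :: "'i \<Rightarrow> 'a \<Rightarrow> real" and Y :: "'i \<Rightarrow> 'b \<Rightarrow> real"
  assumes M: "prob_space M" and N: "prob_space N" and I: "finite I"
    and X[measurable]: "\<And>i. i \<in> I \<Longrightarrow> X i \<in> borel_measurable M"
    and Y[measurable]: "\<And>i. i \<in> I \<Longrightarrow> Y i \<in> borel_measurable N"
    and eq: "\<And>l :: 'i \<Rightarrow> real. (LINT \<omega>|M. iexp (\<Sum>i\<in>I. l i * X i \<omega>)) = (LINT \<omega>|N. iexp (\<Sum>i\<in>I. l i * Y i \<omega>))"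
  shows "distr M (Pi\<^sub>M I (\<lambda>_. borel)) (\<lambda>\<omega>. \<lambda>i\<in>I. X i \<omega>) = distr N (Pi\<^sub>M I (\<lambda>_. borel)) (\<lambda>\<omega>. \<lambda>i\<in>I. Y i \<omega>)"
proof -
  interpret M: prob_space M by fact
  interpret N: prob_space N by fact
  define ind :: "'i set \<Rightarrow> ('i \<Rightarrow> real set) \<Rightarrow> ('i \<Rightarrow> real) \<Rightarrow> real"
    where "ind J B x = (\<Prod>j\<in>J. indicator (B j) (x j))" for J B x
  have ind01: "0 \<le> ind J B x" "ind J B x \<le> 1" for J B x
    unfolding ind_def by (auto intro!: prod_nonneg prod_le_1 simp: indicator_def)
  have step: "(LINT \<omega>|M. ind J B (\<lambda>i. X i \<omega>) *\<^sub>R iexp (\<Sum>i\<in>I-J. l i * X i \<omega>)) =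
      (LINT \<omega>|N. ind J B (\<lambda>i. Y i \<omega>) *\<^sub>R iexp (\<Sum>i\<in>I-J. l i * Y i \<omega>))"
    if "J \<subseteq> I" "\<And>i. i \<in> I \<Longrightarrow> B i \<in> sets borel" for J B l
    using finite_subset[OF that(1) I] that(1)
  proof (induction J arbitrary: l rule: finite_induct)
    case empty
    then show ?case using eq by (simp add: ind_def)
  next
    case (insert k J)
    note [measurable] = that(2)
    have kI: "k \<in> I" and JI: "J \<subseteq> I" using insert.prems by auto
    have Jm: "j \<in> J \<Longrightarrow> j \<in> I" for j using JI by auto
    have im[measurable]: "(\<lambda>\<omega>. ind J B (\<lambda>i. X i \<omega>)) \<in> borel_measurable M" 
        "(\<lambda>\<omega>. ind J B (\<lambda>i. Y i \<omega>)) \<in> borel_measurable N"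
      unfolding ind_def using Jm by (auto intro!: borel_measurable_prod borel_measurable_indicator' measurable_compose[OF X] measurable_compose[OF Y] simp: that(2))
    define U where "U = (\<lambda>\<omega>. \<Sum>i\<in>I - insert k J. l i * X i \<omega>)"
    define V where "V = (\<lambda>\<omega>. \<Sum>i\<in>I - insert k J. l i * Y i \<omega>)"
    have [measurable]: "U \<in> borel_measurable M" "V \<in> borel_measurable N" 
      unfolding U_def V_def by measurable
    have [measurable]: "X k \<in> borel_measurable M" "Y k \<in> borel_measurable N" "B k \<in> sets borel" using kI X Y that(2) by auto
    have split: "I - J = insert k (I - insert k J)" using kI insert.hyps by auto
    have sX: "(\<Sum>i\<in>I - J. (if i = k then \<theta> else s * l i) * X i \<omega>) = \<theta> * X k \<omega> + s * U \<omega>" for \<theta> s \<omega>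
      unfolding split U_def using I by (subst sum.insert) (auto intro!: sum.cong simp: sum_distrib_left)
    have sY: "(\<Sum>i\<in>I - J. (if i = k then \<theta> else s * l i) * Y i \<omega>) = \<theta> * Y k \<omega> + s * V \<omega>" for \<theta> s \<omega>
      unfolding split V_def using I by (subst sum.insert) (auto intro!: sum.cong simp: sum_distrib_left)
    have IH: "(LINT \<omega>|M. ind J B (\<lambda>i. X i \<omega>) *\<^sub>R iexp (\<theta> * X k \<omega> + s * U \<omega>)) =
      (LINT \<omega>|N. ind J B (\<lambda>i. Y i \<omega>) *\<^sub>R iexp (\<theta> * Y k \<omega> + s * V \<omega>))" for \<theta> s
      using insert.IH[OF JI, of "\<lambda>i. if i = k then \<theta> else s * l i"] unfolding sX sY .
    have e1: "(LINT \<omega>|M. iexp (\<theta> * X k \<omega>)) = (LINT \<omega>|N. iexp (\<theta> * Y k \<omega>))" for \<theta>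
    proof -
      have "(\<Sum>i\<in>I. (if i = k then \<theta> else 0) * Z i) = \<theta> * Z k" for Z :: "'i \<Rightarrow> real"
        using I kI by (simp add: if_distrib[of "\<lambda>x. x * _"] sum.delta cong: if_cong)
      then show ?thesis using eq[of "\<lambda>i. if i = k then \<theta> else 0"] by simp
    qed
    have int1: "integrable M (\<lambda>\<omega>. ind J B (\<lambda>i. X i \<omega>) *\<^sub>R iexp (\<theta> * X k \<omega> + s * U \<omega>))" for \<theta> s
      using ind01 by (intro M.integrable_const_bound[of _ 1]) auto
    have int2: "integrable N (\<lambda>\<omega>. ind J B (\<lambda>i. Y i \<omega>) *\<^sub>R iexp (\<theta> * Y k \<omega> + s * V \<omega>))" for \<theta> s
      using ind01 by (intro N.integrable_const_bound[of _ 1]) auto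
    \<comment> \<open>cosine and sine of the remaining exponent are weights bounded by 1 that again lead to exponentials\<close>
    have cosid: "(r * cos u) *\<^sub>R iexp t = (r *\<^sub>R iexp (t + 1 * u) + r *\<^sub>R iexp (t + (-1) * u)) / 2" for r u t :: real
      by (simp add: complex_eq_iff Re_exp Im_exp cos_add sin_add cos_diff sin_diff algebra_simps)
    have sinid: "(r * sin u) *\<^sub>R iexp t = (r *\<^sub>R iexp (t + 1 * u) - r *\<^sub>R iexp (t + (-1) * u)) * (- \<i> / 2)" for r u t :: real
      by (simp add: complex_eq_iff Re_exp Im_exp cos_add sin_add cos_diff sin_diff field_simps)
    have bd: "\<bar>ind J B x * cos u\<bar> \<le> 1" "\<bar>ind J B x * sin u\<bar> \<le> 1" for x u
      unfolding abs_mult using ind01[of J B x] abs_cos_le_one[of u] abs_sin_le_one[of u] by (auto intro!: mult_le_one)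
    have c: "(LINT \<omega>|M. (ind J B (\<lambda>i. X i \<omega>) * cos (U \<omega>)) * indicator (B k) (X k \<omega>)) =
       (LINT \<omega>|N. (ind J B (\<lambda>i. Y i \<omega>) * cos (V \<omega>)) * indicator (B k) (Y k \<omega>))"
      by (rule char_unique_bounded_weight[OF M N])
         (use bd e1 in \<open>simp_all only: cosid Bochner_Integration.integral_divide_zero Bochner_Integration.integral_add[OF int1 int1] Bochner_Integration.integral_add[OF int2 int2] IH, measurable\<close>)
    have s: "(LINT \<omega>|M. (ind J B (\<lambda>i. X i \<omega>) * sin (U \<omega>)) * indicator (B k) (X k \<omega>)) =
       (LINT \<omega>|N. (ind J B (\<lambda>i. Y i \<omega>) * sin (V \<omega>)) * indicator (B k) (Y k \<omega>))"
      by (rule char_unique_bounded_weight[OF M N])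
         (use bd e1 in \<open>simp_all only: sinid Bochner_Integration.integral_mult_left_zero Bochner_Integration.integral_diff[OF int1 int1] Bochner_Integration.integral_diff[OF int2 int2] IH, measurable\<close>)
    have dec: "ind (insert k J) B x *\<^sub>R iexp u = complex_of_real ((ind J B x * cos u) * indicator (B k) (x k)) +
       \<i> * complex_of_real ((ind J B x * sin u) * indicator (B k) (x k))" for x u
      using insert.hyps by (simp add: ind_def scaleR_conv_of_real exp_Euler cos_of_real sin_of_real algebra_simps)
    have b': "\<bar>ind J B x * cos u * indicator (B k) z\<bar> \<le> 1"  "\<bar>ind J B x * sin u * indicator (B k) z\<bar> \<le> 1" for x u z
      using bd[of x u] by (auto simp: indicator_def)
    have i: "integrable M (\<lambda>\<omega>. (ind J B (\<lambda>i. X i \<omega>) * cos (U \<omega>)) * indicator (B k) (X k \<omega>))"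
      "integrable M (\<lambda>\<omega>. (ind J B (\<lambda>i. X i \<omega>) * sin (U \<omega>)) * indicator (B k) (X k \<omega>))"
      using b' by (auto intro!: M.integrable_const_bound[of _ 1])
    have i': "integrable N (\<lambda>\<omega>. (ind J B (\<lambda>i. Y i \<omega>) * cos (V \<omega>)) * indicator (B k) (Y k \<omega>))"
      "integrable N (\<lambda>\<omega>. (ind J B (\<lambda>i. Y i \<omega>) * sin (V \<omega>)) * indicator (B k) (Y k \<omega>))"
      using b' by (auto intro!: N.integrable_const_bound[of _ 1])
    have A: "(LINT \<omega>|M. ind (insert k J) B (\<lambda>i. X i \<omega>) *\<^sub>R iexp (U \<omega>)) = (LINT \<omega>|N. ind (insert k J) B (\<lambda>i. Y i \<omega>) *\<^sub>R iexp (V \<omega>))"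
      unfolding dec
      apply (subst Bochner_Integration.integral_add)
      subgoal using i by (intro integrable_of_real)
      subgoal using i by (intro integrable_mult_right integrable_of_real)
      apply (subst Bochner_Integration.integral_add)
      subgoal using i' by (intro integrable_of_real)
      subgoal using i' by (intro integrable_mult_right integrable_of_real)
      using c s by (simp only: integral_mult_right_zero integral_complex_of_real)
    show ?case using A unfolding U_def V_def .
  qed
  have meas: "emeasure (distr M (Pi\<^sub>M I (\<lambda>_. borel)) (\<lambda>\<omega>. \<lambda>i\<in>I. X i \<omega>)) (Pi\<^sub>E I B) = ennreal (LINT \<omega>|M. ind I B (\<lambda>i. X i \<omega>))"
    if M: "prob_space M" and X: "\<And>i. i \<in> I \<Longrightarrow> X i \<in> borel_measurable M" and B: "\<And>i. i \<in> I \<Longrightarrow> B i \<in> sets borel"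
    for M :: "'c measure" and X :: "'i \<Rightarrow> 'c \<Rightarrow> real" and B
  proof -
    interpret prob_space M by fact
    have [measurable]: "(\<lambda>\<omega>. \<lambda>i\<in>I. X i \<omega>) \<in> measurable M (Pi\<^sub>M I (\<lambda>_. borel))"
      using X by (intro measurable_restrict)
    have S[measurable]: "Pi\<^sub>E I B \<in> sets (Pi\<^sub>M I (\<lambda>_. borel))" using B I by (intro sets_PiM_I_finite) auto
    have "(LINT \<omega>|M. ind I B (\<lambda>i. X i \<omega>)) = (LINT \<omega>|M. indicator ((\<lambda>\<omega>. \<lambda>i\<in>I. X i \<omega>) -` Pi\<^sub>E I B \<inter> space M) \<omega>)"
      using I by (intro Bochner_Integration.integral_cong) (auto simp: ind_def indicator_def prod.If_cases restrict_def PiE_iff extensional_def split: if_splits)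
    also have "\<dots> = measure M ((\<lambda>\<omega>. \<lambda>i\<in>I. X i \<omega>) -` Pi\<^sub>E I B \<inter> space M)" by simp
    finally show ?thesis by (simp add: emeasure_distr emeasure_eq_measure)
  qed
  have intnd: "complex_of_real (LINT \<omega>|M. ind I B (\<lambda>i. X i \<omega>)) = (LINT \<omega>|M. ind I B (\<lambda>i. X i \<omega>) *\<^sub>R iexp 0)"
    for M :: "'c measure" and X B  by (simp add: scaleR_conv_of_real)
  show ?thesis
  proof (rule measure_eqI_PiM_finite[OF I, where A="\<lambda>_. space (Pi\<^sub>M I (\<lambda>_. borel))"])
    fix B :: "'i \<Rightarrow> real set" assume B: "\<And>i. i \<in> I \<Longrightarrow> B i \<in> sets borel"
    have "complex_of_real (LINT \<omega>|M. ind I B (\<lambda>i. X i \<omega>)) = complex_of_real (LINT \<omega>|N. ind I B (\<lambda>i. Y i \<omega>))"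
      using step[of I B, OF order_refl B] unfolding intnd by simp
    then have "(LINT \<omega>|M. ind I B (\<lambda>i. X i \<omega>)) = (LINT \<omega>|N. ind I B (\<lambda>i. Y i \<omega>))"
      by (metis of_real_eq_iff)
    then show "emeasure (distr M (Pi\<^sub>M I (\<lambda>_. borel)) (\<lambda>\<omega>. \<lambda>i\<in>I. X i \<omega>)) (Pi\<^sub>E I B) = emeasure (distr N (Pi\<^sub>M I (\<lambda>_. borel)) (\<lambda>\<omega>. \<lambda>i\<in>I. Y i \<omega>)) (Pi\<^sub>E I B)"
      using meas[OF M X B] meas[OF N Y B] by simp
  next
    have "prob_space (distr M (Pi\<^sub>M I (\<lambda>_. borel)) (\<lambda>\<omega>. \<lambda>i\<in>I. X i \<omega>))"
      using X by (intro M.prob_space_distr measurable_restrict)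
    then show "emeasure (distr M (Pi\<^sub>M I (\<lambda>_. borel)) (\<lambda>\<omega>. \<lambda>i\<in>I. X i \<omega>)) (space (Pi\<^sub>M I (\<lambda>_. borel))) \<noteq> \<infinity>" 
      by (metis prob_space.emeasure_space_1 space_distr ennreal_one_neq_top infinity_ennreal_def)
    have "Pi\<^sub>E I (\<lambda>_. UNIV :: real set) \<in> prod_algebra I (\<lambda>_. borel)" using I by (intro prod_algebraI_finite) auto
    then show "range (\<lambda>_::nat. space (Pi\<^sub>M I (\<lambda>_. borel))) \<subseteq> prod_algebra I (\<lambda>_. borel :: real measure)"
      by (auto simp: space_PiM)
  qed auto
qed

section \<open>Truncated moments of a symmetric stable variable\<close>

text \<open>
  Averaging \<open>1 - \<phi>(u g)\<close> over a standard normal \<open>g\<close> gives the expectation of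
  \<open>1 - exp (- (X/\<delta>)\<^sup>2)\<close>, which is comparable to \<open>min 1 ((X/\<delta>)\<^sup>2)\<close>. A single estimate thus controls both
  the tail probability at \<open>\<delta>\<close> and the variance of the truncated variable, for all \<open>\<alpha>\<close> up to 2.
\<close>

lemma stable_truncated_moment:
  fixes X :: "'a \<Rightarrow> real"
  assumes M: "prob_space M" and [measurable]: "X \<in> borel_measurable M"
    and \<alpha>: "0 < \<alpha>" "\<alpha> \<le> 2" and v: "0 \<le> v" and \<delta>: "0 < \<delta>"
    and ch: "\<And>\<theta>. (LINT \<omega>|M. iexp (\<theta> * X \<omega>)) = complex_of_real (exp (- (v * \<bar>\<theta>\<bar> powr \<alpha>)))"
  shows "(LINT \<omega>|M. min 1 ((X \<omega> / \<delta>)\<^sup>2)) \<le> 8 * v * \<delta> powr (-\<alpha>)"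
proof -
  interpret M: prob_space M by fact
  let ?G = std_normal_distribution
  interpret G: real_distribution ?G by (rule real_dist_normal_dist)
  interpret pair_prob_space M ?G ..
  define u where "u = sqrt 2 / \<delta>"
  have u: "u > 0" using \<delta> by (simp add: u_def)
  have "complex_of_real (LINT \<omega>|M. exp (- (X \<omega> / \<delta>)\<^sup>2)) = (LINT \<omega>|M. (LINT g|?G. iexp (u * X \<omega> * g)))"
  proof -
    have "(LINT g|?G. iexp (u * x * g)) = complex_of_real (exp (- (x / \<delta>)\<^sup>2))" for x
    proof -
      have "(LINT g|?G. iexp (u * x * g)) = complex_of_real (exp (- ((u * x)\<^sup>2) / 2))"
        using fun_cong[OF char_std_normal_distribution, of "u * x"] unfolding char_def .
      also have "(u * x)\<^sup>2 = 2 * (x / \<delta>)\<^sup>2"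
        by (simp add: u_def power_mult_distrib power_divide)
      finally show ?thesis by simp
    qed
    then show ?thesis by (simp only: integral_complex_of_real)
  qed
  also have "\<dots> = (LINT g|?G. (LINT \<omega>|M. iexp (u * X \<omega> * g)))"
  proof (rule Fubini_integral[symmetric])
    show "integrable (M \<Otimes>\<^sub>M ?G) (\<lambda>(x, y). iexp (u * X x * y))"
      by (intro P.integrable_const_bound[of _ 1]) (auto simp: case_prod_beta)
  qed
  also have "\<dots> = (LINT g|?G. complex_of_real (exp (- (v * \<bar>u * g\<bar> powr \<alpha>))))"
    using ch[of "u * _"] by (simp add: mult_ac)
  also have "\<dots> = complex_of_real (LINT g|?G. exp (- (v * \<bar>u * g\<bar> powr \<alpha>)))"
    by (rule integral_complex_of_real)
  finally have eq: "(LINT \<omega>|M. exp (- (X \<omega> / \<delta>)\<^sup>2)) = (LINT g|?G. exp (- (v * \<bar>u * g\<bar> powr \<alpha>)))"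
    by (metis of_real_eq_iff)
  have ig: "integrable ?G (\<lambda>g. g^2)" by (rule integrable_std_normal_distribution_moment)
  have mg: "(LINT g|?G. g^2) = 1" using std_normal_distribution_even_moments(1)[of 1] by simp
  have "(LINT g|?G. 1 - v * u powr \<alpha> * (1 + g^2)) \<le> (LINT g|?G. exp (- (v * \<bar>u * g\<bar> powr \<alpha>)))"
  proof (rule integral_mono)
    show "integrable ?G (\<lambda>g. 1 - v * u powr \<alpha> * (1 + g^2))" using ig by simp
    show "integrable ?G (\<lambda>g. exp (- (v * \<bar>u * g\<bar> powr \<alpha>)))"
      using v by (intro G.integrable_const_bound[of _ 1]) auto
    fix g :: real
    have "\<bar>g\<bar> powr \<alpha> \<le> 1 + g^2"
    proof (cases "\<bar>g\<bar> \<le> 1")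
      case True
      then have "\<bar>g\<bar> powr \<alpha> \<le> 1" using \<alpha> by (intro powr_le1) auto
      then show ?thesis by (smt (verit) zero_le_power2)
    next
      case False
      then have "\<bar>g\<bar> powr \<alpha> \<le> \<bar>g\<bar> powr 2" using \<alpha> by (intro powr_mono) auto
      also have "\<dots> = g^2" using False by (simp add: powr_numeral)
      finally show ?thesis by simp
    qed
    then have "v * (u powr \<alpha> * \<bar>g\<bar> powr \<alpha>) \<le> v * (u powr \<alpha> * (1 + g^2))"
      using v by (intro mult_left_mono) auto
    moreover have "\<bar>u * g\<bar> powr \<alpha> = u powr \<alpha> * \<bar>g\<bar> powr \<alpha>" using u by (simp add: abs_mult powr_mult)
    ultimately show "1 - v * u powr \<alpha> * (1 + g^2) \<le> exp (- (v * \<bar>u * g\<bar> powr \<alpha>))"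
      using exp_ge_add_one_self[of "- (v * \<bar>u * g\<bar> powr \<alpha>)"] by (simp add: mult.assoc)
  qed
  also have "(LINT g|?G. 1 - v * u powr \<alpha> * (1 + g^2)) = 1 - 2 * v * u powr \<alpha>"
    using ig mg G.prob_space by simp
  finally have low: "1 - 2 * v * u powr \<alpha> \<le> (LINT \<omega>|M. exp (- (X \<omega> / \<delta>)\<^sup>2))" using eq by simp
  have ie: "integrable M (\<lambda>\<omega>. exp (- (X \<omega> / \<delta>)\<^sup>2))"
    by (intro M.integrable_const_bound[of _ 1]) auto
  have "(LINT \<omega>|M. min 1 ((X \<omega> / \<delta>)\<^sup>2)) \<le> (LINT \<omega>|M. 2 * (1 - exp (- (X \<omega> / \<delta>)\<^sup>2)))"
  proof (rule integral_mono)
    show "integrable M (\<lambda>\<omega>. min 1 ((X \<omega> / \<delta>)\<^sup>2))"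
      by (intro M.integrable_const_bound[of _ 1]) auto
    show "integrable M (\<lambda>\<omega>. 2 * (1 - exp (- (X \<omega> / \<delta>)\<^sup>2)))" using ie by simp
    fix \<omega>
    define z where "z = (X \<omega> / \<delta>)\<^sup>2"
    have z: "z \<ge> 0" by (simp add: z_def)
    have "exp (-z) \<le> 1 / (1 + z)" using exp_ge_add_one_self[of z] z by (simp add: exp_minus field_simps)
    also have "\<dots> \<le> 1 - min 1 z / 2"
    proof (cases "z \<le> 1")
      case True
      then have "z * z \<le> z" using z by (simp add: mult_left_le)
      then show ?thesis using z True by (simp add: field_simps)
    qed (use z in \<open>simp add: field_simps\<close>)
    finally show "min 1 ((X \<omega> / \<delta>)\<^sup>2) \<le> 2 * (1 - exp (- (X \<omega> / \<delta>)\<^sup>2))" unfolding z_def by simp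
  qed
  also have "\<dots> = 2 * (1 - (LINT \<omega>|M. exp (- (X \<omega> / \<delta>)\<^sup>2)))" using ie M.prob_space by simp
  also have "\<dots> \<le> 4 * v * u powr \<alpha>" using low by simp
  also have "\<dots> \<le> 4 * v * (2 * \<delta> powr (-\<alpha>))"
  proof -
    have "u powr \<alpha> = 2 powr (\<alpha>/2) * \<delta> powr (-\<alpha>)"
      using \<delta> by (simp add: u_def powr_divide powr_minus_divide powr_half_sqrt[symmetric] powr_powr)
    moreover have "2 powr (\<alpha>/2) \<le> (2::real) powr 1" using \<alpha> by (intro powr_mono) auto
    ultimately show ?thesis using v by (intro mult_left_mono) (auto intro!: mult_right_mono)
  qed
  finally show ?thesis by simp
qed

text \<open>
  A real characteristic function means a symmetric law.
\<close>

lemma real_char_truncated_mean: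
  fixes \<mu> :: "real measure"
  assumes \<mu>: "real_distribution \<mu>" and ch: "\<And>\<theta>. Im (char \<mu> \<theta>) = 0"
  shows "(LINT x|\<mu>. indicator {-\<delta>..\<delta>} x * x) = 0"
proof -
  interpret real_distribution \<mu> by fact
  have d: "real_distribution (distr \<mu> borel uminus)" by (intro real_distribution_distr) simp
  have "char (distr \<mu> borel uminus) \<theta> = cnj (char \<mu> \<theta>)" for \<theta>
  proof -
    have "char (distr \<mu> borel uminus) \<theta> = (CLINT x|\<mu>. cnj (iexp (\<theta> * x)))"
      unfolding char_def by (subst integral_distr) (auto simp: exp_cnj)
    then show ?thesis unfolding char_def by simp
  qed
  then have "char (distr \<mu> borel uminus) = char \<mu>"
    using ch by (auto simp: fun_eq_iff complex_eq_iff)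
  then have "distr \<mu> borel uminus = \<mu>" using Levy_uniqueness[OF d \<mu>] by blast
  then have "(LINT x|\<mu>. indicator {-\<delta>..\<delta>} x * x) = (LINT x|distr \<mu> borel uminus. indicator {-\<delta>..\<delta>} x * x)"
    by simp
  also have "\<dots> = (LINT x|\<mu>. indicator {-\<delta>..\<delta>} (-x) * (-x))"
    by (subst integral_distr) auto
  also have "\<dots> = (LINT x|\<mu>. - (indicator {-\<delta>..\<delta>} x * x))"
    by (intro Bochner_Integration.integral_cong) (auto simp: indicator_def)
  finally show ?thesis by simp
qed

section \<open>Exponential moments of truncated sums\<close>

lemma exp_le_quadratic:
  assumes "\<bar>y\<bar> \<le> 1"
  shows "exp y \<le> 1 + y + (y::real)\<^sup>2"
proof (cases "0 \<le> y")
  case True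
  then show ?thesis using assms exp_bound[of y] by auto
next
  case False
  define z where "z = -y"
  have z: "0 \<le> z" using False by (simp add: z_def)
  have p: "0 < 1 + z + z\<^sup>2/2" using z by (smt (verit) zero_le_power2 divide_nonneg_nonneg)
  have "1 + z + z\<^sup>2/2 \<le> exp z" using exp_lower_Taylor_quadratic[OF z] .
  then have "exp y \<le> 1 / (1 + z + z\<^sup>2/2)" using p unfolding z_def exp_minus 
    by (metis exp_minus frac_le inverse_eq_divide le_numeral_extra(4) minus_minus zero_le_one)
  also have "\<dots> \<le> 1 - z + z\<^sup>2"
  proof -
    have "0 \<le> z^2/2 + z^3/2 + z^4/2" using z by auto
    moreover have "(1 - z + z\<^sup>2) * (1 + z + z\<^sup>2/2) = 1 + (z^2/2 + z^3/2 + z^4/2)" by (simp add: field_simps eval_nat_numeral)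
    ultimately have "1 \<le> (1 - z + z\<^sup>2) * (1 + z + z\<^sup>2/2)" by linarith
    then show ?thesis using p by (simp add: divide_le_eq)
  qed
  finally show ?thesis by (simp add: z_def)
qed

lemma powr_le_exp:
  assumes "0 < q" shows "\<bar>w\<bar> powr q \<le> q powr q * exp \<bar>w::real\<bar>"
proof -
  have "\<bar>w\<bar> / q \<le> exp (\<bar>w\<bar> / q)" using exp_ge_add_one_self[of "\<bar>w\<bar> / q"] by linarith
  then have "(\<bar>w\<bar> / q) powr q \<le> exp (\<bar>w\<bar> / q) powr q" using assms by (intro powr_mono2) auto
  also have "\<dots> = exp \<bar>w\<bar>" using assms by (simp add: exp_powr_real)
  finally show ?thesis using assms by (simp add: powr_divide divide_le_eq mult.commute)
qed

lemma powr_sum3_le: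
  assumes "0 < q" "0 \<le> a" "0 \<le> b" "0 \<le> c"
  shows "(a + b + c) powr q \<le> 3 powr q * (a powr q + b powr q + (c::real) powr q)"
proof -
  define m where "m = max a (max b c)"
  have "(a + b + c) powr q \<le> (3 * m) powr q" using assms by (intro powr_mono2) (auto simp: m_def)
  also have "\<dots> = 3 powr q * m powr q" using assms by (simp add: powr_mult m_def)
  also have "m powr q \<le> a powr q + b powr q + c powr q" unfolding m_def max_def by (auto simp: add_nonneg_nonneg)
  finally show ?thesis by (simp add: mult_left_mono)
qed

text \<open>
  The bounds are relative to the probability of the truncation event, so that they are bounds
  for the law conditioned on that event.
\<close>

lemma truncated_exponential_moment:
  fixes \<mu> :: "real measure" and \<delta> \<kappa> s :: real
  assumes \<mu>: "real_distribution \<mu>" and \<delta>: "0 < \<delta>"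
    and mean: "(LINT x|\<mu>. indicator {-\<delta>..\<delta>} x * x) = 0"
    and mom: "(LINT x|\<mu>. min 1 ((x / \<delta>)\<^sup>2)) \<le> \<kappa>" and \<kappa>: "\<kappa> \<le> 1/2"
  shows "1 - \<kappa> \<le> measure \<mu> {-\<delta>..\<delta>}"
    and "\<bar>s\<bar> * \<delta> \<le> 1 \<Longrightarrow> (LINT x|\<mu>. indicator {-\<delta>..\<delta>} x * exp (s * x)) \<le> measure \<mu> {-\<delta>..\<delta>} * exp (2 * \<kappa> * (s * \<delta>)\<^sup>2)"
proof -
  interpret real_distribution \<mu> by fact
  let ?A = "{-\<delta>..\<delta>}"
  have imin: "integrable \<mu> (\<lambda>x. min 1 ((x / \<delta>)\<^sup>2))" by (intro integrable_const_bound[of _ 1]) auto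
  have iA: "integrable \<mu> (indicator ?A :: real \<Rightarrow> real)" by (intro integrable_const_bound[of _ 1]) (auto simp: indicator_def)
  have iAx: "integrable \<mu> (\<lambda>x. indicator ?A x * x)" using \<delta> by (intro integrable_const_bound[of _ \<delta>]) (auto simp: indicator_def)
  have "1 - measure \<mu> ?A = (LINT x|\<mu>. 1 - indicator ?A x)" using iA prob_space by simp
  also have "\<dots> \<le> (LINT x|\<mu>. min 1 ((x / \<delta>)\<^sup>2))"
  proof (rule integral_mono)
    fix x :: real
    show "1 - indicator ?A x \<le> min 1 ((x / \<delta>)\<^sup>2)"
    proof (cases "x \<in> ?A")
      case False
      then have "1 \<le> \<bar>x / \<delta>\<bar>" using \<delta> by (auto simp: abs_if field_simps)
      then have "1 \<le> (x / \<delta>)\<^sup>2" by (metis abs_ge_self abs_le_square_iff abs_one one_power2 order_trans power2_abs)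
      then show ?thesis using False by simp
    qed simp
  qed (use imin iA in auto)
  finally show p: "1 - \<kappa> \<le> measure \<mu> ?A" using mom by linarith
  assume s: "\<bar>s\<bar> * \<delta> \<le> 1"
  have "(LINT x|\<mu>. indicator ?A x * exp (s * x)) \<le> (LINT x|\<mu>. indicator ?A x + s * (indicator ?A x * x) + (s * \<delta>)\<^sup>2 * min 1 ((x / \<delta>)\<^sup>2))"
  proof (rule integral_mono)
    have "exp (s * x) \<le> exp 1" if "x \<in> ?A" for x
    proof -
      have "s * x \<le> \<bar>s\<bar> * \<bar>x\<bar>" by (metis abs_ge_self abs_mult)
      also have "\<dots> \<le> \<bar>s\<bar> * \<delta>" using that by (intro mult_left_mono) auto
      finally show ?thesis using s by simp
    qed
    then show "integrable \<mu> (\<lambda>x. indicator ?A x * exp (s * x))"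
      by (intro integrable_const_bound[of _ "exp 1"]) (auto simp: indicator_def)
    show "integrable \<mu> (\<lambda>x. indicator ?A x + s * (indicator ?A x * x) + (s * \<delta>)\<^sup>2 * min 1 ((x / \<delta>)\<^sup>2))"
      using imin iA iAx by auto
    fix x :: real
    show "indicator ?A x * exp (s * x) \<le> indicator ?A x + s * (indicator ?A x * x) + (s * \<delta>)\<^sup>2 * min 1 ((x / \<delta>)\<^sup>2)"
    proof (cases "x \<in> ?A")
      case True
      have "\<bar>s * x\<bar> \<le> \<bar>s\<bar> * \<delta>" unfolding abs_mult using True by (intro mult_left_mono) auto
      then have "exp (s * x) \<le> 1 + s * x + (s * x)\<^sup>2" using s by (intro exp_le_quadratic) auto
      moreover have "(x / \<delta>)\<^sup>2 \<le> 1" unfolding abs_square_le_1 using True \<delta> by (auto simp: abs_le_iff field_simps)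
      then have "(s * \<delta>)\<^sup>2 * min 1 ((x / \<delta>)\<^sup>2) = (s * x)\<^sup>2" using \<delta> by (simp add: power_mult_distrib power_divide)
      ultimately show ?thesis using True by simp
    qed simp
  qed
  also have "\<dots> = measure \<mu> ?A + (s * \<delta>)\<^sup>2 * (LINT x|\<mu>. min 1 ((x / \<delta>)\<^sup>2))"
    using imin iA iAx mean by simp
  also have "\<dots> \<le> measure \<mu> ?A + (s * \<delta>)\<^sup>2 * \<kappa>" using mom by (intro add_left_mono mult_left_mono) auto
  also have "\<dots> \<le> measure \<mu> ?A * (1 + 2 * \<kappa> * (s * \<delta>)\<^sup>2)"
  proof -
    have "0 \<le> (LINT x|\<mu>. min 1 ((x / \<delta>)\<^sup>2))" by (intro Bochner_Integration.integral_nonneg) auto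
    then have "0 \<le> \<kappa>" using mom by linarith
    then have "1 * (\<kappa> * (s * \<delta>)\<^sup>2) \<le> (2 * measure \<mu> ?A) * (\<kappa> * (s * \<delta>)\<^sup>2)" using p \<kappa> by (intro mult_right_mono) auto
    then show ?thesis by (simp add: algebra_simps)
  qed
  also have "\<dots> \<le> measure \<mu> ?A * exp (2 * \<kappa> * (s * \<delta>)\<^sup>2)"
    by (intro mult_left_mono exp_ge_add_one_self) auto
  finally show "(LINT x|\<mu>. indicator ?A x * exp (s * x)) \<le> measure \<mu> ?A * exp (2 * \<kappa> * (s * \<delta>)\<^sup>2)" .
qed

lemma truncated_sum_exponential_moment:
  fixes \<mu> :: "real measure" and I :: "'c set" and \<delta> \<kappa> s :: real
  assumes \<mu>: "real_distribution \<mu>" and \<delta>: "0 < \<delta>"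
    and mean: "(LINT x|\<mu>. indicator {-\<delta>..\<delta>} x * x) = 0"
    and mom: "(LINT x|\<mu>. min 1 ((x / \<delta>)\<^sup>2)) \<le> \<kappa>" and \<kappa>: "\<kappa> \<le> 1/2"
    and I: "finite I" and H: "H \<subseteq> I" and s: "\<bar>s\<bar> * \<delta> \<le> 1"
  shows "(LINT \<omega>|Pi\<^sub>M I (\<lambda>_. \<mu>). (\<Prod>c\<in>I. indicator {-\<delta>..\<delta>} (\<omega> c)) * exp (s * (\<Sum>c\<in>H. \<omega> c)))
     \<le> measure \<mu> {-\<delta>..\<delta>} ^ card I * exp (2 * \<kappa> * (s * \<delta>)\<^sup>2 * card H)"
proof -
  interpret \<mu>: real_distribution \<mu> by fact
  interpret product_prob_space "\<lambda>_. \<mu>" I ..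
  let ?A = "{-\<delta>..\<delta>}"
  define f where "f c x = indicator ?A x * (if c \<in> H then exp (s * x) else 1)" for c :: 'c and x :: real
  have fint: "integrable \<mu> (f c)" for c
  proof -
    have "exp (s * x) \<le> exp 1" if "x \<in> ?A" for x
    proof -
      have "s * x \<le> \<bar>s\<bar> * \<bar>x\<bar>" by (metis abs_ge_self abs_mult)
      also have "\<dots> \<le> \<bar>s\<bar> * \<delta>" using that by (intro mult_left_mono) auto
      finally show ?thesis using s by simp
    qed
    then show ?thesis unfolding f_def
      by (intro \<mu>.integrable_const_bound[of _ "exp 1"]) (auto simp: indicator_def)
  qed
  have "(\<Prod>c\<in>I. indicator ?A (\<omega> c)) * exp (s * (\<Sum>c\<in>H. \<omega> c)) = (\<Prod>c\<in>I. f c (\<omega> c))" for \<omega>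
  proof -
    have "exp (s * (\<Sum>c\<in>H. \<omega> c)) = (\<Prod>c\<in>H. exp (s * \<omega> c))"
      using finite_subset[OF H I] by (simp add: sum_distrib_left exp_sum)
    also have "\<dots> = (\<Prod>c\<in>I. if c \<in> H then exp (s * \<omega> c) else 1)"
      using I H by (simp add: prod.If_cases Int_absorb1)
    finally show ?thesis by (simp add: f_def prod.distrib)
  qed
  then have "(LINT \<omega>|Pi\<^sub>M I (\<lambda>_. \<mu>). (\<Prod>c\<in>I. indicator ?A (\<omega> c)) * exp (s * (\<Sum>c\<in>H. \<omega> c))) = (\<Prod>c\<in>I. integral\<^sup>L \<mu> (f c))"
    using product_integral_prod[OF I, of f] fint by simp
  also have "\<dots> \<le> (\<Prod>c\<in>I. measure \<mu> ?A * (if c \<in> H then exp (2 * \<kappa> * (s * \<delta>)\<^sup>2) else 1))"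
  proof (rule prod_mono, intro conjI)
    fix c assume "c \<in> I"
    show "0 \<le> integral\<^sup>L \<mu> (f c)" by (intro Bochner_Integration.integral_nonneg) (auto simp: f_def)
    show "integral\<^sup>L \<mu> (f c) \<le> measure \<mu> ?A * (if c \<in> H then exp (2 * \<kappa> * (s * \<delta>)\<^sup>2) else 1)"
      using truncated_exponential_moment(2)[OF \<mu> \<delta> mean mom \<kappa> s] by (auto simp: f_def[abs_def])
  qed
  also have "\<dots> = measure \<mu> ?A ^ card I * exp (2 * \<kappa> * (s * \<delta>)\<^sup>2) ^ card H"
    using I H by (simp add: prod.distrib prod.If_cases Int_absorb1)
  also have "exp (2 * \<kappa> * (s * \<delta>)\<^sup>2) ^ card H = exp (2 * \<kappa> * (s * \<delta>)\<^sup>2 * card H)"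
    by (metis exp_of_nat2_mult)
  finally show ?thesis .
qed

section \<open>The pigeonhole argument\<close>

text \<open>
  The pigeonhole argument, for sums \<open>\<Sum>c\<in>D x. \<omega> c\<close> of independent variables. Each index set \<open>D x\<close>
  splits into a part \<open>H x\<close> over which the sum is small with large probability and at most \<open>b\<close> blocks
  \<open>R l\<close> from a common finite family. The truncation to \<open>[-\<delta>, \<delta>]\<close>, the bound \<open>\<rho>\<close> on all block sums and the
  bound on the mean \<open>q\<close>-th power over \<open>H x\<close> hold together on an event \<open>G\<close> of at least half the mass of the
  truncation event. Rounding the block sums to multiples of \<open>e / b\<close> partitions \<open>G\<close>, and two points of the
  same class have sums that differ by at most \<open>e\<close> apart from the contributions of \<open>H x\<close>.
\<close>

lemma small_ball_of_two_scale_decomposition: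
  fixes \<mu> :: "real measure" and I :: "'c set" and D H :: "'x \<Rightarrow> 'c set" and R :: "'l \<Rightarrow> 'c set" and J :: "'x \<Rightarrow> 'l set"
    and \<delta> \<kappa> e \<rho> q K :: real and b :: nat
  assumes \<mu>: "real_distribution \<mu>" and \<delta>: "0 < \<delta>" "\<delta> \<le> 1"
    and mean: "(LINT x|\<mu>. indicator {-\<delta>..\<delta>} x * x) = 0"
    and mom: "(LINT x|\<mu>. min 1 ((x / \<delta>)\<^sup>2)) \<le> \<kappa>" and \<kappa>: "\<kappa> \<le> 1/2"
    and I: "finite I" and X: "finite X" and \<Lambda>: "finite \<Lambda>"
    and H: "\<And>x. x \<in> X \<Longrightarrow> H x \<subseteq> I" and R: "\<And>l. l \<in> \<Lambda> \<Longrightarrow> R l \<subseteq> I"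
    and J: "\<And>x. x \<in> X \<Longrightarrow> J x \<subseteq> \<Lambda>" "\<And>x. x \<in> X \<Longrightarrow> card (J x) \<le> b" and b: "0 < b"
    and dec: "\<And>x f. x \<in> X \<Longrightarrow> (\<Sum>c\<in>D x. f c) = (\<Sum>c\<in>H x. f c) + (\<Sum>l\<in>J x. \<Sum>c\<in>R l. f c :: real)"
    and e: "\<delta> \<le> e" and q: "0 < q"
    and KR: "\<And>l. l \<in> \<Lambda> \<Longrightarrow> 2 * \<kappa> * \<delta>\<^sup>2 * card (R l) \<le> K"
    and KH: "\<And>x. x \<in> X \<Longrightarrow> 2 * \<kappa> * \<delta>\<^sup>2 * card (H x) \<le> K * e\<^sup>2"
    and \<rho>: "0 \<le> \<rho>" "8 * card \<Lambda> * exp K \<le> exp \<rho>"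
  shows "(measure \<mu> {-\<delta>..\<delta>} ^ card I / (2 * (2 * \<rho> * b / e + 2) ^ card \<Lambda>))\<^sup>2 \<le>
    measure (Pi\<^sub>M I (\<lambda>_. \<mu>) \<Otimes>\<^sub>M Pi\<^sub>M I (\<lambda>_. \<mu>))
      {w \<in> space (Pi\<^sub>M I (\<lambda>_. \<mu>) \<Otimes>\<^sub>M Pi\<^sub>M I (\<lambda>_. \<mu>)). (\<Sum>x\<in>X. \<bar>\<Sum>c\<in>D x. fst w c - snd w c\<bar> powr q)
         \<le> card X * (3 powr q * (16 * q powr q * exp K + 1) * e powr q)}"
proof -
  interpret \<mu>: real_distribution \<mu> by fact
  let ?A = "{-\<delta>..\<delta>}"
  define P where "P = Pi\<^sub>M I (\<lambda>_. \<mu>)"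
  interpret P: prob_space P unfolding P_def by (intro prob_space_PiM) (rule \<mu>.prob_space_axioms)
  interpret PP: pair_prob_space P P ..
  define p where "p = measure \<mu> ?A ^ card I"
  define \<psi> :: "('c \<Rightarrow> real) \<Rightarrow> real" where "\<psi> \<omega> = (\<Prod>c\<in>I. indicator ?A (\<omega> c))" for \<omega>
  define Y where "Y l \<omega> = (\<Sum>c\<in>R l. \<omega> c)" for l and \<omega> :: "'c \<Rightarrow> real"
  define W where "W x \<omega> = (\<Sum>c\<in>H x. \<omega> c)" for x and \<omega> :: "'c \<Rightarrow> real"
  \<comment> \<open>chosen such that Markov's inequality bounds the mass of \<open>BH\<close> by \<open>p / 4\<close>\<close>
  define B where "B = 8 * q powr q * exp K"
  have e0: "0 < e" using \<delta> e by simp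
  have B0: "0 < B" using q by (simp add: B_def)
  have [measurable]: "(\<lambda>\<omega>. \<omega> c) \<in> borel_measurable P" if "c \<in> I" for c
    unfolding P_def using that measurable_component_singleton[of c I "\<lambda>_. \<mu>"] by simp
  have sumI[measurable]: "(\<lambda>\<omega>. \<Sum>c\<in>T. \<omega> c) \<in> borel_measurable P" if "T \<subseteq> I" for T
    using that by (intro borel_measurable_sum) auto
  have Wm[measurable]: "x \<in> X \<Longrightarrow> W x \<in> borel_measurable P" for x unfolding W_def using H by (intro sumI) auto
  have Ym[measurable]: "l \<in> \<Lambda> \<Longrightarrow> Y l \<in> borel_measurable P" for l unfolding Y_def using R by (intro sumI) auto
  have \<psi>m[measurable]: "\<psi> \<in> borel_measurable P" unfolding \<psi>_def by measurable
  have \<psi>01: "0 \<le> \<psi> \<omega>" "\<psi> \<omega> \<le> 1" "\<psi> \<omega> = 0 \<or> \<psi> \<omega> = 1" for \<omega>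
  proof -
    show "\<psi> \<omega> = 0 \<or> \<psi> \<omega> = 1"
    proof (cases "\<forall>c\<in>I. \<omega> c \<in> ?A")
      case False
      then show ?thesis unfolding \<psi>_def using I by (metis indicator_simps(2) prod_zero)
    qed (simp add: \<psi>_def)
    then show "0 \<le> \<psi> \<omega>" "\<psi> \<omega> \<le> 1" by auto
  qed
  have \<psi>_bd: "\<bar>\<omega> c\<bar> \<le> \<delta>" if "\<psi> \<omega> = 1" "c \<in> I" for \<omega> c
  proof -
    have "indicator ?A (\<omega> c) \<noteq> (0::real)" using that I unfolding \<psi>_def by (metis prod_zero_iff zero_neq_one)
    then show ?thesis by (auto simp: indicator_def split: if_splits)
  qed
  have \<psi>int: "integrable P (\<lambda>\<omega>. \<psi> \<omega> * exp (s * (\<Sum>c\<in>T. \<omega> c)))" if "T \<subseteq> I" for T s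
  proof (rule P.integrable_const_bound[of _ "exp (\<bar>s\<bar> * (\<Sum>c\<in>T. \<delta>))"])
    show "AE \<omega> in P. norm (\<psi> \<omega> * exp (s * (\<Sum>c\<in>T. \<omega> c))) \<le> exp (\<bar>s\<bar> * (\<Sum>c\<in>T. \<delta>))"
    proof (rule AE_I2)
      fix \<omega>
      show "norm (\<psi> \<omega> * exp (s * (\<Sum>c\<in>T. \<omega> c))) \<le> exp (\<bar>s\<bar> * (\<Sum>c\<in>T. \<delta>))"
      proof (cases "\<psi> \<omega> = 1")
        case True
        have "\<bar>\<Sum>c\<in>T. \<omega> c\<bar> \<le> (\<Sum>c\<in>T. \<bar>\<omega> c\<bar>)" by (rule sum_abs)
        also have "\<dots> \<le> (\<Sum>c\<in>T. \<delta>)" using \<psi>_bd[OF True] that by (intro sum_mono) auto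
        finally have "\<bar>s\<bar> * \<bar>\<Sum>c\<in>T. \<omega> c\<bar> \<le> \<bar>s\<bar> * (\<Sum>c\<in>T. \<delta>)" by (intro mult_left_mono) auto
        moreover have "s * (\<Sum>c\<in>T. \<omega> c) \<le> \<bar>s\<bar> * \<bar>\<Sum>c\<in>T. \<omega> c\<bar>" by (metis abs_ge_self abs_mult)
        ultimately show ?thesis using True by simp
      qed (use \<psi>01(3)[of \<omega>] in auto)
    qed
  qed (use sumI[OF that] in measurable)
  have expm: "(LINT \<omega>|P. \<psi> \<omega> * exp (s * (\<Sum>c\<in>T. \<omega> c))) \<le> p * exp (2 * \<kappa> * (s * \<delta>)\<^sup>2 * card T)"
    if "T \<subseteq> I" "\<bar>s\<bar> * \<delta> \<le> 1" for T s
    unfolding P_def p_def \<psi>_def by (rule truncated_sum_exponential_moment[OF \<mu> \<delta>(1) mean mom \<kappa> I that])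
  have absint: "integrable P (\<lambda>\<omega>. \<psi> \<omega> * exp \<bar>s * (\<Sum>c\<in>T. \<omega> c)\<bar>)" if "T \<subseteq> I" for T s
  proof (rule Bochner_Integration.integrable_bound)
    show "integrable P (\<lambda>\<omega>. \<psi> \<omega> * exp (s * (\<Sum>c\<in>T. \<omega> c)) + \<psi> \<omega> * exp ((-s) * (\<Sum>c\<in>T. \<omega> c)))"
      using \<psi>int[OF that, of s] \<psi>int[OF that, of "-s"] by (intro Bochner_Integration.integrable_add) auto
    show "AE \<omega> in P. norm (\<psi> \<omega> * exp \<bar>s * (\<Sum>c\<in>T. \<omega> c)\<bar>) \<le> norm (\<psi> \<omega> * exp (s * (\<Sum>c\<in>T. \<omega> c)) + \<psi> \<omega> * exp ((-s) * (\<Sum>c\<in>T. \<omega> c)))"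
    proof (rule AE_I2)
      fix \<omega>
      show "norm (\<psi> \<omega> * exp \<bar>s * (\<Sum>c\<in>T. \<omega> c)\<bar>) \<le> norm (\<psi> \<omega> * exp (s * (\<Sum>c\<in>T. \<omega> c)) + \<psi> \<omega> * exp ((-s) * (\<Sum>c\<in>T. \<omega> c)))"
        using \<psi>01(3)[of \<omega>] exp_gt_zero[of "s * (\<Sum>c\<in>T. \<omega> c)"] exp_gt_zero[of "(-s) * (\<Sum>c\<in>T. \<omega> c)"]
          by (auto simp: abs_if simp del: exp_gt_zero)
    qed
  qed (use sumI[OF that] in measurable)
  \<comment> \<open>\<open>exp \<bar>w\<bar> \<le> exp w + exp (-w)\<close>, and the one-sided bound holds for both signs\<close>
  have absexp: "(LINT \<omega>|P. \<psi> \<omega> * exp \<bar>s * (\<Sum>c\<in>T. \<omega> c)\<bar>) \<le> 2 * p * exp (2 * \<kappa> * (s * \<delta>)\<^sup>2 * card T)"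
    if "T \<subseteq> I" "\<bar>s\<bar> * \<delta> \<le> 1" for T s
  proof -
    have "(LINT \<omega>|P. \<psi> \<omega> * exp \<bar>s * (\<Sum>c\<in>T. \<omega> c)\<bar>) \<le> (LINT \<omega>|P. \<psi> \<omega> * exp (s * (\<Sum>c\<in>T. \<omega> c)) + \<psi> \<omega> * exp ((-s) * (\<Sum>c\<in>T. \<omega> c)))"
    proof (rule integral_mono[OF absint[OF that(1)]])
      show "integrable P (\<lambda>\<omega>. \<psi> \<omega> * exp (s * (\<Sum>c\<in>T. \<omega> c)) + \<psi> \<omega> * exp ((-s) * (\<Sum>c\<in>T. \<omega> c)))"
        using \<psi>int[OF that(1), of s] \<psi>int[OF that(1), of "-s"] by (intro Bochner_Integration.integrable_add) auto
      fix \<omega>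
      show "\<psi> \<omega> * exp \<bar>s * (\<Sum>c\<in>T. \<omega> c)\<bar> \<le> \<psi> \<omega> * exp (s * (\<Sum>c\<in>T. \<omega> c)) + \<psi> \<omega> * exp ((-s) * (\<Sum>c\<in>T. \<omega> c))"
        using \<psi>01[of \<omega>] by (auto simp: abs_if)
    qed
    also have "\<dots> = (LINT \<omega>|P. \<psi> \<omega> * exp (s * (\<Sum>c\<in>T. \<omega> c))) + (LINT \<omega>|P. \<psi> \<omega> * exp ((-s) * (\<Sum>c\<in>T. \<omega> c)))"
      using \<psi>int[OF that(1), of s] \<psi>int[OF that(1), of "-s"] by (intro Bochner_Integration.integral_add) auto
    also have "\<dots> \<le> p * exp (2 * \<kappa> * (s * \<delta>)\<^sup>2 * card T) + p * exp (2 * \<kappa> * ((-s) * \<delta>)\<^sup>2 * card T)"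
      using expm[of T s] expm[of T "-s"] that by (intro add_mono) auto
    finally show ?thesis by simp
  qed
  have mass: "(LINT \<omega>|P. \<psi> \<omega>) = p"
  proof -
    interpret prod: product_prob_space "\<lambda>_::'c. \<mu>" I ..
    have "integrable \<mu> (indicator ?A :: real \<Rightarrow> real)" by (intro \<mu>.integrable_const_bound[of _ 1]) (auto simp: indicator_def)
    then show ?thesis unfolding \<psi>_def P_def p_def
      using prod.product_integral_prod[OF I, of "\<lambda>_. indicator ?A :: real \<Rightarrow> real"] by simp
  qed
  have p0: "0 \<le> p" by (simp add: p_def)
  define BL where "BL l = {\<omega> \<in> space P. \<rho> < \<bar>Y l \<omega>\<bar>}" for l
  define BH where "BH = {\<omega> \<in> space P. card X * (B * e powr q) < (\<Sum>x\<in>X. \<bar>W x \<omega>\<bar> powr q)}"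
  define G where "G = {\<omega> \<in> space P. \<psi> \<omega> = 1 \<and> (\<forall>l\<in>\<Lambda>. \<bar>Y l \<omega>\<bar> \<le> \<rho>) \<and> (\<Sum>x\<in>X. \<bar>W x \<omega>\<bar> powr q) \<le> card X * (B * e powr q)}"
  have BLs[measurable]: "l \<in> \<Lambda> \<Longrightarrow> BL l \<in> sets P" for l unfolding BL_def by measurable
  have BHs[measurable]: "BH \<in> sets P" unfolding BH_def by measurable
  have Gs[measurable]: "G \<in> sets P" unfolding G_def using \<Lambda> by measurable
  have ind_int: "integrable P (\<lambda>\<omega>. \<psi> \<omega> * indicator T \<omega>)" if [measurable]: "T \<in> sets P" for T
    using \<psi>01 by (intro P.integrable_const_bound[of _ 1]) (auto simp: indicator_def)
  have boundL: "(LINT \<omega>|P. \<psi> \<omega> * indicator (BL l) \<omega>) \<le> 2 * p * exp (K - \<rho>)" if l: "l \<in> \<Lambda>" for l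
  proof -
    have "(LINT \<omega>|P. \<psi> \<omega> * indicator (BL l) \<omega>) \<le> (LINT \<omega>|P. (\<psi> \<omega> * exp \<bar>1 * (\<Sum>c\<in>R l. \<omega> c)\<bar>) * exp (-\<rho>))"
    proof (rule integral_mono[OF ind_int[OF BLs[OF l]]])
      show "integrable P (\<lambda>\<omega>. (\<psi> \<omega> * exp \<bar>1 * (\<Sum>c\<in>R l. \<omega> c)\<bar>) * exp (-\<rho>))"
        using absint[OF R[OF l], of 1] by (intro integrable_mult_left) auto
      fix \<omega>
      have "indicator (BL l) \<omega> \<le> exp (\<bar>1 * (\<Sum>c\<in>R l. \<omega> c)\<bar> - \<rho>)"
        by (auto simp: indicator_def BL_def Y_def)
      then have "\<psi> \<omega> * indicator (BL l) \<omega> \<le> \<psi> \<omega> * exp (\<bar>1 * (\<Sum>c\<in>R l. \<omega> c)\<bar> - \<rho>)"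
        using \<psi>01 by (intro mult_left_mono) auto
      then show "\<psi> \<omega> * indicator (BL l) \<omega> \<le> (\<psi> \<omega> * exp \<bar>1 * (\<Sum>c\<in>R l. \<omega> c)\<bar>) * exp (-\<rho>)"
        by (simp add: exp_diff exp_minus divide_inverse mult.assoc)
    qed
    also have "\<dots> = (LINT \<omega>|P. (\<psi> \<omega> * exp \<bar>1 * (\<Sum>c\<in>R l. \<omega> c)\<bar>)) * exp (-\<rho>)" by simp
    also have "\<dots> \<le> 2 * p * exp (2 * \<kappa> * (1 * \<delta>)\<^sup>2 * card (R l)) * exp (-\<rho>)"
      using absexp[OF R[OF l], of 1] \<delta> by (intro mult_right_mono) auto
    also have "\<dots> \<le> 2 * p * exp K * exp (-\<rho>)"
      using KR[OF l] p0 by (intro mult_right_mono mult_left_mono) auto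
    finally show ?thesis by (simp add: exp_diff exp_minus divide_inverse)
  qed
  have boundH: "(LINT \<omega>|P. \<psi> \<omega> * indicator BH \<omega>) \<le> p / 4"
  proof (cases "X = {}")
    case True
    then have "BH = {}" by (simp add: BH_def)
    then show ?thesis using p0 by simp
  next
    case False
    then have cX: "0 < card X" using X by auto
    let ?F = "\<lambda>\<omega>. \<Sum>x\<in>X. \<psi> \<omega> * exp \<bar>(1/e) * (\<Sum>c\<in>H x. \<omega> c)\<bar>"
    have iF: "integrable P ?F" by (rule Bochner_Integration.integrable_sum, rule absint[OF H])
    have "(LINT \<omega>|P. \<psi> \<omega> * indicator BH \<omega>) \<le> (LINT \<omega>|P. ?F \<omega> * (q powr q / (card X * B)))"
    proof (rule integral_mono[OF ind_int[OF BHs]])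
      show "integrable P (\<lambda>\<omega>. ?F \<omega> * (q powr q / (card X * B)))" using iF by (intro integrable_mult_left)
      fix \<omega>
      have "\<bar>W x \<omega>\<bar> powr q \<le> e powr q * (q powr q * exp \<bar>(1/e) * (\<Sum>c\<in>H x. \<omega> c)\<bar>)" for x
      proof -
        have "\<bar>W x \<omega>\<bar> powr q = e powr q * \<bar>(1/e) * (\<Sum>c\<in>H x. \<omega> c)\<bar> powr q"
          using e0 by (simp add: W_def abs_mult powr_divide)
        also have "\<dots> \<le> e powr q * (q powr q * exp \<bar>(1/e) * (\<Sum>c\<in>H x. \<omega> c)\<bar>)"
          by (intro mult_left_mono powr_le_exp q) simp
        finally show ?thesis .
      qed
      then have le: "(\<Sum>x\<in>X. \<bar>W x \<omega>\<bar> powr q) \<le> e powr q * (q powr q * (\<Sum>x\<in>X. exp \<bar>(1/e) * (\<Sum>c\<in>H x. \<omega> c)\<bar>))"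
        unfolding sum_distrib_left by (intro sum_mono)
      have "indicator BH \<omega> \<le> (\<Sum>x\<in>X. exp \<bar>(1/e) * (\<Sum>c\<in>H x. \<omega> c)\<bar>) * (q powr q / (card X * B))"
      proof (cases "\<omega> \<in> BH")
        case True
        then have "e powr q * (card X * B) \<le> e powr q * (q powr q * (\<Sum>x\<in>X. exp \<bar>(1/e) * (\<Sum>c\<in>H x. \<omega> c)\<bar>))"
          using le by (simp add: BH_def mult_ac)
        then have "card X * B \<le> q powr q * (\<Sum>x\<in>X. exp \<bar>(1/e) * (\<Sum>c\<in>H x. \<omega> c)\<bar>)"
          using e0 by (simp add: mult_le_cancel_left)
        then show ?thesis using True B0 cX by (simp add: field_simps)
      qed (use B0 in \<open>auto intro!: mult_nonneg_nonneg divide_nonneg_nonneg sum_nonneg\<close>)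
      then have "\<psi> \<omega> * indicator BH \<omega> \<le> \<psi> \<omega> * ((\<Sum>x\<in>X. exp \<bar>(1/e) * (\<Sum>c\<in>H x. \<omega> c)\<bar>) * (q powr q / (card X * B)))"
        using \<psi>01 by (intro mult_left_mono) auto
      then show "\<psi> \<omega> * indicator BH \<omega> \<le> ?F \<omega> * (q powr q / (card X * B))"
        by (simp only: sum_distrib_left[symmetric] mult.assoc)
    qed
    also have "\<dots> = (\<Sum>x\<in>X. LINT \<omega>|P. \<psi> \<omega> * exp \<bar>(1/e) * (\<Sum>c\<in>H x. \<omega> c)\<bar>) * (q powr q / (card X * B))"
      by (subst integral_mult_left_zero, subst Bochner_Integration.integral_sum, rule absint[OF H], assumption, rule refl)
    also have "\<dots> \<le> (\<Sum>x\<in>X. 2 * p * exp K) * (q powr q / (card X * B))"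
    proof (intro mult_right_mono sum_mono)
      fix x assume x: "x \<in> X"
      have "(LINT \<omega>|P. \<psi> \<omega> * exp \<bar>(1/e) * (\<Sum>c\<in>H x. \<omega> c)\<bar>) \<le> 2 * p * exp (2 * \<kappa> * ((1/e) * \<delta>)\<^sup>2 * card (H x))"
        using e e0 by (intro absexp[OF H[OF x]]) auto
      also have "2 * \<kappa> * ((1/e) * \<delta>)\<^sup>2 * card (H x) \<le> K"
        using KH[OF x] e0 by (simp add: power_divide field_simps)
      finally show "(LINT \<omega>|P. \<psi> \<omega> * exp \<bar>(1/e) * (\<Sum>c\<in>H x. \<omega> c)\<bar>) \<le> 2 * p * exp K" using p0 by (simp add: mult_left_mono)
    qed (use B0 in auto)
    also have "\<dots> = p / 4" using cX q by (simp add: B_def field_simps)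
    finally show ?thesis .
  qed
  have "p \<le> measure P G + (\<Sum>l\<in>\<Lambda>. LINT \<omega>|P. \<psi> \<omega> * indicator (BL l) \<omega>) + (LINT \<omega>|P. \<psi> \<omega> * indicator BH \<omega>)"
  proof -
    have iG: "integrable P (indicator G :: _ \<Rightarrow> real)" by (intro P.integrable_const_bound[of _ 1]) (auto simp: indicator_def)
    have "p \<le> (LINT \<omega>|P. indicator G \<omega> + (\<Sum>l\<in>\<Lambda>. \<psi> \<omega> * indicator (BL l) \<omega>) + \<psi> \<omega> * indicator BH \<omega>)"
      unfolding mass[symmetric]
    proof (rule integral_mono)
      show "integrable P \<psi>" using \<psi>01 by (intro P.integrable_const_bound[of _ 1]) auto
      show "integrable P (\<lambda>\<omega>. indicator G \<omega> + (\<Sum>l\<in>\<Lambda>. \<psi> \<omega> * indicator (BL l) \<omega>) + \<psi> \<omega> * indicator BH \<omega>)"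
        using ind_int iG by (intro Bochner_Integration.integrable_add Bochner_Integration.integrable_sum) auto
      fix \<omega> assume sp: "\<omega> \<in> space P"
      have nn: "0 \<le> (\<Sum>l\<in>\<Lambda>. \<psi> \<omega> * indicator (BL l) \<omega>)" using \<psi>01 by (intro sum_nonneg) auto
      consider "\<psi> \<omega> = 0" | "\<psi> \<omega> = 1" "\<omega> \<in> G" | "\<psi> \<omega> = 1" "\<omega> \<in> BH" | l where "\<psi> \<omega> = 1" "l \<in> \<Lambda>" "\<omega> \<in> BL l"
        using \<psi>01(3)[of \<omega>] sp unfolding G_def BH_def BL_def by fastforce
      then show "\<psi> \<omega> \<le> indicator G \<omega> + (\<Sum>l\<in>\<Lambda>. \<psi> \<omega> * indicator (BL l) \<omega>) + \<psi> \<omega> * indicator BH \<omega>"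
      proof cases
        case 4
        then have "1 \<le> (\<Sum>l\<in>\<Lambda>. \<psi> \<omega> * indicator (BL l) \<omega>)"
          using member_le_sum[of l \<Lambda> "\<lambda>l. \<psi> \<omega> * indicator (BL l) \<omega>"] \<Lambda> \<psi>01 by auto
        moreover have "0 \<le> (indicator G \<omega> :: real)" "0 \<le> \<psi> \<omega> * indicator BH \<omega>" using \<psi>01 by simp_all
        ultimately show ?thesis using 4(1) by linarith
      qed (use nn in auto)
    qed
    also have "\<dots> = measure P G + (\<Sum>l\<in>\<Lambda>. LINT \<omega>|P. \<psi> \<omega> * indicator (BL l) \<omega>) + (LINT \<omega>|P. \<psi> \<omega> * indicator BH \<omega>)"
      using ind_int iG by (subst Bochner_Integration.integral_add Bochner_Integration.integral_sum; auto)+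
    finally show ?thesis .
  qed
  also have "\<dots> \<le> measure P G + (\<Sum>l\<in>\<Lambda>. 2 * p * exp (K - \<rho>)) + p / 4"
    using boundL boundH by (intro add_mono sum_mono) auto
  also have "(\<Sum>l\<in>\<Lambda>. 2 * p * exp (K - \<rho>)) \<le> p / 4"
  proof -
    have "8 * card \<Lambda> * exp (K - \<rho>) \<le> 1" using \<rho> by (simp add: exp_diff field_simps)
    then have "p * (8 * card \<Lambda> * exp (K - \<rho>)) \<le> p * 1" using p0 by (intro mult_left_mono)
    then show ?thesis by (simp add: mult_ac)
  qed
  finally have PG: "p / 2 \<le> measure P G" by simp
  define \<eta> where "\<eta> = e / b"
  have \<eta>: "0 < \<eta>" using e0 b by (simp add: \<eta>_def)
  define C where "C = PiE \<Lambda> (\<lambda>_. {\<lfloor>-\<rho>/\<eta>\<rfloor>..\<lfloor>\<rho>/\<eta>\<rfloor>})"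
  define code where "code \<omega> = (\<lambda>l\<in>\<Lambda>. \<lfloor>Y l \<omega> / \<eta>\<rfloor>)" for \<omega>
  define Gk where "Gk k = {\<omega> \<in> G. \<forall>l\<in>\<Lambda>. \<lfloor>Y l \<omega> / \<eta>\<rfloor> = k l}" for k :: "'l \<Rightarrow> int"
  have Gks[measurable]: "Gk k \<in> sets P" for k
  proof -
    have "Gk k = G \<inter> {\<omega> \<in> space P. \<forall>l\<in>\<Lambda>. \<lfloor>Y l \<omega> / \<eta>\<rfloor> = k l}" unfolding Gk_def G_def by auto
    also have "\<dots> \<in> sets P" using \<Lambda> by measurable
    finally show ?thesis .
  qed
  have finC: "finite C" unfolding C_def using \<Lambda> by (intro finite_PiE) auto
  have cardC: "real (card C) \<le> (2 * \<rho> * b / e + 2) ^ card \<Lambda>"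
  proof -
    have "real (card {\<lfloor>-\<rho>/\<eta>\<rfloor>..\<lfloor>\<rho>/\<eta>\<rfloor>}) \<le> 2 * \<rho> * b / e + 2"
    proof -
      have "-\<rho>/\<eta> \<le> \<rho>/\<eta>" using \<rho> \<eta> by (intro divide_right_mono) auto
      then have "\<lfloor>-\<rho>/\<eta>\<rfloor> \<le> \<lfloor>\<rho>/\<eta>\<rfloor>" by (rule floor_mono)
      then have "real (card {\<lfloor>-\<rho>/\<eta>\<rfloor>..\<lfloor>\<rho>/\<eta>\<rfloor>}) = \<lfloor>\<rho>/\<eta>\<rfloor> + 1 - \<lfloor>-\<rho>/\<eta>\<rfloor>" by (simp add: of_nat_nat)
      also have "\<dots> \<le> \<rho>/\<eta> + 1 - (-\<rho>/\<eta> - 1)" by linarith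
      also have "\<dots> = 2 * \<rho> * b / e + 2" by (simp add: \<eta>_def)
      finally show ?thesis .
    qed
    then have "real (card {\<lfloor>-\<rho>/\<eta>\<rfloor>..\<lfloor>\<rho>/\<eta>\<rfloor>}) ^ card \<Lambda> \<le> (2 * \<rho> * b / e + 2) ^ card \<Lambda>"
      by (intro power_mono) auto
    then show ?thesis unfolding C_def using \<Lambda> by (simp add: card_PiE)
  qed
  have GU: "G = (\<Union>k\<in>C. Gk k)"
  proof
    show "G \<subseteq> (\<Union>k\<in>C. Gk k)"
    proof
      fix \<omega> assume w: "\<omega> \<in> G"
      have "\<lfloor>-\<rho>/\<eta>\<rfloor> \<le> \<lfloor>Y l \<omega> / \<eta>\<rfloor> \<and> \<lfloor>Y l \<omega> / \<eta>\<rfloor> \<le> \<lfloor>\<rho>/\<eta>\<rfloor>" if "l \<in> \<Lambda>" for l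
      proof -
        have "-\<rho> \<le> Y l \<omega>" "Y l \<omega> \<le> \<rho>" using w that by (force simp: G_def abs_le_iff)+
        then show ?thesis using \<eta> by (intro conjI floor_mono divide_right_mono) auto
      qed
      then have "code \<omega> \<in> C" unfolding C_def code_def by auto
      moreover have "\<omega> \<in> Gk (code \<omega>)" using w by (auto simp: Gk_def code_def)
      ultimately show "\<omega> \<in> (\<Union>k\<in>C. Gk k)" by blast
    qed
  qed (auto simp: Gk_def)
  \<comment> \<open>the most likely class has at least the average probability\<close>
  obtain k where k: "k \<in> C" "measure P G \<le> card C * measure P (Gk k)"
  proof (rule ccontr)
    assume a: "\<not> thesis"
    then have lt: "card C * measure P (Gk k) < measure P G" if "k \<in> C" for k using that \<open>\<And>k. _ \<Longrightarrow> _ \<Longrightarrow> thesis\<close> by force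
    have "measure P G \<le> (\<Sum>k\<in>C. measure P (Gk k))" unfolding GU
      using finC by (intro P.finite_measure_subadditive_finite) auto
    moreover have "C \<noteq> {}"
    proof -
      have "(\<lambda>l\<in>\<Lambda>. \<lfloor>-\<rho>/\<eta>\<rfloor>) \<in> C" unfolding C_def using \<rho> \<eta> by (auto intro!: floor_mono divide_right_mono)
      then show ?thesis by blast
    qed
    then have "card C > 0" using finC by auto
    then have "(\<Sum>k\<in>C. measure P (Gk k)) < (\<Sum>k\<in>C. measure P G / card C)"
      using \<open>C \<noteq> {}\<close> finC lt by (intro sum_strict_mono) (auto simp: field_simps)
    ultimately show False using \<open>card C > 0\<close> by simp
  qed
  have Kc: "0 < (2 * \<rho> * b / e + 2) ^ card \<Lambda>" using \<rho> e0 by (intro zero_less_power add_nonneg_pos) auto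
  have lower: "p / (2 * (2 * \<rho> * b / e + 2) ^ card \<Lambda>) \<le> measure P (Gk k)"
  proof -
    have "p / 2 \<le> card C * measure P (Gk k)" using PG k by linarith
    also have "\<dots> \<le> (2 * \<rho> * b / e + 2) ^ card \<Lambda> * measure P (Gk k)" using cardC by (intro mult_right_mono) auto
    finally show ?thesis using Kc by (simp add: field_simps)
  qed
  have sub: "Gk k \<times> Gk k \<subseteq> {w \<in> space (P \<Otimes>\<^sub>M P). (\<Sum>x\<in>X. \<bar>\<Sum>c\<in>D x. fst w c - snd w c\<bar> powr q)
         \<le> card X * (3 powr q * (16 * q powr q * exp K + 1) * e powr q)}"
  proof (clarify, intro conjI CollectI)
    fix \<omega> \<omega>' assume w: "\<omega> \<in> Gk k" "\<omega>' \<in> Gk k"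
    then show "(\<omega>, \<omega>') \<in> space (P \<Otimes>\<^sub>M P)" by (auto simp: Gk_def G_def space_pair_measure)
    have Yd: "\<bar>Y l \<omega> - Y l \<omega>'\<bar> \<le> \<eta>" if "l \<in> \<Lambda>" for l
    proof -
      have "\<lfloor>Y l \<omega> / \<eta>\<rfloor> = \<lfloor>Y l \<omega>' / \<eta>\<rfloor>" using w that by (auto simp: Gk_def)
      then have "\<bar>Y l \<omega> / \<eta> - Y l \<omega>' / \<eta>\<bar> \<le> 1" by linarith
      then have "\<bar>Y l \<omega> - Y l \<omega>'\<bar> / \<eta> \<le> 1" using \<eta> by (simp add: diff_divide_distrib[symmetric])
      then show ?thesis using \<eta> by (simp add: divide_le_eq)
    qed
    have each: "\<bar>\<Sum>c\<in>D x. fst (\<omega>, \<omega>') c - snd (\<omega>, \<omega>') c\<bar> powr q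
        \<le> 3 powr q * (\<bar>W x \<omega>\<bar> powr q + \<bar>W x \<omega>'\<bar> powr q + e powr q)" if x: "x \<in> X" for x
    proof -
      have "(\<Sum>c\<in>D x. \<omega> c - \<omega>' c) = W x \<omega> - W x \<omega>' + (\<Sum>l\<in>J x. Y l \<omega> - Y l \<omega>')"
        using dec[OF x, of "\<lambda>c. \<omega> c - \<omega>' c"] by (simp add: W_def Y_def sum_subtractf)
      moreover have "\<bar>\<Sum>l\<in>J x. Y l \<omega> - Y l \<omega>'\<bar> \<le> e"
      proof -
        have "\<bar>\<Sum>l\<in>J x. Y l \<omega> - Y l \<omega>'\<bar> \<le> (\<Sum>l\<in>J x. \<bar>Y l \<omega> - Y l \<omega>'\<bar>)" by (rule sum_abs)
        also have "\<dots> \<le> (\<Sum>l\<in>J x. \<eta>)" using Yd J(1)[OF x] by (intro sum_mono) auto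
        also have "\<dots> \<le> b * \<eta>" using J(2)[OF x] \<eta> by (simp add: mult_right_mono)
        finally show ?thesis using b by (simp add: \<eta>_def)
      qed
      ultimately have "\<bar>\<Sum>c\<in>D x. \<omega> c - \<omega>' c\<bar> \<le> \<bar>W x \<omega>\<bar> + \<bar>W x \<omega>'\<bar> + e" by linarith
      then have "\<bar>\<Sum>c\<in>D x. \<omega> c - \<omega>' c\<bar> powr q \<le> (\<bar>W x \<omega>\<bar> + \<bar>W x \<omega>'\<bar> + e) powr q"
        using q by (intro powr_mono2) auto
      also have "\<dots> \<le> 3 powr q * (\<bar>W x \<omega>\<bar> powr q + \<bar>W x \<omega>'\<bar> powr q + e powr q)"
        using q e0 by (intro powr_sum3_le) auto
      finally show ?thesis by simp
    qed
    have "(\<Sum>x\<in>X. \<bar>\<Sum>c\<in>D x. fst (\<omega>, \<omega>') c - snd (\<omega>, \<omega>') c\<bar> powr q)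
       \<le> (\<Sum>x\<in>X. 3 powr q * (\<bar>W x \<omega>\<bar> powr q + \<bar>W x \<omega>'\<bar> powr q + e powr q))" by (intro sum_mono each)
    also have "\<dots> = 3 powr q * ((\<Sum>x\<in>X. \<bar>W x \<omega>\<bar> powr q) + (\<Sum>x\<in>X. \<bar>W x \<omega>'\<bar> powr q) + card X * e powr q)"
      by (simp add: sum_distrib_left[symmetric] sum.distrib)
    also have "\<dots> \<le> 3 powr q * (card X * (B * e powr q) + card X * (B * e powr q) + card X * e powr q)"
      using w by (intro mult_left_mono add_mono) (auto simp: Gk_def G_def)
    also have "\<dots> = card X * (3 powr q * (16 * q powr q * exp K + 1) * e powr q)"
      by (simp add: B_def algebra_simps)
    finally show "(\<Sum>x\<in>X. \<bar>\<Sum>c\<in>D x. fst (\<omega>, \<omega>') c - snd (\<omega>, \<omega>') c\<bar> powr q)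
         \<le> card X * (3 powr q * (16 * q powr q * exp K + 1) * e powr q)" .
  qed
  have "(p / (2 * (2 * \<rho> * b / e + 2) ^ card \<Lambda>))\<^sup>2 \<le> (measure P (Gk k))\<^sup>2"
    using lower p0 Kc by (intro power_mono) (auto intro!: divide_nonneg_nonneg)
  also have "\<dots> = measure (P \<Otimes>\<^sub>M P) (Gk k \<times> Gk k)"
    by (simp add: power2_eq_square measure_def P.emeasure_pair_measure_Times enn2real_mult)
  also have "\<dots> \<le> measure (P \<Otimes>\<^sub>M P) {w \<in> space (P \<Otimes>\<^sub>M P). (\<Sum>x\<in>X. \<bar>\<Sum>c\<in>D x. fst w c - snd w c\<bar> powr q)
         \<le> card X * (3 powr q * (16 * q powr q * exp K + 1) * e powr q)}"
  proof (rule PP.P.finite_measure_mono[OF sub])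
    have [measurable]: "(\<lambda>w. \<Sum>c\<in>D x. fst w c - snd w c) \<in> borel_measurable (P \<Otimes>\<^sub>M P)" if x: "x \<in> X" for x
    proof -
      have "(\<lambda>w. \<Sum>c\<in>D x. fst w c - snd w c) = (\<lambda>w. W x (fst w) - W x (snd w) + (\<Sum>l\<in>J x. Y l (fst w) - Y l (snd w)))"
        by (simp add: dec[OF x] W_def Y_def sum_subtractf fun_eq_iff)
      also have "\<dots> \<in> borel_measurable (P \<Otimes>\<^sub>M P)"
        using J(1)[OF x] x by (intro borel_measurable_add borel_measurable_diff borel_measurable_sum measurable_compose[OF measurable_fst] measurable_compose[OF measurable_snd] Wm Ym) auto
      finally show ?thesis .
    qed
    show "{w \<in> space (P \<Otimes>\<^sub>M P). (\<Sum>x\<in>X. \<bar>\<Sum>c\<in>D x. fst w c - snd w c\<bar> powr q)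
         \<le> card X * (3 powr q * (16 * q powr q * exp K + 1) * e powr q)} \<in> sets (P \<Otimes>\<^sub>M P)"
      by measurable
  qed
  finally show ?thesis unfolding P_def p_def .
qed

section \<open>Dyadic decomposition of boxes\<close>

text \<open>
  For \<open>a = x div 2^(m-k)\<close> this is the piece of \<open>{..<x}\<close> that belongs to the \<open>k\<close>-th binary digit of \<open>x\<close>,
  counted from the most significant of \<open>m\<close> digits: empty if the digit is 0, and otherwise the set of all
  numbers that agree with \<open>x\<close> before that digit and have a 0 there. Taking \<open>a\<close> instead of \<open>x\<close> as argument
  makes visible that there are only \<open>2^k\<close> such pieces.
\<close>

definition dyadic_piece :: "nat \<Rightarrow> nat \<Rightarrow> nat \<Rightarrow> nat set" where
  "dyadic_piece m k a = {j. odd a \<and> j div 2 ^ (m - k) + 1 = a}"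

lemma card_dyadic_piece_le: "finite (dyadic_piece m k a)" "card (dyadic_piece m k a) \<le> 2 ^ (m - k)"
proof -
  have "dyadic_piece m k a \<subseteq> {(a - 1) * 2 ^ (m - k)..<(a - 1) * 2 ^ (m - k) + 2 ^ (m - k)}"
  proof
    fix j assume "j \<in> dyadic_piece m k a"
    then have "j div 2 ^ (m - k) = a - 1" by (auto simp: dyadic_piece_def)
    then have "j = (a - 1) * 2 ^ (m - k) + j mod 2 ^ (m - k)" using div_mult_mod_eq[of j "2 ^ (m - k)"] by metis
    moreover have "j mod 2 ^ (m - k) < 2 ^ (m - k)" by simp
    ultimately show "j \<in> {(a - 1) * 2 ^ (m - k)..<(a - 1) * 2 ^ (m - k) + 2 ^ (m - k)}"
      unfolding atLeastLessThan_iff by linarith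
  qed
  from finite_subset[OF this] card_mono[OF _ this]
  show "finite (dyadic_piece m k a)" "card (dyadic_piece m k a) \<le> 2 ^ (m - k)" by auto
qed

text \<open>
  If \<open>j < x\<close>, look at the first binary digit in which the two numbers differ.
\<close>

lemma less_iff_dyadic_piece:
  fixes j x :: nat
  assumes j: "j < 2 ^ m" and x: "x < 2 ^ m"
  shows "j < x \<longleftrightarrow> (\<exists>k\<in>{1..m}. j \<in> dyadic_piece m k (x div 2 ^ (m - k)))"
proof
  assume jx: "j < x"
  define r where "r = (GREATEST r. j div 2 ^ r \<noteq> x div 2 ^ r)"
  have bound: "r < m" if "j div 2 ^ r \<noteq> x div 2 ^ r" for r
  proof (rule ccontr)
    assume "\<not> r < m"
    then have "(2::nat) ^ m \<le> 2 ^ r" by simp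
    then have "j < 2 ^ r" "x < 2 ^ r" using j x by linarith+
    then show False using that by simp
  qed
  have "j div 2 ^ r \<noteq> x div 2 ^ r" unfolding r_def
    by (rule GreatestI_nat[of _ 0 m]) (use jx bound in \<open>auto intro: less_imp_le\<close>)
  then have rm: "r < m" and ne: "j div 2 ^ r \<noteq> x div 2 ^ r" using bound by auto
  have "\<not> (j div 2 ^ Suc r \<noteq> x div 2 ^ Suc r)"
  proof
    assume "j div 2 ^ Suc r \<noteq> x div 2 ^ Suc r"
    then have "Suc r \<le> r" unfolding r_def
      by (rule Greatest_le_nat[of _ _ m]) (use bound in \<open>auto intro: less_imp_le\<close>)
    then show False by simp
  qed
  then have eq: "(j div 2 ^ r) div 2 = (x div 2 ^ r) div 2" by (simp add: div_mult2_eq[symmetric] mult.commute)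
  have "j div 2 ^ r \<le> x div 2 ^ r" using jx by (intro div_le_mono) auto
  moreover have "u \<le> v \<Longrightarrow> u div 2 = v div 2 \<Longrightarrow> u \<noteq> v \<Longrightarrow> odd v \<and> u + 1 = v" for u v :: nat by presburger
  ultimately have "odd (x div 2 ^ r)" "j div 2 ^ r + 1 = x div 2 ^ r" using eq ne by blast+
  then have "j \<in> dyadic_piece m (m - r) (x div 2 ^ (m - (m - r)))" using rm by (simp add: dyadic_piece_def)
  then show "\<exists>k\<in>{1..m}. j \<in> dyadic_piece m k (x div 2 ^ (m - k))" using rm by (intro bexI[of _ "m - r"]) auto
next
  assume "\<exists>k\<in>{1..m}. j \<in> dyadic_piece m k (x div 2 ^ (m - k))"
  then obtain k where "j div 2 ^ (m - k) + 1 = x div 2 ^ (m - k)" by (auto simp: dyadic_piece_def)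
  then have "j div 2 ^ (m - k) < x div 2 ^ (m - k)" by simp
  then show "j < x" by (metis div_le_mono leD leI)
qed

lemma dyadic_piece_disjoint:
  assumes "j \<in> dyadic_piece m k (x div 2 ^ (m - k))" "j \<in> dyadic_piece m k' (x div 2 ^ (m - k'))"
    and "k \<le> m" "k' \<le> m"
  shows "k = k'"
proof -
  have *: False if "j \<in> dyadic_piece m k (x div 2 ^ (m - k))" "j \<in> dyadic_piece m k' (x div 2 ^ (m - k'))"
     "k' < k" "k \<le> m" for k k'
  proof -
    let ?r = "m - k"
    define s where "s = k - k' - 1"
    have s: "m - k' = Suc ?r + s" using that by (simp add: s_def)
    have o: "odd (x div 2 ^ ?r)" "j div 2 ^ ?r + 1 = x div 2 ^ ?r" using that(1) by (auto simp: dyadic_piece_def)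
    moreover have "odd v \<Longrightarrow> u + 1 = v \<Longrightarrow> u div 2 = v div 2" for u v :: nat by presburger
    ultimately have "(j div 2 ^ ?r) div 2 = (x div 2 ^ ?r) div 2" by blast
    then have "((j div 2 ^ ?r) div 2) div 2 ^ s = ((x div 2 ^ ?r) div 2) div 2 ^ s" by simp
    then have "j div 2 ^ (m - k') = x div 2 ^ (m - k')"
      unfolding s by (simp add: div_mult2_eq[symmetric] power_add mult_ac)
    then show False using that(2) by (auto simp: dyadic_piece_def)
  qed
  show ?thesis using *[of k k'] *[of k' k] assms by (meson linorder_neqE_nat)
qed

text \<open>
  The values at all but one coordinate determine the last one; hence the
  exponent \<open>d - 1\<close> in the number of dyadic rectangles of given volume.
\<close>

lemma card_sum_eq_le:
  fixes n :: nat
  shows "finite {k :: 'd::finite \<Rightarrow> nat. (sum k UNIV) = n}"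
    and "card {k :: 'd::finite \<Rightarrow> nat. (sum k UNIV) = n} \<le> (n + 1) ^ (CARD('d) - 1)"
proof -
  obtain i0 :: 'd where True by simp
  let ?S = "{k :: 'd \<Rightarrow> nat. (sum k UNIV) = n}"
  let ?T = "PiE (UNIV - {i0}) (\<lambda>_. {0..n})"
  let ?f = "\<lambda>k. restrict k (UNIV - {i0}) :: 'd \<Rightarrow> nat"
  have s: "(sum k UNIV) = k i0 + (\<Sum>i\<in>UNIV - {i0}. k i)" for k :: "'d \<Rightarrow> nat"
    by (subst sum.remove[of _ i0]) auto
  have inj: "inj_on ?f ?S"
  proof (rule inj_onI, rule ext)
    fix k k' i assume a: "k \<in> ?S" "k' \<in> ?S" "?f k = ?f k'"
    have e: "k i = k' i" if "i \<noteq> i0" for i using fun_cong[OF a(3), of i] that by simp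
    then have "(\<Sum>i\<in>UNIV - {i0}. k i) = (\<Sum>i\<in>UNIV - {i0}. k' i)" by (intro sum.cong) auto
    then have "k i0 = k' i0" using a s[of k] s[of k'] by auto
    then show "k i = k' i" using e by (cases "i = i0") auto
  qed
  have im: "?f ` ?S \<subseteq> ?T"
  proof -
    have "k i \<le> n" if "k \<in> ?S" for k i using that member_le_sum[of i UNIV k] by auto
    then show ?thesis by (auto split: if_splits)
  qed
  have fT: "finite ?T" by (intro finite_PiE) auto
  show "finite ?S" using inj finite_subset[OF im fT] by (rule finite_imageD[rotated])
  have "card ?S \<le> card ?T" using card_inj_on_le[OF inj im fT] .
  also have "\<dots> = (n + 1) ^ (CARD('d) - 1)" by (simp add: card_PiE)
  finally show "card ?S \<le> (n + 1) ^ (CARD('d) - 1)" .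
qed

definition grid :: "nat \<Rightarrow> ('d::finite \<Rightarrow> nat) set" where
  "grid m = {x. \<forall>i. x i < 2 ^ m}"

lemma grid_eq_PiE: "grid m = PiE UNIV (\<lambda>_. {..<2 ^ m})"
  by (auto simp: grid_def)

lemma finite_grid [simp]: "finite (grid m)"
  unfolding grid_eq_PiE by (intro finite_PiE) auto

lemma card_grid: "card (grid m :: ('d::finite \<Rightarrow> nat) set) = (2 ^ m) ^ CARD('d)"
  unfolding grid_eq_PiE by (simp add: card_PiE)

definition box_cells :: "nat \<Rightarrow> ('d::finite \<Rightarrow> nat) \<Rightarrow> ('d \<Rightarrow> nat) set" where
  "box_cells m x = {c \<in> grid m. \<forall>i. c i < x i}"

definition rect :: "nat \<Rightarrow> ('d::finite \<Rightarrow> nat) \<Rightarrow> ('d \<Rightarrow> nat) \<Rightarrow> ('d \<Rightarrow> nat) set" where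
  "rect m k a = {c \<in> grid m. \<forall>i. c i \<in> dyadic_piece m (k i) (a i)}"

definition levels :: "nat \<Rightarrow> ('d::finite \<Rightarrow> nat) set" where
  "levels m = {k. \<forall>i. k i \<in> {1..m}}"

definition dyadic_prefix :: "nat \<Rightarrow> ('d::finite \<Rightarrow> nat) \<Rightarrow> ('d \<Rightarrow> nat) \<Rightarrow> ('d \<Rightarrow> nat)" where
  "dyadic_prefix m x k = (\<lambda>i. x i div 2 ^ (m - k i))"

lemma finite_levels [simp]: "finite (levels m)"
proof -
  have "levels m = PiE UNIV (\<lambda>_. {1..m})" by (auto simp: levels_def)
  also have "finite \<dots>" by (intro finite_PiE) auto
  finally show ?thesis .
qed

lemma finite_rect [simp]: "finite (rect m k a)"
  unfolding rect_def by simp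

lemma rect_prefix_disjoint:
  assumes "k \<in> levels m" "k' \<in> levels m" "k \<noteq> k'"
  shows "rect m k (dyadic_prefix m x k) \<inter> rect m k' (dyadic_prefix m x k') = {}"
proof (rule ccontr)
  assume "\<not> ?thesis"
  then obtain c where "c \<in> rect m k (dyadic_prefix m x k)" "c \<in> rect m k' (dyadic_prefix m x k')" by auto
  then have "k i = k' i" for i
    using assms by (intro dyadic_piece_disjoint[of "c i" m "k i" "x i" "k' i"]) (auto simp: rect_def dyadic_prefix_def levels_def)
  then show False using assms by auto
qed

lemma sum_box_cells_eq_sum_rect:
  fixes f :: "('d::finite \<Rightarrow> nat) \<Rightarrow> real"
  assumes x: "x \<in> grid m"
  shows "(\<Sum>c\<in>box_cells m x. f c) = (\<Sum>k\<in>levels m. \<Sum>c\<in>rect m k (dyadic_prefix m x k). f c)"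
proof -
  have "box_cells m x = (\<Union>k\<in>levels m. rect m k (dyadic_prefix m x k))"
  proof (intro equalityI subsetI)
    fix c assume c: "c \<in> box_cells m x"
    have "\<forall>i. \<exists>k. k \<in> {1..m} \<and> c i \<in> dyadic_piece m k (x i div 2 ^ (m - k))"
    proof
      fix i
      show "\<exists>k. k \<in> {1..m} \<and> c i \<in> dyadic_piece m k (x i div 2 ^ (m - k))"
        using less_iff_dyadic_piece[of "c i" m "x i"] c x by (auto simp: box_cells_def grid_def)
    qed
    then obtain k where "\<forall>i. k i \<in> {1..m} \<and> c i \<in> dyadic_piece m (k i) (x i div 2 ^ (m - k i))" by metis
    then show "c \<in> (\<Union>k\<in>levels m. rect m k (dyadic_prefix m x k))"
      using c by (auto simp: levels_def rect_def dyadic_prefix_def box_cells_def)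
  next
    fix c assume "c \<in> (\<Union>k\<in>levels m. rect m k (dyadic_prefix m x k))"
    then obtain k where k: "k \<in> levels m" "c \<in> rect m k (dyadic_prefix m x k)" by auto
    have "c i < x i" for i
      using less_iff_dyadic_piece[of "c i" m "x i"] k x
      by (auto simp: rect_def grid_def levels_def dyadic_prefix_def)
    then show "c \<in> box_cells m x" using k by (auto simp: box_cells_def rect_def)
  qed
  also have "sum f \<dots> = (\<Sum>k\<in>levels m. \<Sum>c\<in>rect m k (dyadic_prefix m x k). f c)"
    by (intro sum.UNION_disjoint ballI impI rect_prefix_disjoint) auto
  finally show ?thesis .
qed

lemma card_rect_le:
  assumes "k \<in> levels m"
  shows "real (card (rect m k (a :: 'd::finite \<Rightarrow> nat))) \<le> real (card (grid m :: ('d \<Rightarrow> nat) set)) * (1/2) ^ (sum k UNIV)"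
proof -
  have "rect m k a \<subseteq> PiE UNIV (\<lambda>i. dyadic_piece m (k i) (a i))" by (auto simp: rect_def)
  then have "card (rect m k a) \<le> card (PiE UNIV (\<lambda>i. dyadic_piece m (k i) (a i)))"
    by (intro card_mono finite_PiE) (auto simp: card_dyadic_piece_le)
  also have "\<dots> \<le> (\<Prod>i\<in>UNIV. 2 ^ (m - k i))"
    by (simp add: card_PiE prod_mono card_dyadic_piece_le)
  finally have "real (card (rect m k a)) \<le> real (\<Prod>i\<in>UNIV. 2 ^ (m - k i))" by (simp only: of_nat_le_iff)
  also have "\<dots> = (\<Prod>i\<in>UNIV. 2 ^ (m - k i))" by simp
  also have "\<dots> = (\<Prod>i\<in>(UNIV::'d set). 2 ^ m * (1/2::real) ^ k i)"
    using assms by (intro prod.cong) (auto simp: levels_def power_diff field_simps)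
  also have "\<dots> = real (card (grid m :: ('d \<Rightarrow> nat) set)) * (1/2) ^ (sum k UNIV)"
    by (simp add: prod.distrib card_grid power_sum)
  finally show ?thesis .
qed

definition low_index :: "nat \<Rightarrow> nat \<Rightarrow> (('d::finite \<Rightarrow> nat) \<times> ('d \<Rightarrow> nat)) set" where
  "low_index m N = (SIGMA k : {k \<in> levels m. (sum k UNIV) \<le> N}. PiE UNIV (\<lambda>i. {..<2 ^ k i}))"

lemma dyadic_prefix_less: "x \<in> grid m \<Longrightarrow> k \<in> levels m \<Longrightarrow> dyadic_prefix m x k i < 2 ^ k i"
  unfolding dyadic_prefix_def grid_def levels_def
  by (auto simp: less_mult_imp_div_less power_add[symmetric])

lemma card_low_index:
  "finite (low_index m N :: (('d::finite \<Rightarrow> nat) \<times> ('d \<Rightarrow> nat)) set)"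
  "card (low_index m N :: (('d::finite \<Rightarrow> nat) \<times> ('d \<Rightarrow> nat)) set) \<le> (N + 1) ^ (CARD('d) - 1) * 2 ^ (N + 1)"
proof -
  let ?K = "{k \<in> levels m. (sum k UNIV) \<le> N} :: ('d \<Rightarrow> nat) set"
  show "finite (low_index m N :: (('d::finite \<Rightarrow> nat) \<times> ('d \<Rightarrow> nat)) set)"
    unfolding low_index_def by (intro finite_SigmaI finite_PiE) auto
  have "card (low_index m N :: (('d::finite \<Rightarrow> nat) \<times> ('d \<Rightarrow> nat)) set) = (\<Sum>k\<in>?K. 2 ^ (sum k UNIV))"
    unfolding low_index_def by (subst card_SigmaI) (auto intro!: finite_PiE simp: card_PiE power_sum)
  also have "\<dots> \<le> (\<Sum>k\<in>(\<Union>n\<in>{..N}. {k :: 'd \<Rightarrow> nat. (sum k UNIV) = n}). 2 ^ (sum k UNIV))"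
    by (intro sum_mono2) (auto intro!: card_sum_eq_le)
  also have "\<dots> = (\<Sum>n\<in>{..N}. \<Sum>k\<in>{k :: 'd \<Rightarrow> nat. (sum k UNIV) = n}. 2 ^ (sum k UNIV))"
    by (intro sum.UNION_disjoint) (auto intro!: card_sum_eq_le)
  also have "\<dots> = (\<Sum>n\<in>{..N}. card {k :: 'd \<Rightarrow> nat. (sum k UNIV) = n} * 2 ^ n)" by simp
  also have "\<dots> \<le> (\<Sum>n\<in>{..N}. (N + 1) ^ (CARD('d) - 1) * 2 ^ n)"
    by (intro sum_mono mult_right_mono order_trans[OF card_sum_eq_le(2)] power_mono) auto
  also have "\<dots> = (N + 1) ^ (CARD('d) - 1) * (\<Sum>n\<in>{..N}. 2 ^ n)" by (simp only: sum_distrib_left)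
  also have "\<dots> \<le> (N + 1) ^ (CARD('d) - 1) * 2 ^ (N + 1)"
  proof (rule mult_left_mono)
    have "(\<Sum>n\<in>{..N}. 2 ^ n) < (2::nat) ^ (N + 1)" by (induction N) auto
    then show "(\<Sum>n\<in>{..N}. 2 ^ n) \<le> (2::nat) ^ (N + 1)" by simp
  qed simp
  finally show "card (low_index m N :: (('d::finite \<Rightarrow> nat) \<times> ('d \<Rightarrow> nat)) set) \<le> (N + 1) ^ (CARD('d) - 1) * 2 ^ (N + 1)" .
qed

lemma card_low_levels:
  "card {k :: 'd::finite \<Rightarrow> nat. k \<in> levels m \<and> (sum k UNIV) \<le> N} \<le> (N + 1) ^ CARD('d)"
proof -
  have "k i \<le> N" if "(sum k UNIV) \<le> N" for k :: "'d \<Rightarrow> nat" and i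
    using that member_le_sum[of i UNIV k] by auto
  then have "{k :: 'd \<Rightarrow> nat. k \<in> levels m \<and> (sum k UNIV) \<le> N} \<subseteq> PiE UNIV (\<lambda>_. {..N})" by auto
  then have "card {k :: 'd \<Rightarrow> nat. k \<in> levels m \<and> (sum k UNIV) \<le> N} \<le> card (PiE (UNIV :: 'd set) (\<lambda>_. {..N}))"
    by (intro card_mono finite_PiE) auto
  then show ?thesis by (simp add: card_PiE)
qed

lemma polynomial_geometric_sum_bounded:
  "\<exists>C>0. \<forall>T. finite T \<longrightarrow> (\<Sum>j\<in>T. real (2 + j) ^ p * (1/2) ^ j) \<le> C"
proof -
  define K where "K = 4 powr (p + 1) * (p + 1) powr (p + 1) * exp (1/2 :: real)"
  define r where "r = exp (1/4 :: real) / 2"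
  have "exp (1/4 :: real) \<le> 1 + 1/4 + (1/4)^2" by (rule exp_le_quadratic) auto
  then have r: "0 < r" "r < 1" by (auto simp: r_def power2_eq_square)
  have K: "0 < K" by (simp add: K_def)
  have term_le: "real (2 + j) ^ p * (1/2) ^ j \<le> K * r ^ j" for j
  proof -
    define w where "w = real (2 + j) / 4"
    have w4: "4 * \<bar>w\<bar> = real (2 + j)" by (simp add: w_def)
    have "real (2 + j) ^ p \<le> real (2 + j) ^ (p + 1)" by (intro power_increasing) auto
    also have "\<dots> = real (2 + j) powr real (p + 1)" by (intro powr_realpow[symmetric]) simp
    also have "\<dots> = (4 * \<bar>w\<bar>) powr real (p + 1)" by (simp only: w4)
    also have "\<dots> = 4 powr real (p + 1) * \<bar>w\<bar> powr real (p + 1)" by (simp add: powr_mult)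
    also have "\<dots> \<le> 4 powr real (p + 1) * (real (p + 1) powr real (p + 1) * exp \<bar>w\<bar>)"
      by (intro mult_left_mono powr_le_exp) auto
    also have "exp \<bar>w\<bar> = exp (1/2) * exp (1/4) ^ j"
    proof -
      have "\<bar>w\<bar> = 1/2 + real j * (1/4)" by (simp add: w_def)
      then show ?thesis by (simp only: exp_add exp_of_nat_mult)
    qed
    also have "4 powr real (p + 1) * (real (p + 1) powr real (p + 1) * (exp (1/2) * exp (1/4) ^ j)) = K * exp (1/4) ^ j"
      by (simp add: K_def mult_ac)
    finally have "real (2 + j) ^ p \<le> K * exp (1/4) ^ j" .
    then have "real (2 + j) ^ p * (1/2) ^ j \<le> (K * exp (1/4) ^ j) * (1/2) ^ j" by (intro mult_right_mono) auto
    moreover have "r ^ j = exp (1/4) ^ j * (1/2) ^ j" by (simp add: r_def power_divide)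
    ultimately show ?thesis by (simp only: mult.assoc)
  qed
  have sr: "summable (\<lambda>j. K * r ^ j)" using r by (intro summable_mult summable_geometric) auto
  have "(\<Sum>j\<in>T. real (2 + j) ^ p * (1/2) ^ j) \<le> (\<Sum>j. K * r ^ j)" if "finite T" for T
  proof -
    have "(\<Sum>j\<in>T. real (2 + j) ^ p * (1/2) ^ j) \<le> (\<Sum>j\<in>T. K * r ^ j)" by (intro sum_mono term_le)
    also have "\<dots> \<le> (\<Sum>j. K * r ^ j)" using K r by (intro sum_le_suminf[OF sr that]) auto
    finally show ?thesis .
  qed
  moreover have "0 < (\<Sum>j. K * r ^ j)" using K r by (intro suminf_pos[OF sr]) auto
  ultimately show ?thesis by blast
qed

text \<open>
  The number of level vectors with \<open>|k| = n\<close> grows only polynomially, so the sum is dominated by its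
  first layer \<open>n = N + 1\<close>.
\<close>

lemma high_levels_sum_le:
  "\<exists>C>0. \<forall>m N. (\<Sum>k | k \<in> (levels m :: ('d::finite \<Rightarrow> nat) set) \<and> N < (sum k UNIV). (1/2::real) ^ (sum k UNIV))
      \<le> C * (real (N + 1)) ^ (CARD('d) - 1) * (1/2) ^ N"
proof -
  define p where "p = CARD('d) - 1"
  obtain C where C: "C > 0" "\<And>T. finite T \<Longrightarrow> (\<Sum>j\<in>T. real (2 + j) ^ p * (1/2) ^ j) \<le> C"
    using polynomial_geometric_sum_bounded by blast
  have "(\<Sum>k | k \<in> (levels m :: ('d \<Rightarrow> nat) set) \<and> N < (sum k UNIV). (1/2::real) ^ (sum k UNIV))
      \<le> C * (real (N + 1)) ^ p * (1/2) ^ N" for m N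
  proof -
    let ?L = "{k :: 'd \<Rightarrow> nat. k \<in> levels m \<and> N < (sum k UNIV)}"
    let ?S = "\<lambda>n. {k :: 'd \<Rightarrow> nat. (sum k UNIV) = n}"
    define U where "U = CARD('d) * m"
    have L: "?L \<subseteq> (\<Union>j\<in>{..U}. ?S (N + 1 + j))"
    proof
      fix k assume k: "k \<in> ?L"
      then have "(sum k UNIV) \<le> (\<Sum>i\<in>(UNIV::'d set). m)" by (intro sum_mono) (auto simp: levels_def)
      then have "(sum k UNIV) - (N + 1) \<le> U" by (simp add: U_def)
      then show "k \<in> (\<Union>j\<in>{..U}. ?S (N + 1 + j))" using k by (intro UN_I[of "(sum k UNIV) - (N + 1)"]) auto
    qed
    have "(\<Sum>k\<in>?L. (1/2::real) ^ (sum k UNIV)) \<le> (\<Sum>k\<in>(\<Union>j\<in>{..U}. ?S (N + 1 + j)). (1/2::real) ^ (sum k UNIV))"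
      using L by (intro sum_mono2 finite_UN_I card_sum_eq_le) auto
    also have "\<dots> = (\<Sum>j\<in>{..U}. \<Sum>k\<in>?S (N + 1 + j). (1/2::real) ^ (sum k UNIV))"
      by (intro sum.UNION_disjoint) (auto intro!: card_sum_eq_le)
    also have "\<dots> = (\<Sum>j\<in>{..U}. card (?S (N + 1 + j)) * (1/2::real) ^ (N + 1 + j))" by simp
    also have "\<dots> \<le> (\<Sum>j\<in>{..U}. (real (N + 1) ^ p * (1/2) ^ N) * (real (2 + j) ^ p * (1/2) ^ j))"
    proof (rule sum_mono)
      fix j
      have "card (?S (N + 1 + j)) \<le> (N + 1 + j + 1) ^ p" unfolding p_def by (rule card_sum_eq_le)
      also have "\<dots> \<le> ((N + 1) * (2 + j)) ^ p" by (intro power_mono) auto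
      finally have "real (card (?S (N + 1 + j))) \<le> real (((N + 1) * (2 + j)) ^ p)" by (simp only: of_nat_le_iff)
      then have "real (card (?S (N + 1 + j))) \<le> real (N + 1) ^ p * real (2 + j) ^ p" by (simp only: of_nat_power of_nat_mult power_mult_distrib)
      moreover have "(1/2::real) ^ (N + 1 + j) \<le> (1/2) ^ N * (1/2) ^ j" by (simp add: power_add)
      ultimately have "real (card (?S (N + 1 + j))) * (1/2::real) ^ (N + 1 + j) \<le> (real (N + 1) ^ p * real (2 + j) ^ p) * ((1/2) ^ N * (1/2) ^ j)"
        by (intro mult_mono) auto
      then show "real (card (?S (N + 1 + j))) * (1/2::real) ^ (N + 1 + j) \<le> (real (N + 1) ^ p * (1/2) ^ N) * (real (2 + j) ^ p * (1/2) ^ j)"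
        by (simp only: mult_ac)
    qed
    also have "\<dots> = (real (N + 1) ^ p * (1/2) ^ N) * (\<Sum>j\<in>{..U}. real (2 + j) ^ p * (1/2) ^ j)" by (simp only: sum_distrib_left)
    also have "\<dots> \<le> (real (N + 1) ^ p * (1/2) ^ N) * C" using C(2)[of "{..U}"] by (intro mult_left_mono) auto
    finally show ?thesis by (simp add: mult_ac)
  qed
  then show ?thesis using C(1) unfolding p_def by blast
qed

section \<open>Small balls for the sheet on a grid\<close>

definition high_cells :: "nat \<Rightarrow> nat \<Rightarrow> ('d::finite \<Rightarrow> nat) \<Rightarrow> ('d \<Rightarrow> nat) set" where
  "high_cells m N x = (\<Union>k\<in>{k \<in> levels m. N < (sum k UNIV)}. rect m k (dyadic_prefix m x k))"

definition low_levels :: "nat \<Rightarrow> nat \<Rightarrow> ('d::finite \<Rightarrow> nat) set" where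
  "low_levels m N = {k \<in> levels m. (sum k UNIV) \<le> N}"

text \<open>
  The box below \<open>x\<close> consists of the rectangles of high level, kept together as one set of small
  volume, and of those of low level, which belong to a family that does not depend on \<open>x\<close>.
\<close>

lemma sum_box_cells_split:
  fixes f :: "('d::finite \<Rightarrow> nat) \<Rightarrow> real"
  assumes x: "x \<in> grid m"
  shows "(\<Sum>c\<in>box_cells m x. f c) = (\<Sum>c\<in>high_cells m N x. f c) +
     (\<Sum>(k, a)\<in>(\<lambda>k. (k, dyadic_prefix m x k)) ` low_levels m N. \<Sum>c\<in>rect m k a. f c)"
proof -
  let ?g = "\<lambda>k. \<Sum>c\<in>rect m k (dyadic_prefix m x k). f c"
  have "(\<Sum>k\<in>levels m. ?g k) = (\<Sum>k\<in>{k \<in> levels m. N < (sum k UNIV)} \<union> low_levels m N. ?g k)"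
    by (intro sum.cong) (auto simp: low_levels_def)
  also have "\<dots> = (\<Sum>k\<in>{k \<in> levels m. N < (sum k UNIV)}. ?g k) + (\<Sum>k\<in>low_levels m N. ?g k)"
    by (intro sum.union_disjoint) (auto simp: low_levels_def)
  also have "(\<Sum>k\<in>{k \<in> levels m. N < (sum k UNIV)}. ?g k) = (\<Sum>c\<in>high_cells m N x. f c)"
    unfolding high_cells_def by (intro sum.UNION_disjoint[symmetric] ballI impI rect_prefix_disjoint) auto
  also have "(\<Sum>k\<in>low_levels m N. ?g k) = (\<Sum>(k, a)\<in>(\<lambda>k. (k, dyadic_prefix m x k)) ` low_levels m N. \<Sum>c\<in>rect m k a. f c)"
    by (subst sum.reindex) (auto simp: inj_on_def)
  finally show ?thesis using sum_box_cells_eq_sum_rect[OF x] by simp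
qed

lemma exp_le_one_minus:
  assumes "0 \<le> (x::real)" "x \<le> 1/2"
  shows "exp (- 2 * x) \<le> 1 - x"
proof -
  have "1 + 2 * x + (2*x)^2/2 \<le> exp (2 * x)" using assms by (intro exp_lower_Taylor_quadratic) auto
  then have "exp (- 2 * x) \<le> inverse (1 + 2 * x + (2*x)^2/2)" using assms
    by (auto simp: exp_minus intro!: le_imp_inverse_le add_pos_nonneg)
  also have "\<dots> \<le> 1 - x"
  proof -
    have "0 \<le> x * (1 - 2 * x\<^sup>2)" using assms
    proof (intro mult_nonneg_nonneg)
      have "x\<^sup>2 \<le> (1/2)\<^sup>2" using assms by (intro power_mono) auto
      then show "0 \<le> 1 - 2 * x\<^sup>2" by (simp add: power2_eq_square)
    qed auto
    moreover have "(1 - x) * (1 + 2 * x + (2*x)^2/2) = 1 + x * (1 - 2 * x\<^sup>2)"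
      by (simp add: field_simps power2_eq_square)
    ultimately have "1 \<le> (1 - x) * (1 + 2 * x + (2*x)^2/2)" by linarith
    moreover have "0 < 1 + 2 * x + (2*x)^2/2" using assms by (intro add_pos_nonneg) auto
    ultimately show ?thesis by (simp add: inverse_eq_divide divide_le_eq)
  qed
  finally show ?thesis .
qed

text \<open>
  The bound depends on the mesh only through the requirement \<open>m\<close> that the grid is fine enough.
  With \<open>\<kappa> = 8 * \<delta> powr (-\<alpha>) / card I\<close>, the truncation event has probability at least
  \<open>(1 - \<kappa>) ^ card I \<ge> exp (- 2 * \<kappa> * card I)\<close>.
\<close>

lemma grid_small_ball:
  fixes \<mu> :: "real measure" and \<delta> \<alpha> e \<rho> q K C :: real and m N :: nat
  defines "I \<equiv> grid m :: ('d::finite \<Rightarrow> nat) set"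
  defines "n \<equiv> (N + 1) ^ (CARD('d) - 1) * 2 ^ (N + 1)" and "b \<equiv> (N + 1) ^ CARD('d)"
  assumes \<mu>: "real_distribution \<mu>" and \<alpha>: "0 < \<alpha>" "\<alpha> \<le> 2"
    and ch: "\<And>\<theta>. char \<mu> \<theta> = complex_of_real (exp (- (1 / card I * \<bar>\<theta>\<bar> powr \<alpha>)))"
    and \<delta>: "0 < \<delta>" "\<delta> \<le> 1" and m: "16 * \<delta> powr (-\<alpha>) \<le> card I"
    and e: "\<delta> \<le> e" and q: "0 < q" and K: "16 \<le> K"
    and C: "(\<Sum>k | k \<in> (levels m :: ('d \<Rightarrow> nat) set) \<and> N < (sum k UNIV). (1/2::real) ^ (sum k UNIV))
      \<le> C * real (N + 1) ^ (CARD('d) - 1) * (1/2) ^ N"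
    and KH: "16 * \<delta> powr (2 - \<alpha>) * (C * real (N + 1) ^ (CARD('d) - 1) * (1/2) ^ N) \<le> K * e\<^sup>2"
    and \<rho>: "0 \<le> \<rho>" "8 * real n * exp K \<le> exp \<rho>"
  shows "(exp (- 16 * \<delta> powr (-\<alpha>)) / (2 * (2 * \<rho> * real b / e + 2) ^ n))\<^sup>2 \<le>
    measure (Pi\<^sub>M I (\<lambda>_. \<mu>) \<Otimes>\<^sub>M Pi\<^sub>M I (\<lambda>_. \<mu>))
      {w \<in> space (Pi\<^sub>M I (\<lambda>_. \<mu>) \<Otimes>\<^sub>M Pi\<^sub>M I (\<lambda>_. \<mu>)). (\<Sum>x\<in>I. \<bar>\<Sum>c\<in>box_cells m x. fst w c - snd w c\<bar> powr q)
         \<le> card I * (3 powr q * (16 * q powr q * exp K + 1) * e powr q)}"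
proof -
  interpret \<mu>: real_distribution \<mu> by fact
  let ?A = "{-\<delta>..\<delta>}"
  define v where "v = 1 / real (card I)"
  have cI: "0 < card I" unfolding I_def by (simp add: card_grid)
  have v: "0 < v" using cI by (simp add: v_def)
  define \<kappa> where "\<kappa> = 8 * v * \<delta> powr (-\<alpha>)"
  have \<kappa>0: "0 \<le> \<kappa>" using v by (simp add: \<kappa>_def)
  have \<kappa>: "\<kappa> \<le> 1/2" using m cI by (simp add: \<kappa>_def v_def field_simps)
  have mean: "(LINT x|\<mu>. indicator ?A x * x) = 0"
    using ch by (intro real_char_truncated_mean[OF \<mu>]) simp
  have mom: "(LINT x|\<mu>. min 1 ((x / \<delta>)\<^sup>2)) \<le> \<kappa>"
    unfolding \<kappa>_def using v ch[unfolded char_def]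
    by (intro stable_truncated_moment[OF \<mu>.prob_space_axioms _ \<alpha> _ \<delta>(1)]) (auto simp: v_def)
  have e0: "0 < e" using \<delta> e by simp
  have \<kappa>\<delta>: "2 * \<kappa> * \<delta>\<^sup>2 = 16 * v * \<delta> powr (2 - \<alpha>)"
  proof -
    have "\<delta> powr (2 - \<alpha>) = \<delta> powr (-\<alpha>) * \<delta>\<^sup>2"
      using \<delta> by (simp add: powr_diff powr_minus divide_inverse powr_numeral)
    then show ?thesis by (simp add: \<kappa>_def)
  qed
  have \<delta>a: "\<delta> powr (2 - \<alpha>) \<le> 1" using \<delta> \<alpha> by (intro powr_le1) auto
  let ?\<Lambda> = "low_index m N :: (('d \<Rightarrow> nat) \<times> ('d \<Rightarrow> nat)) set"
  have cardL: "card ?\<Lambda> \<le> n" unfolding n_def by (rule card_low_index)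
  define R where "R = (\<lambda>(k, a). rect m k a :: ('d \<Rightarrow> nat) set)"
  define J where "J x = (\<lambda>k. (k, dyadic_prefix m x k)) ` (low_levels m N :: ('d \<Rightarrow> nat) set)" for x
  have main: "(measure \<mu> ?A ^ card I / (2 * (2 * \<rho> * b / e + 2) ^ card ?\<Lambda>))\<^sup>2 \<le>
    measure (Pi\<^sub>M I (\<lambda>_. \<mu>) \<Otimes>\<^sub>M Pi\<^sub>M I (\<lambda>_. \<mu>))
      {w \<in> space (Pi\<^sub>M I (\<lambda>_. \<mu>) \<Otimes>\<^sub>M Pi\<^sub>M I (\<lambda>_. \<mu>)). (\<Sum>x\<in>I. \<bar>\<Sum>c\<in>box_cells m x. fst w c - snd w c\<bar> powr q)
         \<le> card I * (3 powr q * (16 * q powr q * exp K + 1) * e powr q)}"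
  proof (rule small_ball_of_two_scale_decomposition[OF \<mu> \<delta> mean mom \<kappa>, where H = "high_cells m N" and R = R and J = J])
    show "finite I" "finite I" unfolding I_def by simp_all
    show "finite ?\<Lambda>" by (rule card_low_index)
    show "high_cells m N x \<subseteq> I" for x by (auto simp: high_cells_def rect_def I_def)
    show "R l \<subseteq> I" for l by (auto simp: R_def rect_def I_def split: prod.splits)
    show "0 < b" by (simp add: b_def)
    show "\<delta> \<le> e" "0 < q" "0 \<le> \<rho>" by fact+
    show "8 * card ?\<Lambda> * exp K \<le> exp \<rho>"
    proof -
      have "8 * real (card ?\<Lambda>) * exp K \<le> 8 * real n * exp K" using cardL by (intro mult_right_mono mult_left_mono) auto
      then show ?thesis using \<rho> by linarith
    qed
    fix x assume x: "x \<in> I"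
    show "J x \<subseteq> ?\<Lambda>"
      using dyadic_prefix_less x by (auto simp: J_def low_index_def low_levels_def I_def)
    have "card (J x) \<le> card (low_levels m N :: ('d \<Rightarrow> nat) set)"
      unfolding J_def low_levels_def by (intro card_image_le) simp
    also have "\<dots> \<le> b" unfolding low_levels_def b_def by (rule card_low_levels)
    finally show "card (J x) \<le> b" .
    show "(\<Sum>c\<in>box_cells m x. f c) = (\<Sum>c\<in>high_cells m N x. f c) + (\<Sum>l\<in>J x. \<Sum>c\<in>R l. f c)" for f :: "('d \<Rightarrow> nat) \<Rightarrow> real"
      using sum_box_cells_split[of x m f N] x unfolding I_def J_def R_def by (simp add: case_prod_beta)
    have "real (card (high_cells m N x)) \<le> (\<Sum>k | k \<in> (levels m :: ('d \<Rightarrow> nat) set) \<and> N < (sum k UNIV). real (card (rect m k (dyadic_prefix m x k))))"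
    proof -
      have "card (high_cells m N x) \<le> (\<Sum>k | k \<in> (levels m :: ('d \<Rightarrow> nat) set) \<and> N < (sum k UNIV). card (rect m k (dyadic_prefix m x k)))"
        unfolding high_cells_def by (rule card_UN_le) simp
      then show ?thesis by (simp only: of_nat_le_iff of_nat_sum[symmetric])
    qed
    also have "\<dots> \<le> (\<Sum>k | k \<in> (levels m :: ('d \<Rightarrow> nat) set) \<and> N < (sum k UNIV). real (card I) * (1/2) ^ (sum k UNIV))"
      unfolding I_def by (intro sum_mono card_rect_le) auto
    also have "\<dots> \<le> real (card I) * (C * real (N + 1) ^ (CARD('d) - 1) * (1/2) ^ N)"
      unfolding sum_distrib_left[symmetric] by (intro mult_left_mono C) auto
    finally have "(16 * v * \<delta> powr (2 - \<alpha>)) * real (card (high_cells m N x))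
      \<le> (16 * v * \<delta> powr (2 - \<alpha>)) * (real (card I) * (C * real (N + 1) ^ (CARD('d) - 1) * (1/2) ^ N))"
      using v by (intro mult_left_mono) auto
    also have "\<dots> = 16 * \<delta> powr (2 - \<alpha>) * (C * real (N + 1) ^ (CARD('d) - 1) * (1/2) ^ N)"
      using cI by (simp add: v_def)
    finally show "2 * \<kappa> * \<delta>\<^sup>2 * card (high_cells m N x) \<le> K * e\<^sup>2" unfolding \<kappa>\<delta> using KH by linarith
  next
    fix l assume l: "l \<in> ?\<Lambda>"
    obtain k a where ka: "l = (k, a)" by (cases l)
    have "real (card (rect m k a)) \<le> card I * (1/2) ^ (sum k UNIV)"
      unfolding I_def using l ka by (intro card_rect_le) (auto simp: low_index_def)
    also have "\<dots> \<le> real (card I) * 1" by (intro mult_left_mono power_le_one) auto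
    finally have "(16 * v * \<delta> powr (2 - \<alpha>)) * real (card (R l)) \<le> (16 * v * 1) * (real (card I) * 1)"
      using v \<delta>a ka by (intro mult_mono) (auto simp: R_def)
    also have "\<dots> \<le> K" using cI K by (simp add: v_def)
    finally show "2 * \<kappa> * \<delta>\<^sup>2 * card (R l) \<le> K" unfolding \<kappa>\<delta> .
  qed
  have p1: "exp (- 16 * \<delta> powr (-\<alpha>)) \<le> measure \<mu> ?A ^ card I"
  proof -
    have "exp (- 16 * \<delta> powr (-\<alpha>)) = exp (real (card I) * (- 2 * \<kappa>))" using cI by (simp add: \<kappa>_def v_def)
    also have "\<dots> = exp (- 2 * \<kappa>) ^ card I" by (rule exp_of_nat_mult)
    also have "\<dots> \<le> measure \<mu> ?A ^ card I"
      using exp_le_one_minus[OF \<kappa>0 \<kappa>] truncated_exponential_moment(1)[OF \<mu> \<delta>(1) mean mom \<kappa>]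
      by (intro power_mono) auto
    finally show ?thesis .
  qed
  have "exp (- 16 * \<delta> powr (-\<alpha>)) / (2 * (2 * \<rho> * real b / e + 2) ^ n) \<le> measure \<mu> ?A ^ card I / (2 * (2 * \<rho> * b / e + 2) ^ card ?\<Lambda>)"
  proof (rule frac_le)
    have "1 \<le> 2 * \<rho> * real b / e + 2" using \<rho> e0 by simp
    then show "2 * (2 * \<rho> * b / e + 2) ^ card ?\<Lambda> \<le> 2 * (2 * \<rho> * b / e + 2) ^ n"
      using cardL by (intro mult_left_mono power_increasing) auto
    show "0 < 2 * (2 * \<rho> * b / e + 2) ^ card ?\<Lambda>" using \<rho> e0 by (intro mult_pos_pos zero_less_power add_nonneg_pos) auto
  qed (use p1 in auto)
  then have "(exp (- 16 * \<delta> powr (-\<alpha>)) / (2 * (2 * \<rho> * real b / e + 2) ^ n))\<^sup>2 \<le> (measure \<mu> ?A ^ card I / (2 * (2 * \<rho> * b / e + 2) ^ card ?\<Lambda>))\<^sup>2"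
    using \<rho> e0 by (intro power_mono) (auto intro!: divide_nonneg_nonneg)
  with main show ?thesis by linarith
qed

section \<open>Choice of the parameters\<close>

text \<open>
  With \<open>L = ln (1/\<epsilon>)\<close> and \<open>T = \<epsilon> powr (-\<alpha>) * L powr (\<alpha> * (d - 1/2))\<close> the choice is \<open>\<delta> powr (-\<alpha>) = T\<close> and
  \<open>2^N \<approx> T / L^d\<close>. Then \<open>N = O(L)\<close>, the number \<open>n\<close> of low rectangles satisfies \<open>n * L = O(T)\<close>, and the
  logarithm of the number of classes per rectangle is \<open>O(L)\<close>, so that all costs are \<open>O(T)\<close>.
\<close>

lemma parameter_choice:
  fixes \<alpha> C :: real and d :: nat
  assumes \<alpha>: "0 < \<alpha>" "\<alpha> \<le> 2" and d: "1 \<le> d" and C: "0 < C"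
  shows "\<exists>K c \<epsilon>0. 16 \<le> K \<and> 0 < c \<and> 0 < \<epsilon>0 \<and> \<epsilon>0 \<le> 1 \<and> (\<forall>\<epsilon>. 0 < \<epsilon> \<and> \<epsilon> < \<epsilon>0 \<longrightarrow>
    (\<exists>\<delta> (N :: nat) \<rho>. 0 < \<delta> \<and> \<delta> \<le> 1 \<and> \<delta> \<le> \<epsilon>
      \<and> 16 * \<delta> powr (2 - \<alpha>) * (C * real (N + 1) ^ (d - 1) * (1/2) ^ N) \<le> K * \<epsilon>\<^sup>2
      \<and> 0 \<le> \<rho> \<and> 8 * real ((N + 1) ^ (d - 1) * 2 ^ (N + 1)) * exp K \<le> exp \<rho>
      \<and> exp (- c * (\<epsilon> powr (- \<alpha>) * ln (1 / \<epsilon>) powr (\<alpha> * (real d - 1 / 2))))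
        \<le> (exp (- 16 * \<delta> powr (-\<alpha>)) / (2 * (2 * \<rho> * real ((N + 1) ^ d) / \<epsilon> + 2) ^ ((N + 1) ^ (d - 1) * 2 ^ (N + 1))))\<^sup>2))"
proof -
  define D where "D = real d - 1/2"
  have D: "0 < D" "D \<le> d" using d by (auto simp: D_def)
  define c1 where "c1 = 5 + 4 * real d"
  define c2 where "c2 = 2 * c1 ^ (d - 1)"
  define K where "K = 16 + 32 * C * c1 ^ (d - 1)"
  define c4 where "c4 = 2 * (8 * c2 + K) * c1 ^ d + 2"
  define c3 where "c3 = c4 + (2 + 2 * real d) + real d + 1"
  define c where "c = 2 * (17 + c3 * c2)"
  have c1: "1 \<le> c1" by (simp add: c1_def)
  have c2: "2 \<le> c2" using c1 by (simp add: c2_def one_le_power)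
  have K: "16 \<le> K" using C c1 by (simp add: K_def)
  have c4: "2 \<le> c4" using c1 c2 K by (simp add: c4_def)
  have c3: "0 < c3" using c4 by (simp add: c3_def)
  have c: "0 < c" using c3 c2 by (simp add: c_def add_pos_nonneg)
  have "\<forall>\<^sub>F x in at_top. ln x / x < \<alpha> / d"
    using ln_x_over_x_tendsto_0 by (rule order_tendstoD) (use \<alpha> d in auto)
  then obtain L1 where L1: "\<And>x::real. x \<ge> L1 \<Longrightarrow> ln x / x < \<alpha> / d" by (auto simp: eventually_at_top_linorder)
  define L0 where "L0 = max 1 L1"
  have main: "\<exists>\<delta> (N :: nat) \<rho>. 0 < \<delta> \<and> \<delta> \<le> 1 \<and> \<delta> \<le> \<epsilon>
      \<and> 16 * \<delta> powr (2 - \<alpha>) * (C * real (N + 1) ^ (d - 1) * (1/2) ^ N) \<le> K * \<epsilon>\<^sup>2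
      \<and> 0 \<le> \<rho> \<and> 8 * real ((N + 1) ^ (d - 1) * 2 ^ (N + 1)) * exp K \<le> exp \<rho>
      \<and> exp (- c * (\<epsilon> powr (- \<alpha>) * ln (1 / \<epsilon>) powr (\<alpha> * (real d - 1 / 2))))
        \<le> (exp (- 16 * \<delta> powr (-\<alpha>)) / (2 * (2 * \<rho> * real ((N + 1) ^ d) / \<epsilon> + 2) ^ ((N + 1) ^ (d - 1) * 2 ^ (N + 1))))\<^sup>2"
    if \<epsilon>: "0 < \<epsilon>" "\<epsilon> < exp (- L0)" for \<epsilon>
  proof -
    define L where "L = ln (1 / \<epsilon>)"
    have "ln \<epsilon> < - L0" using \<epsilon> by (metis ln_exp ln_less_cancel_iff exp_gt_zero)
    then have L: "1 \<le> L" "L1 \<le> L" using \<epsilon> by (auto simp: L_def L0_def ln_div)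
    have \<epsilon>L: "\<epsilon> = exp (- L)" using \<epsilon> by (simp add: L_def ln_div)
    have lnL: "0 \<le> ln L" "ln L \<le> L" using L ln_le_minus_one[of L] by auto
    define U where "U = \<alpha> * L + \<alpha> * D * ln L"
    define T where "T = \<epsilon> powr (- \<alpha>) * L powr (\<alpha> * D)"
    have TU: "T = exp U" using L by (simp add: T_def U_def \<epsilon>L powr_def exp_add)
    have U0: "0 \<le> U" using \<alpha> D L lnL by (simp add: U_def)
    have T1: "1 \<le> T" using U0 by (simp add: TU)
    have UL: "U \<le> (2 + 2 * real d) * L"
    proof -
      have "\<alpha> * D * ln L \<le> 2 * real d * L" using \<alpha> D L lnL by (intro mult_mono) auto
      moreover have "\<alpha> * L \<le> 2 * L" using \<alpha> L by (intro mult_right_mono) auto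
      ultimately show ?thesis by (simp add: U_def algebra_simps)
    qed
    define M0 where "M0 = T / L ^ d"
    have "real d * ln L \<le> \<alpha> * L" using L1[OF L(2)] L d by (simp add: field_simps)
    then have dl: "real d * ln L \<le> U" using \<alpha> D lnL by (simp add: U_def add_increasing2)
    have Ld: "L ^ d = exp (real d * ln L)" using L by (simp add: exp_of_nat_mult)
    have M0: "1 \<le> M0" "M0 \<le> T"
      using dl L T1 by (auto simp: M0_def TU Ld field_simps mult_le_cancel_left1 lnL)
    \<comment> \<open>\<open>N\<close> is the integer with \<open>2 ^ N \<le> M0 < 2 ^ (N + 1)\<close>\<close>
    define N where "N = nat \<lfloor>log 2 M0\<rfloor>"
    have N: "real N = of_int \<lfloor>log 2 M0\<rfloor>" using M0 by (simp add: N_def)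
    have N1: "2 ^ N \<le> M0"
    proof -
      have "(2::real) ^ N = 2 powr real N" by (simp add: powr_realpow)
      also have "\<dots> \<le> 2 powr (log 2 M0)" unfolding N by (intro powr_mono) auto
      finally show ?thesis using M0 by simp
    qed
    have N2: "M0 \<le> 2 * 2 ^ N"
    proof -
      have "M0 = 2 powr (log 2 M0)" using M0 by simp
      also have "\<dots> \<le> 2 powr (real N + 1)" unfolding N by (intro powr_mono) linarith+
      finally show ?thesis by (simp add: powr_add powr_realpow)
    qed
    have NL: "real (N + 1) \<le> c1 * L"
    proof -
      have "exp (real N * ln 2) \<le> exp U" using N1 M0 by (simp add: TU exp_of_nat_mult)
      then have "real N * ln 2 \<le> U" by simp
      moreover have "1/2 \<le> ln (2::real)" using exp_half_le2 by (subst ln_ge_iff) auto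
      then have "real N * (1/2) \<le> real N * ln 2" by (intro mult_left_mono) auto
      ultimately have "real N \<le> 2 * ((2 + 2 * real d) * L)" using UL by linarith
      then show ?thesis using L by (simp add: c1_def algebra_simps)
    qed
    define \<delta> where "\<delta> = \<epsilon> * L powr (- D)"
    have Lp: "L powr (-D) \<le> 1" "0 < L powr (-D)" using L D powr_mono[of "-D" 0 L] by auto
    have \<epsilon>1: "\<epsilon> \<le> 1" using L by (simp add: \<epsilon>L)
    have \<delta>: "0 < \<delta>" "\<delta> \<le> \<epsilon>" "\<delta> \<le> 1" using \<epsilon> Lp \<epsilon>1 by (auto simp: \<delta>_def mult_le_one mult_left_le)
    have \<delta>T: "\<delta> powr (-\<alpha>) = T" using \<epsilon> L by (simp add: \<delta>_def T_def powr_mult powr_powr mult.commute)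
    have \<delta>2: "\<delta> powr (2 - \<alpha>) = \<epsilon>\<^sup>2 / L ^ (2 * d - 1) * T"
    proof -
      have "\<delta> powr (2 - \<alpha>) = \<delta> powr 2 * \<delta> powr (-\<alpha>)" by (simp add: powr_add[symmetric])
      also have "\<delta> powr 2 = \<epsilon>\<^sup>2 * L powr (- real (2 * d - 1))"
        using \<epsilon> L d by (simp add: \<delta>_def powr_mult powr_powr D_def of_nat_diff algebra_simps powr_numeral)
      also have "L powr (- real (2 * d - 1)) = 1 / L ^ (2 * d - 1)" using L by (simp add: powr_minus_divide powr_realpow)
      finally show ?thesis by (simp add: \<delta>T)
    qed
    have half: "(1/2) ^ N \<le> 2 * L ^ d / T"
    proof -
      have "T \<le> 2 * 2 ^ N * L ^ d" using N2 L by (simp add: M0_def divide_le_eq)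
      then show ?thesis using T1 by (simp add: field_simps power_one_over)
    qed
    have Npow: "real (N + 1) ^ k \<le> c1 ^ k * L ^ k" for k
      using power_mono[OF NL, of k] by (simp add: power_mult_distrib)
    have Lsplit: "L ^ (2 * d - 1) = L ^ (d - 1) * L ^ d" using d by (simp add: power_add[symmetric] mult_2)
    have high: "16 * \<delta> powr (2 - \<alpha>) * (C * real (N + 1) ^ (d - 1) * (1/2) ^ N) \<le> K * \<epsilon>\<^sup>2"
    proof -
      have "16 * \<delta> powr (2 - \<alpha>) * (C * real (N + 1) ^ (d - 1) * (1/2) ^ N)
        \<le> 16 * \<delta> powr (2 - \<alpha>) * (C * (c1 ^ (d - 1) * L ^ (d - 1)) * (2 * L ^ d / T))"
        using C half Npow by (intro mult_left_mono mult_mono) (auto intro!: mult_nonneg_nonneg simp: L c1_def order_trans[OF _ L(1)])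
      also have "\<dots> = 32 * C * c1 ^ (d - 1) * \<epsilon>\<^sup>2"
        unfolding \<delta>2 Lsplit using L T1 by (simp add: field_simps)
      also have "\<dots> \<le> K * \<epsilon>\<^sup>2" unfolding K_def by (intro mult_right_mono) auto
      finally show ?thesis .
    qed
    define n where "n = (N + 1) ^ (d - 1) * 2 ^ (N + 1)"
    have nL: "real n * L \<le> c2 * T"
    proof -
      have "real n * L = real (N + 1) ^ (d - 1) * (2 * 2 ^ N) * L" by (simp add: n_def)
      also have "\<dots> \<le> (c1 ^ (d - 1) * L ^ (d - 1)) * (2 * M0) * L"
        using N1 Npow L c1 by (intro mult_right_mono mult_mono) auto
      also have "\<dots> = c2 * M0 * (L ^ (d - 1) * L)" by (simp add: c2_def)
      also have "L ^ (d - 1) * L = L ^ d" using d by (simp add: power_eq_if mult.commute)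
      also have "c2 * M0 * L ^ d = c2 * T" using L by (simp add: M0_def)
      finally show ?thesis .
    qed
    have nT: "real n \<le> c2 * T"
    proof -
      have "real n * 1 \<le> real n * L" using L by (intro mult_left_mono) auto
      then show ?thesis using nL by simp
    qed
    define \<rho> where "\<rho> = 8 * real n + K"
    have \<rho>0: "0 \<le> \<rho>" using K by (simp add: \<rho>_def)
    have \<rho>: "8 * real n * exp K \<le> exp \<rho>"
    proof -
      have "8 * real n \<le> exp (8 * real n)" using exp_ge_add_one_self[of "8 * real n"] by linarith
      then show ?thesis by (simp add: \<rho>_def exp_add)
    qed
    define Q where "Q = 2 * \<rho> * real ((N + 1) ^ d) / \<epsilon> + 2"
    have Q0: "0 < Q" using \<rho>0 \<epsilon> by (auto simp: Q_def intro!: add_nonneg_pos)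
    have QL: "Q \<le> exp (c3 * L)"
    proof -
      have "\<rho> \<le> (8 * c2 + K) * T"
      proof -
        have "K * 1 \<le> K * T" using K T1 by (intro mult_left_mono) auto
        then show ?thesis using nT by (simp add: \<rho>_def algebra_simps)
      qed
      then have "2 * \<rho> * real ((N + 1) ^ d) / \<epsilon> \<le> 2 * ((8 * c2 + K) * T) * (c1 ^ d * L ^ d) / \<epsilon>"
        using Npow[of d] \<epsilon> \<rho>0 c2 K T1 by (intro divide_right_mono mult_mono) auto
      moreover have "2 \<le> 2 * (T * L ^ d / \<epsilon>)"
      proof -
        have "1 * 1 * 1 \<le> T * L ^ d * (1 / \<epsilon>)" using T1 L \<epsilon> \<epsilon>1 by (intro mult_mono) (auto simp: one_le_power)
        then show ?thesis by simp
      qed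
      ultimately have "Q \<le> c4 * (T * L ^ d / \<epsilon>)" unfolding Q_def c4_def by (simp add: algebra_simps add_divide_distrib)
      also have "T * L ^ d / \<epsilon> = exp (U + real d * ln L + L)" by (simp add: TU Ld \<epsilon>L exp_add exp_minus divide_inverse)
      also have "c4 \<le> exp c4" using exp_ge_add_one_self[of c4] by linarith
      finally have "Q \<le> exp (c4 + (U + real d * ln L + L))" by (simp add: exp_add)
      also have "c4 + (U + real d * ln L + L) \<le> c3 * L"
      proof -
        have "c4 * 1 \<le> c4 * L" using c4 L by (intro mult_left_mono) auto
        moreover have "real d * ln L \<le> real d * L" using lnL by (intro mult_left_mono) auto
        ultimately show ?thesis using UL by (simp add: c3_def algebra_simps)
      qed
      finally show ?thesis by simp
    qed
    have "Q ^ n \<le> exp (c3 * L) ^ n" using QL Q0 by (intro power_mono) auto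
    also have "\<dots> = exp (c3 * (real n * L))" by (simp add: exp_of_nat_mult[symmetric] mult_ac)
    also have "\<dots> \<le> exp (c3 * (c2 * T))" using c3 nL by simp
    finally have Qn: "Q ^ n \<le> exp (c3 * c2 * T)" by (simp add: mult_ac)
    have two: "2 \<le> exp T" using exp_ge_add_one_self[of T] T1 by linarith
    have "exp (- (17 + c3 * c2) * T) = exp (- 16 * T) / (exp T * exp (c3 * c2 * T))"
      by (simp add: exp_add[symmetric] exp_diff[symmetric] algebra_simps)
    also have "\<dots> \<le> exp (- 16 * T) / (2 * Q ^ n)"
      using Qn two Q0 by (intro divide_left_mono mult_mono mult_pos_pos) auto
    finally have "exp (- (17 + c3 * c2) * T) ^ 2 \<le> (exp (- 16 * T) / (2 * Q ^ n))\<^sup>2"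
      by (intro power_mono) auto
    moreover have "exp (- (17 + c3 * c2) * T) ^ 2 = exp (- c * T)"
      by (simp add: power2_eq_square exp_add[symmetric] c_def algebra_simps)
    ultimately have fin: "exp (- c * T) \<le> (exp (- 16 * T) / (2 * Q ^ n))\<^sup>2" by simp
    show ?thesis
    proof (rule exI[of _ \<delta>], rule exI[of _ N], rule exI[of _ \<rho>], intro conjI)
      show "0 < \<delta>" "\<delta> \<le> 1" "\<delta> \<le> \<epsilon>" "0 \<le> \<rho>" by fact+
      show "16 * \<delta> powr (2 - \<alpha>) * (C * real (N + 1) ^ (d - 1) * (1/2) ^ N) \<le> K * \<epsilon>\<^sup>2" by (rule high)
      show "8 * real ((N + 1) ^ (d - 1) * 2 ^ (N + 1)) * exp K \<le> exp \<rho>" using \<rho> unfolding n_def .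
      show "exp (- c * (\<epsilon> powr (- \<alpha>) * ln (1 / \<epsilon>) powr (\<alpha> * (real d - 1 / 2))))
        \<le> (exp (- 16 * \<delta> powr (-\<alpha>)) / (2 * (2 * \<rho> * real ((N + 1) ^ d) / \<epsilon> + 2) ^ ((N + 1) ^ (d - 1) * 2 ^ (N + 1))))\<^sup>2"
        using fin unfolding \<delta>T Q_def n_def unfolding T_def L_def D_def .
    qed
  qed
  show ?thesis
    using main K c L0_def by (intro exI[of _ K] exI[of _ c] exI[of _ "exp (- L0)"]) auto
qed

section \<open>Cells of the unit cube\<close>

definition grid_point :: "nat \<Rightarrow> ('d \<Rightarrow> nat) \<Rightarrow> real ^ 'd::finite" where
  "grid_point m x = (\<chi> i. real (x i) / 2 ^ m)"

text \<open>
  The boxes are open on the left and closed on the right, so that for \<open>s\<close> in the box of \<open>c\<close> the condition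
  \<open>s \<in> [0, x / 2^m]\<close> says exactly that \<open>c < x\<close> in every coordinate.
\<close>

definition grid_box :: "nat \<Rightarrow> ('d \<Rightarrow> nat) \<Rightarrow> (real ^ 'd::finite) set" where
  "grid_box m c = {t. \<forall>i. real (c i) / 2 ^ m < t $ i \<and> t $ i \<le> (real (c i) + 1) / 2 ^ m}"

lemma mem_unit_cube: "t \<in> unit_cube \<longleftrightarrow> (\<forall>i. 0 \<le> t $ i \<and> t $ i \<le> 1)"
  by (simp add: mem_box_cart)

lemma emeasure_unit_cube: "emeasure lborel (unit_cube :: (real ^ 'd::finite) set) = 1"
proof -
  have b: "(1 :: real ^ 'd) \<bullet> b = 1" if b: "b \<in> Basis" for b
  proof -
    obtain i where "b = axis i 1" using b by (auto simp: Basis_vec_def)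
    then show ?thesis by (simp add: inner_axis)
  qed
  show ?thesis by (subst emeasure_lborel_cbox) (auto simp: b)
qed

lemma grid_Suc_le: "x \<in> grid m \<Longrightarrow> real (x i) + 1 \<le> 2 ^ m"
proof -
  assume "x \<in> grid m"
  then have "x i + 1 \<le> 2 ^ m" by (simp add: grid_def Suc_le_eq)
  then have "real (x i + 1) \<le> real (2 ^ m)" by (simp only: of_nat_le_iff)
  then show ?thesis by simp
qed

lemma grid_point_in_cube [simp]: "x \<in> grid m \<Longrightarrow> grid_point m x \<in> unit_cube"
  by (auto simp: mem_unit_cube grid_point_def grid_def divide_le_eq less_imp_le)

lemma grid_box_measurable [measurable]: "grid_box m c \<in> sets borel"
proof -
  have "grid_box m c = (\<Inter>i. {t. real (c i) / 2 ^ m < t $ i} \<inter> {t. t $ i \<le> (real (c i) + 1) / 2 ^ m})"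
    by (auto simp: grid_box_def)
  also have "\<dots> \<in> sets borel"
    by (intro sets.finite_INT sets.Int borel_open borel_closed open_halfspace_component_gt_cart closed_halfspace_component_le_cart) auto
  finally show ?thesis .
qed

lemma emeasure_grid_box:
  "emeasure lborel (grid_box m (c :: 'd::finite \<Rightarrow> nat)) = ennreal (1 / card (grid m :: ('d \<Rightarrow> nat) set))"
proof -
  define l :: "real ^ 'd" where "l = (\<chi> i. real (c i) / 2 ^ m)"
  define u :: "real ^ 'd" where "u = (\<chi> i. (real (c i) + 1) / 2 ^ m)"
  have d: "(u - l) \<bullet> b = 1 / 2 ^ m" "l \<bullet> b \<le> u \<bullet> b" if "b \<in> Basis" for b
  proof -
    obtain i where "b = axis i 1" using \<open>b \<in> Basis\<close> by (auto simp: Basis_vec_def)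
    then show "(u - l) \<bullet> b = 1 / 2 ^ m" "l \<bullet> b \<le> u \<bullet> b"
      by (auto simp: inner_axis' inner_axis u_def l_def diff_divide_distrib[symmetric] divide_right_mono)
  qed
  have v: "(\<Prod>b\<in>Basis. (u - l) \<bullet> b) = 1 / card (grid m :: ('d \<Rightarrow> nat) set)"
    using d by (simp add: card_grid power_one_over)
  have "emeasure lborel (box l u) = ennreal (1 / card (grid m :: ('d \<Rightarrow> nat) set))"
    using d v by (subst emeasure_lborel_box) auto
  moreover have "emeasure lborel (cbox l u) = ennreal (1 / card (grid m :: ('d \<Rightarrow> nat) set))"
    using d v by (subst emeasure_lborel_cbox) auto
  moreover have "emeasure lborel (box l u) \<le> emeasure lborel (grid_box m c)"
    by (intro emeasure_mono) (auto simp: mem_box_cart grid_box_def l_def u_def less_imp_le)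
  moreover have "emeasure lborel (grid_box m c) \<le> emeasure lborel (cbox l u)"
    by (intro emeasure_mono) (auto simp: mem_box_cart grid_box_def l_def u_def less_imp_le)
  ultimately show ?thesis by simp
qed

lemma grid_box_disjoint:
  assumes "t \<in> grid_box m c" "t \<in> grid_box m c'"
  shows "c = c'"
proof
  fix i
  have "real (c i) < t $ i * 2 ^ m" "t $ i * 2 ^ m \<le> real (c i) + 1" "real (c' i) < t $ i * 2 ^ m" "t $ i * 2 ^ m \<le> real (c' i) + 1"
    using assms by (auto simp: grid_box_def field_simps)
  then have "real (c i) < real (c' i) + 1" "real (c' i) < real (c i) + 1" by linarith+
  then show "c i = c' i" by linarith
qed

lemma grid_box_subset_cube: "c \<in> grid m \<Longrightarrow> grid_box m c \<subseteq> unit_cube"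
proof
  fix t assume c: "c \<in> grid m" and t: "t \<in> grid_box m c"
  show "t \<in> unit_cube" unfolding mem_unit_cube
  proof (intro allI conjI)
    fix i
    have "real (c i) / 2 ^ m < t $ i" "t $ i \<le> (real (c i) + 1) / 2 ^ m" using t by (auto simp: grid_box_def)
    moreover have "0 \<le> real (c i) / 2 ^ m" "(real (c i) + 1) / 2 ^ m \<le> 1" using grid_Suc_le[OF c, of i] by auto
    ultimately show "0 \<le> t $ i" "t $ i \<le> 1" by linarith+
  qed
qed

lemma sum_indicator_grid_box:
  fixes F :: "('d::finite \<Rightarrow> nat) \<Rightarrow> 'b::semiring_1"
  assumes c: "c \<in> grid m" "t \<in> grid_box m c"
  shows "(\<Sum>c'\<in>grid m. F c' * indicator (grid_box m c') t) = F c"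
proof -
  have "indicator (grid_box m c') t = (0 :: 'b)" if "c' \<noteq> c" for c'
    using grid_box_disjoint[OF c(2)] that by (metis indicator_simps(2))
  then have "(\<Sum>c'\<in>grid m - {c}. F c' * indicator (grid_box m c') t) = 0" by (intro sum.neutral) auto
  moreover have "(\<Sum>c'\<in>grid m. F c' * indicator (grid_box m c') t) = F c * indicator (grid_box m c) t + (\<Sum>c'\<in>grid m - {c}. F c' * indicator (grid_box m c') t)"
    by (rule sum.remove) (use c in auto)
  ultimately show ?thesis using c by (simp del: sum_mult_indicator)
qed

lemma sum_indicator_grid_box_outside:
  fixes F :: "('d::finite \<Rightarrow> nat) \<Rightarrow> 'b::semiring_1"
  assumes "t \<notin> unit_cube"
  shows "(\<Sum>c'\<in>grid m. F c' * indicator (grid_box m c') t) = 0"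
proof (intro sum.neutral ballI)
  fix c :: "'d \<Rightarrow> nat" assume "c \<in> grid m"
  then have "t \<notin> grid_box m c" using grid_box_subset_cube assms by blast
  then show "F c * indicator (grid_box m c) t = 0" by simp
qed

text \<open>
  The boxes are disjoint subsets of the cube and their volumes add up to 1.
\<close>

lemma AE_unit_cube_grid_box:
  "AE t in lborel. t \<in> (unit_cube :: (real ^ 'd::finite) set) \<longrightarrow> (\<exists>c\<in>grid m. t \<in> grid_box m c)"
proof -
  let ?G = "grid m :: ('d \<Rightarrow> nat) set"
  let ?U = "\<Union>c\<in>?G. grid_box m c"
  have c0: "0 < card ?G" by (simp add: card_grid)
  have U: "?U \<in> sets lborel" by (auto intro!: sets.finite_UN)
  have "emeasure lborel ?U = (\<Sum>c\<in>?G. emeasure lborel (grid_box m c))"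
    by (rule sum_emeasure[symmetric]) (auto simp: disjoint_family_on_def dest: grid_box_disjoint)
  also have "\<dots> = 1" using c0 by (simp add: emeasure_grid_box ennreal_of_nat_eq_real_of_nat ennreal_mult[symmetric] card_gt_0_iff)
  finally have eU: "emeasure lborel ?U = 1" .
  have "emeasure lborel (unit_cube - ?U) = emeasure lborel (unit_cube :: (real ^ 'd) set) - emeasure lborel ?U"
    using grid_box_subset_cube U eU by (intro emeasure_Diff) auto
  also have "\<dots> = 0" by (simp add: eU emeasure_unit_cube)
  finally have "unit_cube - ?U \<in> null_sets lborel" using U by auto
  then have "AE t in lborel. t \<notin> unit_cube - ?U" by (rule AE_not_in)
  then show ?thesis by eventually_elim auto
qed

lemma mem_grid_box_cbox_iff:
  assumes "s \<in> grid_box m c" "c \<in> grid m"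
  shows "s \<in> cbox 0 (grid_point m x) \<longleftrightarrow> c \<in> box_cells m x"
proof -
  have "0 \<le> s $ i \<and> s $ i \<le> grid_point m x $ i \<longleftrightarrow> c i < x i" for i
  proof -
    have a: "real (c i) < s $ i * 2 ^ m" "s $ i * 2 ^ m \<le> real (c i) + 1"
      using assms by (auto simp: grid_box_def field_simps)
    have "0 \<le> s $ i" using grid_box_subset_cube[OF assms(2)] assms(1) by (auto simp: mem_unit_cube)
    moreover have "s $ i \<le> grid_point m x $ i \<longleftrightarrow> s $ i * 2 ^ m \<le> real (x i)" by (simp add: grid_point_def field_simps)
    moreover have "s $ i * 2 ^ m \<le> real (x i) \<longleftrightarrow> c i < x i"
    proof
      assume "s $ i * 2 ^ m \<le> real (x i)" then show "c i < x i" using a by linarith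
    next
      assume "c i < x i" then have "real (c i) + 1 \<le> real (x i)" by linarith
      then show "s $ i * 2 ^ m \<le> real (x i)" using a by linarith
    qed
    ultimately show ?thesis by blast
  qed
  then show ?thesis using assms by (auto simp: mem_box_cart box_cells_def)
qed

lemma integral_grid_boxes:
  fixes f :: "real ^ 'd::finite \<Rightarrow> real" and F :: "('d \<Rightarrow> nat) \<Rightarrow> real"
  assumes f: "\<And>c t. c \<in> grid m \<Longrightarrow> t \<in> grid_box m c \<Longrightarrow> f t = F c"
    and [measurable]: "f \<in> borel_measurable borel"
  shows "(LINT t:unit_cube|lborel. f t) = (\<Sum>c\<in>grid m. F c) / card (grid m :: ('d \<Rightarrow> nat) set)"
proof -
  let ?G = "grid m :: ('d \<Rightarrow> nat) set"
  have "(LINT t:unit_cube|lborel. f t) = (LINT t|lborel. (\<Sum>c\<in>?G. F c * indicator (grid_box m c) t))"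
    unfolding set_lebesgue_integral_def
  proof (rule integral_cong_AE)
    show "AE t in lborel. indicator unit_cube t *\<^sub>R f t = (\<Sum>c\<in>?G. F c * indicator (grid_box m c) t)"
      using AE_unit_cube_grid_box[of m]
    proof eventually_elim
      case (elim t)
      show ?case
      proof (cases "t \<in> unit_cube")
        case True
        then obtain c where c: "c \<in> ?G" "t \<in> grid_box m c" using elim by auto
        show ?thesis using True f[OF c] by (subst sum_indicator_grid_box[OF c]) simp
      next
        case False
        then show ?thesis by (subst sum_indicator_grid_box_outside) simp_all
      qed
    qed
  qed measurable
  also have "\<dots> = (\<Sum>c\<in>?G. F c * measure lborel (grid_box m c))"
    by (subst Bochner_Integration.integral_sum) (auto simp: emeasure_grid_box)
  also have "\<dots> = (\<Sum>c\<in>?G. F c) / card ?G"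
    by (simp add: measure_def emeasure_grid_box sum_divide_distrib)
  finally show ?thesis .
qed

lemma nn_integral_grid_boxes:
  fixes f :: "real ^ 'd::finite \<Rightarrow> ennreal" and F :: "('d \<Rightarrow> nat) \<Rightarrow> ennreal"
  assumes f: "\<And>c t. c \<in> grid m \<Longrightarrow> t \<in> grid_box m c \<Longrightarrow> f t = F c"
  shows "(\<integral>\<^sup>+t\<in>unit_cube. f t \<partial>lborel) = (\<Sum>c\<in>grid m. F c * ennreal (1 / card (grid m :: ('d \<Rightarrow> nat) set)))"
proof -
  let ?G = "grid m :: ('d \<Rightarrow> nat) set"
  have "(\<integral>\<^sup>+t\<in>unit_cube. f t \<partial>lborel) = (\<integral>\<^sup>+t. (\<Sum>c\<in>?G. F c * indicator (grid_box m c) t) \<partial>lborel)"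
  proof (rule nn_integral_cong_AE)
    show "AE t in lborel. f t * indicator unit_cube t = (\<Sum>c\<in>?G. F c * indicator (grid_box m c) t)"
      using AE_unit_cube_grid_box[of m]
    proof eventually_elim
      case (elim t)
      show ?case
      proof (cases "t \<in> unit_cube")
        case True
        then obtain c where c: "c \<in> ?G" "t \<in> grid_box m c" using elim by auto
        show ?thesis using True f[OF c] by (subst sum_indicator_grid_box[OF c]) simp
      next
        case False
        then show ?thesis by (subst sum_indicator_grid_box_outside) simp_all
      qed
    qed
  qed
  also have "\<dots> = (\<Sum>c\<in>?G. F c * emeasure lborel (grid_box m c))"
    by (subst nn_integral_sum) (auto simp: nn_integral_cmult_indicator)
  finally show ?thesis by (simp add: emeasure_grid_box)
qed

section \<open>The law of the sheet on a grid\<close>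

lemma stable_sheet_char_finite:
  fixes Z :: "real ^ 'd::finite \<Rightarrow> 'w \<Rightarrow> real" and p :: "'x \<Rightarrow> real ^ 'd" and l :: "'x \<Rightarrow> real"
  assumes S: "stable_sheet \<alpha> M Z" and X: "finite X" and p: "\<And>x. x \<in> X \<Longrightarrow> p x \<in> unit_cube"
  shows "(LINT \<omega>|M. iexp (\<Sum>x\<in>X. l x * Z (p x) \<omega>)) =
     complex_of_real (exp (- (LINT s:unit_cube|lborel. \<bar>\<Sum>x\<in>X. l x * indicator (cbox 0 (p x)) s\<bar> powr \<alpha>)))"
proof -
  obtain h where h: "bij_betw h {..<card X} X"
    using ex_bij_betw_nat_finite[OF X] by (auto simp: atLeast0LessThan)
  have "\<forall>j<card X. (p \<circ> h) j \<in> unit_cube" using h p by (auto simp: bij_betw_def)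
  then have "(LINT \<omega>|M. iexp (\<Sum>j<card X. (l \<circ> h) j * Z ((p \<circ> h) j) \<omega>)) =
    complex_of_real (exp (- (LINT s:unit_cube|lborel. \<bar>\<Sum>j<card X. (l \<circ> h) j * indicator (cbox 0 ((p \<circ> h) j)) s\<bar> powr \<alpha>)))"
    using S unfolding stable_sheet_def by blast
  moreover have "(\<Sum>j<card X. g (h j)) = (\<Sum>x\<in>X. g x)" for g :: "'x \<Rightarrow> real"
    using sum.reindex_bij_betw[OF h, of g] .
  ultimately show ?thesis
    using \<open>\<And>g. (\<Sum>j<card X. g (h j)) = (\<Sum>x\<in>X. g x)\<close>[of "\<lambda>x. l x * Z (p x) _"]
      \<open>\<And>g. (\<Sum>j<card X. g (h j)) = (\<Sum>x\<in>X. g x)\<close>[of "\<lambda>x. l x * indicator (cbox 0 (p x)) _"]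
    by (simp add: o_def)
qed

lemma stable_sheet_measurable_at:
  assumes S: "stable_sheet \<alpha> M Z" and t: "t \<in> unit_cube"
  shows "Z t \<in> borel_measurable M"
proof -
  have "(\<lambda>(t, \<omega>). Z t \<omega>) \<in> borel_measurable (restrict_space borel unit_cube \<Otimes>\<^sub>M M)" using S by (simp add: stable_sheet_def)
  from measurable_compose[OF measurable_Pair1'[of t "restrict_space borel unit_cube" M] this]
  show ?thesis using t by (simp add: space_restrict_space)
qed

lemma stable_sheet_char_grid:
  fixes Z :: "real ^ 'd::finite \<Rightarrow> 'w \<Rightarrow> real"
  assumes S: "stable_sheet \<alpha> M Z"
  shows "(LINT \<omega>|M. iexp (\<Sum>x\<in>grid m. l x * Z (grid_point m x) \<omega>)) =
     complex_of_real (exp (- (\<Sum>c\<in>grid m. \<bar>\<Sum>x\<in>grid m. if c \<in> box_cells m x then l x else 0\<bar> powr \<alpha>) / card (grid m :: ('d \<Rightarrow> nat) set)))"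
proof -
  have "(LINT s:unit_cube|lborel. \<bar>\<Sum>x\<in>grid m. l x * indicator (cbox 0 (grid_point m x)) s\<bar> powr \<alpha>)
      = (\<Sum>c\<in>grid m. \<bar>\<Sum>x\<in>grid m. if c \<in> box_cells m x then l x else 0\<bar> powr \<alpha>) / card (grid m :: ('d \<Rightarrow> nat) set)"
  proof (rule integral_grid_boxes)
    fix c :: "'d \<Rightarrow> nat" and t assume c: "c \<in> grid m" "t \<in> grid_box m c"
    have "(\<Sum>x\<in>grid m. l x * indicator (cbox 0 (grid_point m x)) t) = (\<Sum>x\<in>grid m. if c \<in> box_cells m x then l x else 0)"
      by (intro sum.cong refl) (simp add: indicator_def mem_grid_box_cbox_iff[OF c(2,1)])
    then show "\<bar>\<Sum>x\<in>grid m. l x * indicator (cbox 0 (grid_point m x)) t\<bar> powr \<alpha> = \<bar>\<Sum>x\<in>grid m. if c \<in> box_cells m x then l x else 0\<bar> powr \<alpha>"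
      by simp
  qed measurable
  then show ?thesis using stable_sheet_char_finite[OF S, of "grid m" "grid_point m" l] by simp
qed

text \<open>
  Exchanging the order of summation turns a linear combination of box sums into one of the independent cell
  increments. The symmetrisation doubles the exponent of the characteristic function.
\<close>

lemma char_box_sums_difference:
  fixes \<mu> :: "real measure" and m :: nat and l :: "('d::finite \<Rightarrow> nat) \<Rightarrow> real"
  defines "I \<equiv> grid m :: ('d \<Rightarrow> nat) set"
  assumes \<mu>: "real_distribution \<mu>"
    and ch: "\<And>\<theta>. char \<mu> \<theta> = complex_of_real (exp (- (1 / card I * \<bar>\<theta>\<bar> powr \<alpha>)))"
  shows "(LINT w|(Pi\<^sub>M I (\<lambda>_. \<mu>) \<Otimes>\<^sub>M Pi\<^sub>M I (\<lambda>_. \<mu>)). iexp (\<Sum>x\<in>I. l x * (\<Sum>c\<in>box_cells m x. fst w c - snd w c)))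
    = complex_of_real (exp (- 2 * (\<Sum>c\<in>I. \<bar>\<Sum>x\<in>I. if c \<in> box_cells m x then l x else 0\<bar> powr \<alpha>) / card I))"
proof -
  interpret \<mu>: real_distribution \<mu> by fact
  define P where "P = Pi\<^sub>M I (\<lambda>_. \<mu>)"
  interpret P: prob_space P unfolding P_def by (intro prob_space_PiM) (rule \<mu>.prob_space_axioms)
  interpret PP: pair_prob_space P P ..
  interpret prod: product_prob_space "\<lambda>_::'d \<Rightarrow> nat. \<mu>" I ..
  define L where "L c = (\<Sum>x\<in>I. if c \<in> box_cells m x then l x else 0)" for c
  have I: "finite I" by (simp add: I_def)
  have sub: "box_cells m x \<subseteq> I" for x by (auto simp: box_cells_def I_def)
  have lin: "(\<Sum>x\<in>I. l x * (\<Sum>c\<in>box_cells m x. f c)) = (\<Sum>c\<in>I. L c * f c)" for f :: "('d \<Rightarrow> nat) \<Rightarrow> real"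
  proof -
    have "(\<Sum>c\<in>box_cells m x. f c) = (\<Sum>c\<in>I. if c \<in> box_cells m x then f c else 0)" for x
      using sub[of x] I by (simp add: sum.If_cases Int_absorb1)
    then have "(\<Sum>x\<in>I. l x * (\<Sum>c\<in>box_cells m x. f c)) = (\<Sum>x\<in>I. \<Sum>c\<in>I. (if c \<in> box_cells m x then l x else 0) * f c)"
      by (simp only: sum_distrib_left) (intro sum.cong refl, simp)
    also have "\<dots> = (\<Sum>c\<in>I. \<Sum>x\<in>I. (if c \<in> box_cells m x then l x else 0) * f c)" by (rule sum.swap)
    finally show ?thesis by (simp add: L_def sum_distrib_right)
  qed
  have [measurable]: "(\<lambda>\<omega>. \<omega> c) \<in> borel_measurable P" if "c \<in> I" for c
    unfolding P_def using that measurable_component_singleton[of c I "\<lambda>_. \<mu>"] by simp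
  have cP: "(LINT \<omega>|P. iexp (\<Sum>c\<in>I. s c * \<omega> c)) = complex_of_real (exp (- (\<Sum>c\<in>I. \<bar>s c\<bar> powr \<alpha>) / card I))" for s :: "('d \<Rightarrow> nat) \<Rightarrow> real"
  proof -
    have "(LINT \<omega>|P. iexp (\<Sum>c\<in>I. s c * \<omega> c)) = (LINT \<omega>|P. (\<Prod>c\<in>I. iexp (s c * \<omega> c)))"
      using I by (simp add: exp_sum sum_distrib_left)
    also have "\<dots> = (\<Prod>c\<in>I. LINT x|\<mu>. iexp (s c * x))"
      unfolding P_def by (intro prod.product_integral_prod I \<mu>.integrable_iexp) auto
    also have "\<dots> = (\<Prod>c\<in>I. complex_of_real (exp (- (1 / card I * \<bar>s c\<bar> powr \<alpha>))))"
      using ch unfolding char_def by simp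
    also have "\<dots> = complex_of_real (exp (\<Sum>c\<in>I. - (1 / card I * \<bar>s c\<bar> powr \<alpha>)))"
      using I by (simp add: exp_sum)
    finally show ?thesis by (simp add: sum_negf sum_divide_distrib)
  qed
  have "(LINT w|(P \<Otimes>\<^sub>M P). iexp (\<Sum>x\<in>I. l x * (\<Sum>c\<in>box_cells m x. fst w c - snd w c)))
     = (LINT w|(P \<Otimes>\<^sub>M P). iexp (\<Sum>c\<in>I. L c * fst w c) * iexp (\<Sum>c\<in>I. - L c * snd w c))"
    unfolding lin by (simp add: exp_add[symmetric] algebra_simps sum_subtractf sum_negf)
  also have "\<dots> = (LINT y|P. (LINT x|P. iexp (\<Sum>c\<in>I. L c * x c) * iexp (\<Sum>c\<in>I. - L c * y c)))"
  proof -
    have "integrable (P \<Otimes>\<^sub>M P) (\<lambda>(x, y). iexp (\<Sum>c\<in>I. L c * x c) * iexp (\<Sum>c\<in>I. - L c * y c))"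
      by (intro PP.P.integrable_const_bound[of _ 1]) (auto simp: norm_mult case_prod_beta intro!: borel_measurable_times)
    from PP.integral_snd[OF this] show ?thesis by (simp only: case_prod_unfold)
  qed
  also have "\<dots> = (LINT x|P. iexp (\<Sum>c\<in>I. L c * x c)) * (LINT y|P. iexp (\<Sum>c\<in>I. - L c * y c))"
    by (simp only: integral_mult_left_zero integral_mult_right_zero)
  also have "\<dots> = complex_of_real (exp (- 2 * (\<Sum>c\<in>I. \<bar>L c\<bar> powr \<alpha>) / card I))"
    unfolding cP by (simp add: exp_add[symmetric] flip: of_real_mult)
  finally show ?thesis unfolding P_def L_def .
qed

text \<open>
  Stability: doubling the exponent of the characteristic function is the same as multiplying the
  sheet by \<open>2 powr (1/\<alpha>)\<close>.
\<close>

lemma stable_sheet_grid_distribution: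
  fixes Z :: "real ^ 'd::finite \<Rightarrow> 'w \<Rightarrow> real" and \<mu> :: "real measure" and m :: nat
  defines "I \<equiv> grid m :: ('d \<Rightarrow> nat) set"
  assumes M: "prob_space M" and S: "stable_sheet \<alpha> M Z" and \<alpha>: "0 < \<alpha>" and \<mu>: "real_distribution \<mu>"
    and ch: "\<And>\<theta>. char \<mu> \<theta> = complex_of_real (exp (- (1 / card I * \<bar>\<theta>\<bar> powr \<alpha>)))"
  shows "measure M {\<omega> \<in> space M. (\<Sum>x\<in>I. \<bar>2 powr (1 / \<alpha>) * Z (grid_point m x) \<omega>\<bar> powr q) \<le> a} =
    measure (Pi\<^sub>M I (\<lambda>_. \<mu>) \<Otimes>\<^sub>M Pi\<^sub>M I (\<lambda>_. \<mu>))
      {w \<in> space (Pi\<^sub>M I (\<lambda>_. \<mu>) \<Otimes>\<^sub>M Pi\<^sub>M I (\<lambda>_. \<mu>)). (\<Sum>x\<in>I. \<bar>\<Sum>c\<in>box_cells m x. fst w c - snd w c\<bar> powr q) \<le> a}"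
proof -
  interpret M: prob_space M by fact
  interpret \<mu>: real_distribution \<mu> by fact
  define P where "P = Pi\<^sub>M I (\<lambda>_. \<mu>)"
  interpret P: prob_space P unfolding P_def by (intro prob_space_PiM) (rule \<mu>.prob_space_axioms)
  interpret PP: pair_prob_space P P ..
  have I: "finite I" by (simp add: I_def)
  have [measurable]: "(\<lambda>\<omega>. \<omega> c) \<in> borel_measurable P" if "c \<in> I" for c
    unfolding P_def using that measurable_component_singleton[of c I "\<lambda>_. \<mu>"] by simp
  have W[measurable]: "(\<lambda>w. \<Sum>c\<in>box_cells m x. fst w c - snd w c) \<in> borel_measurable (P \<Otimes>\<^sub>M P)" for x :: "'d \<Rightarrow> nat"
    by (intro borel_measurable_sum) (auto simp: box_cells_def I_def[symmetric])
  have Zm[measurable]: "x \<in> I \<Longrightarrow> (\<lambda>\<omega>. 2 powr (1 / \<alpha>) * Z (grid_point m x) \<omega>) \<in> borel_measurable M" for x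
    using stable_sheet_measurable_at[OF S grid_point_in_cube] unfolding I_def by (intro borel_measurable_times) auto
  let ?B = "Pi\<^sub>M I (\<lambda>_. borel :: real measure)"
  have D: "distr M ?B (\<lambda>\<omega>. \<lambda>x\<in>I. 2 powr (1 / \<alpha>) * Z (grid_point m x) \<omega>) =
     distr (P \<Otimes>\<^sub>M P) ?B (\<lambda>w. \<lambda>x\<in>I. \<Sum>c\<in>box_cells m x. fst w c - snd w c)"
  proof (rule char_unique_PiM[OF M PP.P.prob_space_axioms I Zm W])
    fix l :: "('d \<Rightarrow> nat) \<Rightarrow> real"
    define r where "r = 2 powr (1 / \<alpha>)"
    have r: "r powr \<alpha> = 2" "0 \<le> r" using \<alpha> by (auto simp: r_def powr_powr)
    have "(\<Sum>x\<in>I. if c \<in> box_cells m x then l x * r else 0) = r * (\<Sum>x\<in>I. if c \<in> box_cells m x then l x else 0)" for c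
      unfolding sum_distrib_left by (intro sum.cong) auto
    then have "\<bar>\<Sum>x\<in>I. if c \<in> box_cells m x then l x * r else 0\<bar> powr \<alpha> = 2 * \<bar>\<Sum>x\<in>I. if c \<in> box_cells m x then l x else 0\<bar> powr \<alpha>" for c
      using r by (simp only: abs_mult powr_mult abs_ge_zero abs_of_nonneg)
    then have "(\<Sum>c\<in>I. \<bar>\<Sum>x\<in>I. if c \<in> box_cells m x then l x * r else 0\<bar> powr \<alpha>) = 2 * (\<Sum>c\<in>I. \<bar>\<Sum>x\<in>I. if c \<in> box_cells m x then l x else 0\<bar> powr \<alpha>)"
      by (simp only: sum_distrib_left)
    then show "(LINT \<omega>|M. iexp (\<Sum>x\<in>I. l x * (2 powr (1 / \<alpha>) * Z (grid_point m x) \<omega>))) =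
      (LINT w|(P \<Otimes>\<^sub>M P). iexp (\<Sum>x\<in>I. l x * (\<Sum>c\<in>box_cells m x. fst w c - snd w c)))"
      using stable_sheet_char_grid[OF S, where m = m and l = "\<lambda>x. l x * r"] char_box_sums_difference[OF \<mu> ch[unfolded I_def], where l = l]
      unfolding P_def I_def r_def by (simp add: mult.assoc)
  qed
  define E where "E = {y \<in> space ?B. (\<Sum>x\<in>I. \<bar>y x\<bar> powr q) \<le> a}"
  have E: "E \<in> sets ?B" unfolding E_def by measurable
  have m1: "(\<lambda>\<omega>. \<lambda>x\<in>I. 2 powr (1 / \<alpha>) * Z (grid_point m x) \<omega>) \<in> measurable M ?B" using Zm by (intro measurable_restrict)
  have m2: "(\<lambda>w. \<lambda>x\<in>I. \<Sum>c\<in>box_cells m x. fst w c - snd w c) \<in> measurable (P \<Otimes>\<^sub>M P) ?B" using W by (intro measurable_restrict)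
  have "measure M {\<omega> \<in> space M. (\<Sum>x\<in>I. \<bar>2 powr (1 / \<alpha>) * Z (grid_point m x) \<omega>\<bar> powr q) \<le> a} = measure (distr M ?B (\<lambda>\<omega>. \<lambda>x\<in>I. 2 powr (1 / \<alpha>) * Z (grid_point m x) \<omega>)) E"
    unfolding measure_distr[OF m1 E] by (intro arg_cong[where f="measure M"]) (auto simp: E_def space_PiM)
  also have "\<dots> = measure (P \<Otimes>\<^sub>M P) {w \<in> space (P \<Otimes>\<^sub>M P). (\<Sum>x\<in>I. \<bar>\<Sum>c\<in>box_cells m x. fst w c - snd w c\<bar> powr q) \<le> a}"
    unfolding D measure_distr[OF m2 E] by (intro arg_cong[where f="measure (P \<Otimes>\<^sub>M P)"]) (auto simp: E_def space_PiM)
  finally show ?thesis unfolding P_def .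
qed

lemma measure_cbox_0:
  assumes "t \<in> (unit_cube :: (real ^ 'd::finite) set)"
  shows "measure lborel (cbox 0 t) = (\<Prod>i\<in>UNIV. t $ i)"
proof -
  have "0 \<in> cbox 0 t" using assms by (simp add: mem_box_cart)
  then have "cbox 0 t \<noteq> {}" by blast
  then show ?thesis by (subst content_cbox_cart) auto
qed

lemma stable_sheet_increment_char:
  fixes Z :: "real ^ 'd::finite \<Rightarrow> 'w \<Rightarrow> real"
  assumes S: "stable_sheet \<alpha> M Z" and \<alpha>: "0 < \<alpha>" and t: "t \<in> unit_cube" and p: "p \<in> unit_cube" and le: "\<And>i. p $ i \<le> t $ i"
  shows "(LINT \<omega>|M. iexp (\<theta> * (Z t \<omega> - Z p \<omega>))) = complex_of_real (exp (- (((\<Prod>i\<in>UNIV. t $ i) - (\<Prod>i\<in>UNIV. p $ i)) * \<bar>\<theta>\<bar> powr \<alpha>)))"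
proof -
  define pt where "pt b = (if b then t else p)" for b
  define l where "l b = (if b then \<theta> else -\<theta>)" for b
  have "(LINT \<omega>|M. iexp (\<Sum>b\<in>UNIV. l b * Z (pt b) \<omega>)) =
     complex_of_real (exp (- (LINT s:unit_cube|lborel. \<bar>\<Sum>b\<in>UNIV. l b * indicator (cbox 0 (pt b)) s\<bar> powr \<alpha>)))"
    using t p by (intro stable_sheet_char_finite[OF S]) (auto simp: pt_def)
  moreover have "(\<Sum>b\<in>UNIV. l b * Z (pt b) \<omega>) = \<theta> * (Z t \<omega> - Z p \<omega>)" for \<omega>
    by (simp add: UNIV_bool l_def pt_def algebra_simps)
  moreover have "(LINT s:unit_cube|lborel. \<bar>\<Sum>b\<in>UNIV. l b * indicator (cbox 0 (pt b)) s\<bar> powr \<alpha>)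
     = ((\<Prod>i\<in>UNIV. t $ i) - (\<Prod>i\<in>UNIV. p $ i)) * \<bar>\<theta>\<bar> powr \<alpha>"
  proof -
    have sub: "cbox 0 p \<subseteq> cbox 0 t" by (auto simp: mem_box_cart) (meson le order_trans)
    have sub2: "cbox 0 t \<subseteq> unit_cube" using t by (auto simp: mem_box_cart) (meson order_trans)
    have "(LINT s:unit_cube|lborel. \<bar>\<Sum>b\<in>UNIV. l b * indicator (cbox 0 (pt b)) s\<bar> powr \<alpha>)
      = (LINT s|lborel. \<bar>\<theta>\<bar> powr \<alpha> * indicator (cbox 0 t - cbox 0 p) s)"
      unfolding set_lebesgue_integral_def
      by (intro Bochner_Integration.integral_cong) (use sub sub2 \<alpha> in \<open>auto simp: UNIV_bool l_def pt_def indicator_def\<close>)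
    also have "\<dots> = \<bar>\<theta>\<bar> powr \<alpha> * measure lborel (cbox 0 t - cbox 0 p)" by simp
    also have "measure lborel (cbox 0 t - cbox 0 p) = measure lborel (cbox 0 t) - measure lborel (cbox 0 p)"
      using sub by (intro measure_Diff) (auto simp: emeasure_lborel_cbox_eq)
    finally show ?thesis using t p by (simp add: measure_cbox_0 mult.commute)
  qed
  ultimately show ?thesis by simp
qed

definition grid_interpolation :: "nat \<Rightarrow> (real ^ 'd::finite \<Rightarrow> 'w \<Rightarrow> real) \<Rightarrow> real ^ 'd \<Rightarrow> 'w \<Rightarrow> real" where
  "grid_interpolation m Z t \<omega> = (\<Sum>x\<in>grid m. Z (grid_point m x) \<omega> * indicator (grid_box m x) t)"

lemma grid_interpolation_eq:
  assumes "x \<in> grid m" "t \<in> grid_box m x"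
  shows "grid_interpolation m Z t \<omega> = Z (grid_point m x) \<omega>"
  unfolding grid_interpolation_def by (rule sum_indicator_grid_box[OF assms])

text \<open>
  The increment between \<open>t\<close> and the nearest grid point below it is stable with scale given by the
  volume between two boxes, which is at most the sum of the differences of the coordinates.
\<close>

lemma grid_interpolation_error:
  fixes Z :: "real ^ 'd::finite \<Rightarrow> 'w \<Rightarrow> real"
  assumes M: "prob_space M" and S: "stable_sheet \<alpha> M Z" and \<alpha>: "0 < \<alpha>" "\<alpha> \<le> 2"
    and x: "x \<in> grid m" and t: "t \<in> grid_box m x"
  shows "(\<integral>\<^sup>+\<omega>. ennreal (min 1 ((grid_interpolation m Z t \<omega> - Z t \<omega>)\<^sup>2)) \<partial>M) \<le> ennreal (8 * real CARD('d) * (1/2) ^ m)"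
proof -
  interpret prob_space M by fact
  let ?p = "grid_point m x"
  have tc: "t \<in> unit_cube" using grid_box_subset_cube[OF x] t by blast
  have p: "?p \<in> unit_cube" using x by simp
  note [measurable] = stable_sheet_measurable_at[OF S tc] stable_sheet_measurable_at[OF S p]
  have le: "?p $ i \<le> t $ i" "t $ i \<le> ?p $ i + (1/2) ^ m" for i
    using t by (auto simp: grid_box_def grid_point_def less_imp_le power_one_over add_divide_distrib)
  define w where "w = (\<Prod>i\<in>UNIV. t $ i) - (\<Prod>i\<in>UNIV. ?p $ i)"
  have w0: "0 \<le> w" unfolding w_def using le p tc by (auto intro!: prod_mono simp: mem_unit_cube)
  have "w \<le> norm ((\<Prod>i\<in>UNIV. t $ i) - (\<Prod>i\<in>UNIV. ?p $ i))" by (simp add: w_def)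
  also have "\<dots> \<le> (\<Sum>i\<in>UNIV. norm (t $ i - ?p $ i))"
    using tc p by (intro norm_prod_diff) (auto simp: mem_unit_cube)
  also have "\<dots> \<le> (\<Sum>i\<in>(UNIV::'d set). (1/2) ^ m)" using le by (intro sum_mono) (auto simp: abs_le_iff algebra_simps)
  finally have w: "w \<le> real CARD('d) * (1/2) ^ m" by simp
  have "(LINT \<omega>|M. min 1 (((Z t \<omega> - Z ?p \<omega>) / 1)\<^sup>2)) \<le> 8 * w * 1 powr (-\<alpha>)"
    using stable_sheet_increment_char[OF S \<alpha>(1) tc p le(1)] w0
    by (intro stable_truncated_moment[OF M _ \<alpha>]) (auto simp: w_def)
  also have "\<dots> \<le> 8 * real CARD('d) * (1/2) ^ m" using w by simp
  finally have b: "(LINT \<omega>|M. min 1 ((Z t \<omega> - Z ?p \<omega>)\<^sup>2)) \<le> 8 * real CARD('d) * (1/2) ^ m" by simp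
  have "(\<integral>\<^sup>+\<omega>. ennreal (min 1 ((grid_interpolation m Z t \<omega> - Z t \<omega>)\<^sup>2)) \<partial>M) = (\<integral>\<^sup>+\<omega>. ennreal (min 1 ((Z t \<omega> - Z ?p \<omega>)\<^sup>2)) \<partial>M)"
    by (simp add: grid_interpolation_eq[OF x t] power2_commute)
  also have "\<dots> = ennreal (LINT \<omega>|M. min 1 ((Z t \<omega> - Z ?p \<omega>)\<^sup>2))"
    by (intro nn_integral_eq_integral integrable_const_bound[of _ 1]) auto
  finally show ?thesis using b by (simp add: ennreal_leI)
qed

section \<open>Passage to the limit\<close>

abbreviation cube_measure :: "(real ^ 'd::finite) measure" where
  "cube_measure \<equiv> restrict_space lborel unit_cube"

lemma emeasure_cube_measure: "emeasure cube_measure (space (cube_measure :: (real ^ 'd::finite) measure)) = 1"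
  by (subst emeasure_restrict_space) (auto simp: space_restrict_space emeasure_unit_cube)

lemma stable_sheet_measurable_pair:
  fixes Z :: "real ^ 'd::finite \<Rightarrow> 'w \<Rightarrow> real"
  assumes S: "stable_sheet \<alpha> M Z"
  shows "(\<lambda>(t, \<omega>). Z t \<omega>) \<in> borel_measurable (cube_measure \<Otimes>\<^sub>M M)"
    and "(\<lambda>(t, \<omega>). grid_interpolation m Z t \<omega>) \<in> borel_measurable (cube_measure \<Otimes>\<^sub>M M)"
proof -
  have "sets (cube_measure \<Otimes>\<^sub>M M) = sets (restrict_space borel (unit_cube :: (real ^ 'd) set) \<Otimes>\<^sub>M M)"
    by (intro sets_pair_measure_cong sets_restrict_space_cong) auto
  then show "(\<lambda>(t, \<omega>). Z t \<omega>) \<in> borel_measurable (cube_measure \<Otimes>\<^sub>M M)"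
    using S by (simp add: stable_sheet_def cong: measurable_cong_sets)
  have [measurable]: "grid_box m x \<in> sets borel" for x :: "'d \<Rightarrow> nat" by simp
  have ind: "(\<lambda>t. indicator (grid_box m x) t :: real) \<in> borel_measurable cube_measure" for x :: "'d \<Rightarrow> nat"
    by (intro measurable_restrict_space1) measurable
  have "(\<lambda>z. Z (grid_point m x) (snd z) * indicator (grid_box m x) (fst z)) \<in> borel_measurable (cube_measure \<Otimes>\<^sub>M M)" if "x \<in> grid m" for x
    using stable_sheet_measurable_at[OF S grid_point_in_cube[OF that]] ind[of x]
    by (intro borel_measurable_times) (auto intro: measurable_compose[OF measurable_snd] measurable_compose[OF measurable_fst])
  then show "(\<lambda>(t, \<omega>). grid_interpolation m Z t \<omega>) \<in> borel_measurable (cube_measure \<Otimes>\<^sub>M M)"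
    unfolding grid_interpolation_def case_prod_unfold by (intro borel_measurable_sum) auto
qed

lemma tendsto_of_summable_min_square:
  fixes f :: "nat \<Rightarrow> real"
  assumes "summable (\<lambda>m. min 1 ((f m - l)\<^sup>2))"
  shows "f \<longlonglongrightarrow> l"
proof -
  have lim: "(\<lambda>m. min 1 ((f m - l)\<^sup>2)) \<longlonglongrightarrow> 0" using assms by (rule summable_LIMSEQ_zero)
  then have "\<forall>\<^sub>F m in sequentially. min 1 ((f m - l)\<^sup>2) < 1" by (rule order_tendstoD) simp
  then have "\<forall>\<^sub>F m in sequentially. min 1 ((f m - l)\<^sup>2) = (f m - l)\<^sup>2" by eventually_elim auto
  with lim have "(\<lambda>m. (f m - l)\<^sup>2) \<longlonglongrightarrow> 0" by (rule Lim_transform_eventually)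
  then have "(\<lambda>m. sqrt ((f m - l)\<^sup>2)) \<longlonglongrightarrow> sqrt 0" by (rule tendsto_real_sqrt)
  then have "(\<lambda>m. f m - l) \<longlonglongrightarrow> 0" by (simp add: tendsto_rabs_zero_iff)
  then show ?thesis by (simp add: LIM_zero_iff)
qed

text \<open>
  The bounds of \<open>grid_interpolation_error\<close> are summable in \<open>m\<close>, so the truncated squared errors have a
  finite sum at almost every \<open>(t, \<omega>)\<close>; Fubini's theorem puts the two quantifiers into the order needed
  for Fatou's lemma in \<open>t\<close>.
\<close>

lemma grid_interpolation_converges:
  fixes Z :: "real ^ 'd::finite \<Rightarrow> 'w \<Rightarrow> real"
  assumes M: "prob_space M" and S: "stable_sheet \<alpha> M Z" and \<alpha>: "0 < \<alpha>" "\<alpha> \<le> 2"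
  shows "AE \<omega> in M. AE t in cube_measure. (\<lambda>m. grid_interpolation m Z t \<omega>) \<longlonglongrightarrow> Z t \<omega>"
proof -
  interpret prob_space M by fact
  let ?C = "cube_measure :: (real ^ 'd) measure"
  interpret C: prob_space ?C by (rule prob_spaceI) (rule emeasure_cube_measure)
  interpret CM: pair_sigma_finite ?C M ..
  define e where "e m t \<omega> = min 1 ((grid_interpolation m Z t \<omega> - Z t \<omega>)\<^sup>2)" for m t \<omega>
  define F where "F t \<omega> = (\<Sum>m. ennreal (e m t \<omega>))" for t \<omega>
  have em: "(\<lambda>(t, \<omega>). ennreal (e m t \<omega>)) \<in> borel_measurable (?C \<Otimes>\<^sub>M M)" for m
    using stable_sheet_measurable_pair[OF S] unfolding e_def case_prod_unfold by measurable
  have Fm: "(\<lambda>(t, \<omega>). F t \<omega>) \<in> borel_measurable (?C \<Otimes>\<^sub>M M)"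
    unfolding F_def case_prod_unfold using em unfolding case_prod_unfold by (intro borel_measurable_suminf_order) auto
  have ept: "(\<lambda>\<omega>. ennreal (e m t \<omega>)) \<in> borel_measurable M" if "t \<in> unit_cube" for m t
    using measurable_compose[OF measurable_Pair1'[of t ?C M] em[of m]] that by (simp add: space_restrict_space)
  let ?c = "8 * real CARD('d)"
  have sm: "summable (\<lambda>m. ?c * (1/2) ^ m)" by (intro summable_mult summable_geometric) simp
  have bound: "(\<integral>\<^sup>+\<omega>. F t \<omega> \<partial>M) \<le> ennreal (\<Sum>m. ?c * (1/2) ^ m)" if t: "t \<in> unit_cube" and G: "\<forall>m. \<exists>x\<in>grid m. t \<in> grid_box m x" for t
  proof -
    have "(\<integral>\<^sup>+\<omega>. F t \<omega> \<partial>M) = (\<Sum>m. \<integral>\<^sup>+\<omega>. ennreal (e m t \<omega>) \<partial>M)"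
      unfolding F_def by (rule nn_integral_suminf) (rule ept[OF t])
    also have "\<dots> \<le> (\<Sum>m. ennreal (?c * (1/2) ^ m))"
    proof (rule suminf_le)
      fix m
      obtain x where "x \<in> grid m" "t \<in> grid_box m x" using G by blast
      then show "(\<integral>\<^sup>+\<omega>. ennreal (e m t \<omega>) \<partial>M) \<le> ennreal (?c * (1/2) ^ m)"
        unfolding e_def by (rule grid_interpolation_error[OF M S \<alpha>])
    qed auto
    also have "\<dots> = ennreal (\<Sum>m. ?c * (1/2) ^ m)" using sm by (intro suminf_ennreal2) auto
    finally show ?thesis .
  qed
  have "AE t in lborel. \<forall>m. t \<in> (unit_cube :: (real ^ 'd) set) \<longrightarrow> (\<exists>x\<in>grid m. t \<in> grid_box m x)"
    unfolding AE_all_countable using AE_unit_cube_grid_box by blast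
  then have AEt: "AE t in ?C. (\<integral>\<^sup>+\<omega>. F t \<omega> \<partial>M) \<le> ennreal (\<Sum>m. ?c * (1/2) ^ m)"
    using bound by (subst AE_restrict_space_iff) auto
  have "(\<integral>\<^sup>+\<omega>. (\<integral>\<^sup>+t. F t \<omega> \<partial>?C) \<partial>M) = (\<integral>\<^sup>+t. (\<integral>\<^sup>+\<omega>. F t \<omega> \<partial>M) \<partial>?C)"
    using CM.Fubini'[of F] Fm by simp
  also have "\<dots> \<le> (\<integral>\<^sup>+t. ennreal (\<Sum>m. ?c * (1/2) ^ m) \<partial>?C)"
    by (rule nn_integral_mono_AE[OF AEt])
  also have "\<dots> = ennreal (\<Sum>m. ?c * (1/2) ^ m)" by (simp only: nn_integral_const C.emeasure_space_1 mult_1_right)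
  finally have fin: "(\<integral>\<^sup>+\<omega>. (\<integral>\<^sup>+t. F t \<omega> \<partial>?C) \<partial>M) \<noteq> \<infinity>" by (metis ennreal_neq_top infinity_ennreal_def neq_top_trans)
  have m1: "(\<lambda>\<omega>. \<integral>\<^sup>+t. F t \<omega> \<partial>?C) \<in> borel_measurable M"
  proof -
    have "(\<lambda>(\<omega>, t). F t \<omega>) \<in> borel_measurable (M \<Otimes>\<^sub>M ?C)"
      using Fm by (subst measurable_pair_swap_iff) simp
    from C.borel_measurable_nn_integral[OF this] show ?thesis .
  qed
  from nn_integral_PInf_AE[OF m1 fin] AE_space show ?thesis
  proof eventually_elim
    case (elim \<omega>)
    have m2: "(\<lambda>t. F t \<omega>) \<in> borel_measurable ?C"
      using measurable_compose[OF measurable_Pair2'[of \<omega> M ?C] Fm] elim by simp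
    from nn_integral_PInf_AE[OF m2 elim(1)] show ?case
    proof eventually_elim
      case (elim t)
      then have "summable (\<lambda>m. e m t \<omega>)" unfolding F_def by (intro summable_suminf_not_top) (auto simp: e_def)
      then show ?case unfolding e_def by (rule tendsto_of_summable_min_square)
    qed
  qed
qed

lemma measurable_power_integral:
  fixes Y :: "real ^ 'd::finite \<Rightarrow> 'w \<Rightarrow> real"
  assumes M: "prob_space M" and "(\<lambda>(t, \<omega>). Y t \<omega>) \<in> borel_measurable (cube_measure \<Otimes>\<^sub>M M)"
  shows "(\<lambda>\<omega>. \<integral>\<^sup>+t\<in>unit_cube. ennreal (\<bar>Y t \<omega>\<bar> powr q) \<partial>lborel) \<in> borel_measurable M"
proof -
  interpret prob_space M by fact
  let ?C = "cube_measure :: (real ^ 'd) measure"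
  interpret C: prob_space ?C by (rule prob_spaceI) (rule emeasure_cube_measure)
  interpret CM: pair_sigma_finite ?C M ..
  have "(\<lambda>(t, \<omega>). ennreal (\<bar>Y t \<omega>\<bar> powr q)) \<in> borel_measurable (?C \<Otimes>\<^sub>M M)"
    using assms(2) unfolding case_prod_unfold by measurable
  then have "(\<lambda>(\<omega>, t). ennreal (\<bar>Y t \<omega>\<bar> powr q)) \<in> borel_measurable (M \<Otimes>\<^sub>M ?C)"
    by (subst measurable_pair_swap_iff) simp
  from C.borel_measurable_nn_integral[OF this] show ?thesis
    by (simp add: nn_integral_restrict_space)
qed

text \<open>
  By Fatou's lemma the \<open>q\<close>-th power integral of the sheet is at most \<open>a\<close> wherever those of the
  interpolations are at most \<open>a\<close> infinitely often. Convergence almost everywhere is the natural mode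
  here: for \<open>\<alpha> < 2\<close> and \<open>q \<ge> \<alpha>\<close> the \<open>q\<close>-th moments of the sheet are infinite.
\<close>

lemma stable_sheet_probability_of_grid:
  fixes Z :: "real ^ 'd::finite \<Rightarrow> 'w \<Rightarrow> real"
  assumes M: "prob_space M" and S: "stable_sheet \<alpha> M Z" and \<alpha>: "0 < \<alpha>" "\<alpha> \<le> 2" and q: "0 < q"
    and ev: "\<forall>\<^sub>F m in sequentially. \<pi> \<le> measure M {\<omega> \<in> space M. (\<integral>\<^sup>+t\<in>unit_cube. ennreal (\<bar>grid_interpolation m Z t \<omega>\<bar> powr q) \<partial>lborel) \<le> a}"
  shows "\<pi> \<le> measure M {\<omega> \<in> space M. (\<integral>\<^sup>+t\<in>unit_cube. ennreal (\<bar>Z t \<omega>\<bar> powr q) \<partial>lborel) \<le> a}"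
proof -
  interpret prob_space M by fact
  let ?C = "cube_measure :: (real ^ 'd) measure"
  define Im where "Im m \<omega> = (\<integral>\<^sup>+t\<in>unit_cube. ennreal (\<bar>grid_interpolation m Z t \<omega>\<bar> powr q) \<partial>lborel)" for m \<omega>
  define I where "I \<omega> = (\<integral>\<^sup>+t\<in>unit_cube. ennreal (\<bar>Z t \<omega>\<bar> powr q) \<partial>lborel)" for \<omega>
  have [measurable]: "Im m \<in> borel_measurable M" for m
    unfolding Im_def by (rule measurable_power_integral[OF M stable_sheet_measurable_pair(2)[OF S]])
  have [measurable]: "I \<in> borel_measurable M"
    unfolding I_def by (rule measurable_power_integral[OF M stable_sheet_measurable_pair(1)[OF S]])
  have fatou: "AE \<omega> in M. I \<omega> \<le> liminf (\<lambda>m. Im m \<omega>)"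
    using grid_interpolation_converges[OF M S \<alpha>] AE_space
  proof eventually_elim
    case (elim \<omega>)
    have gm: "(\<lambda>t. grid_interpolation m Z t \<omega>) \<in> borel_measurable ?C" for m
      using measurable_compose[OF measurable_Pair2'[of \<omega> M ?C] stable_sheet_measurable_pair(2)[OF S, of m]] elim by simp
    have "I \<omega> = (\<integral>\<^sup>+t. ennreal (\<bar>Z t \<omega>\<bar> powr q) \<partial>?C)" unfolding I_def by (simp add: nn_integral_restrict_space)
    also have "\<dots> \<le> (\<integral>\<^sup>+t. liminf (\<lambda>m. ennreal (\<bar>grid_interpolation m Z t \<omega>\<bar> powr q)) \<partial>?C)"
    proof (rule nn_integral_mono_AE)
      show "AE t in ?C. ennreal (\<bar>Z t \<omega>\<bar> powr q) \<le> liminf (\<lambda>m. ennreal (\<bar>grid_interpolation m Z t \<omega>\<bar> powr q))"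
        using elim(1)
      proof eventually_elim
        case (elim t)
        have "(\<lambda>m. \<bar>grid_interpolation m Z t \<omega>\<bar> powr q) \<longlonglongrightarrow> \<bar>Z t \<omega>\<bar> powr q"
          using q by (intro tendsto_powr' tendsto_rabs elim tendsto_const) auto
        then have "(\<lambda>m. ennreal (\<bar>grid_interpolation m Z t \<omega>\<bar> powr q)) \<longlonglongrightarrow> ennreal (\<bar>Z t \<omega>\<bar> powr q)"
          by (rule tendsto_ennrealI)
        then have "liminf (\<lambda>m. ennreal (\<bar>grid_interpolation m Z t \<omega>\<bar> powr q)) = ennreal (\<bar>Z t \<omega>\<bar> powr q)"
          by (intro lim_imp_Liminf) auto
        then show ?case by simp
      qed
    qed
    also have "\<dots> \<le> liminf (\<lambda>m. \<integral>\<^sup>+t. ennreal (\<bar>grid_interpolation m Z t \<omega>\<bar> powr q) \<partial>?C)"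
      by (intro nn_integral_liminf) (rule measurable_compose[OF gm, of "\<lambda>x. ennreal (\<bar>x\<bar> powr q)"], measurable)
    also have "\<dots> = liminf (\<lambda>m. Im m \<omega>)" unfolding Im_def by (simp add: nn_integral_restrict_space)
    finally show ?case .
  qed
  define E where "E n = {\<omega> \<in> space M. \<exists>m\<ge>n. Im m \<omega> \<le> a}" for n
  have [measurable]: "E n \<in> sets M" for n unfolding E_def by measurable
  have E\<pi>: "\<pi> \<le> measure M (E n)" for n
  proof -
    obtain m0 where m0: "\<And>m. m \<ge> m0 \<Longrightarrow> \<pi> \<le> measure M {\<omega> \<in> space M. Im m \<omega> \<le> a}"
      using ev unfolding eventually_sequentially Im_def by blast
    have "\<pi> \<le> measure M {\<omega> \<in> space M. Im (max m0 n) \<omega> \<le> a}" by (rule m0) simp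
    also have "\<dots> \<le> measure M (E n)" by (intro finite_measure_mono) (auto simp: E_def intro: exI[of _ "max m0 n"])
    finally show ?thesis .
  qed
  have "(\<lambda>n. measure M (E n)) \<longlonglongrightarrow> measure M (\<Inter>n. E n)"
    by (rule finite_Lim_measure_decseq) (auto simp: decseq_def E_def intro: order_trans)
  then have "\<pi> \<le> measure M (\<Inter>n. E n)" using E\<pi> by (intro LIMSEQ_le_const) auto
  also have "\<dots> \<le> measure M {\<omega> \<in> space M. I \<omega> \<le> a}"
  proof (rule finite_measure_mono_AE)
    show "AE \<omega> in M. \<omega> \<in> (\<Inter>n. E n) \<longrightarrow> \<omega> \<in> {\<omega> \<in> space M. I \<omega> \<le> a}"
      using fatou AE_space
    proof eventually_elim
      case (elim \<omega>)
      show ?case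
      proof
        assume w: "\<omega> \<in> (\<Inter>n. E n)"
        have "liminf (\<lambda>m. Im m \<omega>) \<le> a"
        proof (rule ccontr)
          assume "\<not> ?thesis"
          then have "\<forall>\<^sub>F m in sequentially. a < Im m \<omega>" by (intro less_LiminfD) simp
          then obtain m0 where "\<And>m. m \<ge> m0 \<Longrightarrow> a < Im m \<omega>" by (auto simp: eventually_sequentially)
          moreover have "\<exists>m\<ge>m0. Im m \<omega> \<le> a" using w by (auto simp: E_def)
          ultimately show False by (meson not_le)
        qed
        then show "\<omega> \<in> {\<omega> \<in> space M. I \<omega> \<le> a}" using elim by auto
      qed
    qed
  qed measurable
  finally show ?thesis unfolding I_def .
qed

lemma power_integral_grid_interpolation:
  fixes Z :: "real ^ 'd::finite \<Rightarrow> 'w \<Rightarrow> real"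
  shows "(\<integral>\<^sup>+t\<in>unit_cube. ennreal (\<bar>grid_interpolation m Z t \<omega>\<bar> powr q) \<partial>lborel)
     = ennreal ((\<Sum>x\<in>grid m. \<bar>Z (grid_point m x) \<omega>\<bar> powr q) / card (grid m :: ('d \<Rightarrow> nat) set))"
proof -
  have "(\<integral>\<^sup>+t\<in>unit_cube. ennreal (\<bar>grid_interpolation m Z t \<omega>\<bar> powr q) \<partial>lborel)
     = (\<Sum>x\<in>grid m. ennreal (\<bar>Z (grid_point m x) \<omega>\<bar> powr q) * ennreal (1 / card (grid m :: ('d \<Rightarrow> nat) set)))"
    by (rule nn_integral_grid_boxes) (simp add: grid_interpolation_eq)
  also have "\<dots> = (\<Sum>x\<in>grid m. ennreal (\<bar>Z (grid_point m x) \<omega>\<bar> powr q / card (grid m :: ('d \<Rightarrow> nat) set)))"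
    by (intro sum.cong refl) (simp add: ennreal_mult[symmetric])
  also have "\<dots> = ennreal (\<Sum>x\<in>grid m. \<bar>Z (grid_point m x) \<omega>\<bar> powr q / card (grid m :: ('d \<Rightarrow> nat) set))"
    by (rule sum_ennreal) simp
  finally show ?thesis by (simp add: sum_divide_distrib)
qed

section \<open>The small deviation estimate\<close>

text \<open>
  The law of a cell increment is read off from the sheet itself: the values at 0 and at a corner of a
  box of volume \<open>v\<close> differ by such a variable.
\<close>

lemma stable_sheet_cell_law:
  fixes Z :: "real ^ 'd::finite \<Rightarrow> 'w \<Rightarrow> real"
  assumes M: "prob_space M" and S: "stable_sheet \<alpha> M Z" and \<alpha>: "0 < \<alpha>" and v: "0 \<le> v" "v \<le> 1"
  obtains \<mu> where "real_distribution \<mu>" "\<And>\<theta>. char \<mu> \<theta> = complex_of_real (exp (- (v * \<bar>\<theta>\<bar> powr \<alpha>)))"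
proof -
  interpret prob_space M by fact
  obtain i0 :: 'd where True by simp
  define t :: "real ^ 'd" where "t = (\<chi> i. if i = i0 then v else 1)"
  have t: "t \<in> unit_cube" "(0 :: real ^ 'd) \<in> unit_cube" using v by (auto simp: mem_unit_cube t_def)
  have le: "(0 :: real ^ 'd) $ i \<le> t $ i" for i using v by (simp add: t_def)
  note [measurable] = stable_sheet_measurable_at[OF S t(1)] stable_sheet_measurable_at[OF S t(2)]
  define \<mu> where "\<mu> = distr M borel (\<lambda>\<omega>. Z t \<omega> - Z 0 \<omega>)"
  have prods: "(\<Prod>i\<in>UNIV. t $ i) = v" "(\<Prod>i\<in>(UNIV::'d set). (0::real)) = 0"
    by (simp_all add: t_def prod.If_cases)
  have "real_distribution \<mu>" unfolding \<mu>_def by (intro real_distribution_distr) simp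
  moreover have "char \<mu> \<theta> = complex_of_real (exp (- (v * \<bar>\<theta>\<bar> powr \<alpha>)))" for \<theta>
    using stable_sheet_increment_char[OF S \<alpha> t le, of \<theta>] prods
    unfolding char_def \<mu>_def by (subst integral_distr) auto
  ultimately show ?thesis using that by blast
qed

lemma stable_sheet_power_integral_small_ball:
  fixes Z :: "real ^ 'd::finite \<Rightarrow> 'w \<Rightarrow> real" and \<alpha> q :: real
  assumes M: "prob_space M" and S: "stable_sheet \<alpha> M Z" and \<alpha>: "0 < \<alpha>" "\<alpha> \<le> 2" and q: "0 < q"
  shows "\<exists>A c \<epsilon>0. 1 \<le> A \<and> 0 < c \<and> 0 < \<epsilon>0 \<and> \<epsilon>0 \<le> 1 \<and> (\<forall>\<epsilon>. 0 < \<epsilon> \<and> \<epsilon> < \<epsilon>0 \<longrightarrow>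
     exp (- c * (\<epsilon> powr (- \<alpha>) * ln (1 / \<epsilon>) powr (\<alpha> * (real CARD('d) - 1 / 2))))
      \<le> measure M {\<omega> \<in> space M. (\<integral>\<^sup>+t\<in>unit_cube. ennreal (\<bar>Z t \<omega>\<bar> powr q) \<partial>lborel) \<le> ennreal (A * \<epsilon> powr q)})"
proof -
  interpret prob_space M by fact
  let ?d = "CARD('d)"
  obtain C where C: "C > 0" and high: "\<And>m N. (\<Sum>k | k \<in> (levels m :: ('d \<Rightarrow> nat) set) \<and> N < (sum k UNIV). (1/2::real) ^ (sum k UNIV))
      \<le> C * real (N + 1) ^ (?d - 1) * (1/2) ^ N"
    using high_levels_sum_le[where 'd='d] by blast
  have d1: "1 \<le> ?d" by (simp add: Suc_le_eq)
  obtain K c \<epsilon>0 where K: "16 \<le> K" and c: "0 < c" and \<epsilon>0: "0 < \<epsilon>0" "\<epsilon>0 \<le> 1" and par: "\<And>\<epsilon>. 0 < \<epsilon> \<Longrightarrow> \<epsilon> < \<epsilon>0 \<Longrightarrow>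
    (\<exists>\<delta> (N :: nat) \<rho>. 0 < \<delta> \<and> \<delta> \<le> 1 \<and> \<delta> \<le> \<epsilon>
      \<and> 16 * \<delta> powr (2 - \<alpha>) * (C * real (N + 1) ^ (?d - 1) * (1/2) ^ N) \<le> K * \<epsilon>\<^sup>2
      \<and> 0 \<le> \<rho> \<and> 8 * real ((N + 1) ^ (?d - 1) * 2 ^ (N + 1)) * exp K \<le> exp \<rho>
      \<and> exp (- c * (\<epsilon> powr (- \<alpha>) * ln (1 / \<epsilon>) powr (\<alpha> * (real ?d - 1 / 2))))
        \<le> (exp (- 16 * \<delta> powr (-\<alpha>)) / (2 * (2 * \<rho> * real ((N + 1) ^ ?d) / \<epsilon> + 2) ^ ((N + 1) ^ (?d - 1) * 2 ^ (N + 1))))\<^sup>2)"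
    using parameter_choice[OF \<alpha> d1 C] by blast
  define A where "A = 3 powr q * (16 * q powr q * exp K + 1)"
  have A: "1 \<le> A"
  proof -
    have "1 * 1 \<le> 3 powr q * (16 * q powr q * exp K + 1)" using q by (intro mult_mono) (auto simp: ge_one_powr_ge_zero)
    then show ?thesis by (simp add: A_def)
  qed
  have "exp (- c * (\<epsilon> powr (- \<alpha>) * ln (1 / \<epsilon>) powr (\<alpha> * (real ?d - 1 / 2))))
      \<le> measure M {\<omega> \<in> space M. (\<integral>\<^sup>+t\<in>unit_cube. ennreal (\<bar>Z t \<omega>\<bar> powr q) \<partial>lborel) \<le> ennreal (A * \<epsilon> powr q)}"
    if \<epsilon>: "0 < \<epsilon>" "\<epsilon> < \<epsilon>0" for \<epsilon>
  proof (rule stable_sheet_probability_of_grid[OF M S \<alpha> q])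
    let ?p = "exp (- c * (\<epsilon> powr (- \<alpha>) * ln (1 / \<epsilon>) powr (\<alpha> * (real ?d - 1 / 2))))"
    obtain \<delta> N \<rho> where \<delta>: "0 < \<delta>" "\<delta> \<le> 1" "\<delta> \<le> \<epsilon>"
      and KH: "16 * \<delta> powr (2 - \<alpha>) * (C * real (N + 1) ^ (?d - 1) * (1/2) ^ N) \<le> K * \<epsilon>\<^sup>2"
      and \<rho>: "0 \<le> \<rho>" "8 * real ((N + 1) ^ (?d - 1) * 2 ^ (N + 1)) * exp K \<le> exp \<rho>"
      and fin: "?p \<le> (exp (- 16 * \<delta> powr (-\<alpha>)) / (2 * (2 * \<rho> * real ((N + 1) ^ ?d) / \<epsilon> + 2) ^ ((N + 1) ^ (?d - 1) * 2 ^ (N + 1))))\<^sup>2"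
      using par[OF \<epsilon>] by blast
    obtain m0 where m0: "16 * \<delta> powr (-\<alpha>) < 2 ^ m0" using real_arch_pow[of 2] by auto
    have "\<forall>\<^sub>F m in sequentially. 16 * \<delta> powr (-\<alpha>) \<le> 2 ^ m"
    proof (rule eventually_sequentiallyI[of m0])
      fix m assume "m0 \<le> m"
      then have "(2::real) ^ m0 \<le> 2 ^ m" by (intro power_increasing) auto
      then show "16 * \<delta> powr (-\<alpha>) \<le> 2 ^ m" using m0 by linarith
    qed
    then show "\<forall>\<^sub>F m in sequentially. ?p \<le> measure M {\<omega> \<in> space M. (\<integral>\<^sup>+t\<in>unit_cube. ennreal (\<bar>grid_interpolation m Z t \<omega>\<bar> powr q) \<partial>lborel) \<le> ennreal (A * \<epsilon> powr q)}"
    proof eventually_elim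
      case (elim m)
      let ?I = "grid m :: ('d \<Rightarrow> nat) set"
      let ?F = "{\<omega> \<in> space M. (\<integral>\<^sup>+t\<in>unit_cube. ennreal (\<bar>grid_interpolation m Z t \<omega>\<bar> powr q) \<partial>lborel) \<le> ennreal (A * \<epsilon> powr q)}"
      let ?E = "{\<omega> \<in> space M. (\<Sum>x\<in>?I. \<bar>2 powr (1 / \<alpha>) * Z (grid_point m x) \<omega>\<bar> powr q)
           \<le> card ?I * (3 powr q * (16 * q powr q * exp K + 1) * \<epsilon> powr q)}"
      have cI: "(2::real) ^ m \<le> card ?I" "0 < card ?I"
        using power_increasing[of 1 ?d "(2::real) ^ m"] d1 by (auto simp: card_grid)
      then have "0 \<le> 1 / real (card ?I)" "1 / real (card ?I) \<le> 1" by auto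
      then obtain \<mu> where \<mu>: "real_distribution \<mu>" "\<And>\<theta>. char \<mu> \<theta> = complex_of_real (exp (- (1 / card ?I * \<bar>\<theta>\<bar> powr \<alpha>)))"
        using stable_sheet_cell_law[OF M S \<alpha>(1)] by blast
      have m: "16 * \<delta> powr (-\<alpha>) \<le> card ?I" using elim cI by linarith
      note fin
      also note grid_small_ball[OF \<mu>(1) \<alpha> \<mu>(2) \<delta>(1,2) m \<delta>(3) q K high KH \<rho>]
      also note stable_sheet_grid_distribution[OF M S \<alpha>(1) \<mu>, of q, symmetric]
      also have "measure M ?E
         \<le> measure M ?F"
      proof (rule finite_measure_mono)
        show "?F \<in> sets M"
          using measurable_power_integral[OF M stable_sheet_measurable_pair(2)[OF S, of m], of q] by measurable
        show "?E
          \<subseteq> ?F"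
        proof (intro Collect_mono impI conjI)
          fix \<omega> assume w: "\<omega> \<in> space M \<and> (\<Sum>x\<in>?I. \<bar>2 powr (1 / \<alpha>) * Z (grid_point m x) \<omega>\<bar> powr q)
           \<le> card ?I * (3 powr q * (16 * q powr q * exp K + 1) * \<epsilon> powr q)"
          then show "\<omega> \<in> space M" by simp
          have "(\<Sum>x\<in>?I. \<bar>Z (grid_point m x) \<omega>\<bar> powr q) \<le> (\<Sum>x\<in>?I. \<bar>2 powr (1 / \<alpha>) * Z (grid_point m x) \<omega>\<bar> powr q)"
          proof (intro sum_mono powr_mono2)
            fix x
            have "1 * \<bar>Z (grid_point m x) \<omega>\<bar> \<le> 2 powr (1 / \<alpha>) * \<bar>Z (grid_point m x) \<omega>\<bar>"
              using \<alpha> by (intro mult_right_mono) (auto simp: ge_one_powr_ge_zero)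
            then show "\<bar>Z (grid_point m x) \<omega>\<bar> \<le> \<bar>2 powr (1 / \<alpha>) * Z (grid_point m x) \<omega>\<bar>" by (simp add: abs_mult)
          qed (use q in auto)
          also have "\<dots> \<le> card ?I * (A * \<epsilon> powr q)" using w by (simp add: A_def)
          finally have "(\<Sum>x\<in>?I. \<bar>Z (grid_point m x) \<omega>\<bar> powr q) / card ?I \<le> A * \<epsilon> powr q"
            using cI(2) by (simp add: divide_le_eq mult.commute)
          then show "(\<integral>\<^sup>+t\<in>unit_cube. ennreal (\<bar>grid_interpolation m Z t \<omega>\<bar> powr q) \<partial>lborel) \<le> ennreal (A * \<epsilon> powr q)"
            unfolding power_integral_grid_interpolation by (rule ennreal_leI)
        qed
      qed
      finally show ?case .
    qed
  qed
  then show ?thesis using A c \<epsilon>0 by blast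
qed

theorem mainTheorem8:
  fixes \<alpha> q :: real and M :: "'w measure" and Z :: "real ^ 'd \<Rightarrow> 'w \<Rightarrow> real"
  assumes "0 < \<alpha>" and "\<alpha> \<le> 2"
    and "1 \<le> q"
    and "prob_space M"
    and "stable_sheet \<alpha> M Z"
    and "AE \<omega> in M. Lq_norm q (\<lambda>t. Z t \<omega>) < \<infinity>"
  shows "asymp_le (at_right 0)
           (\<lambda>\<epsilon>. neg_log (measure M {\<omega> \<in> space M. Lq_norm q (\<lambda>t. Z t \<omega>) < ennreal \<epsilon>}))
           (\<lambda>\<epsilon>. ereal (\<epsilon> powr (- \<alpha>) * ln (1 / \<epsilon>) powr (\<alpha> * (real CARD('d) - 1 / 2))))"
proof -
  interpret prob_space M by fact
  have q: "0 < q" using assms(3) by simp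
  note \<alpha> = assms(1,2) and M = assms(4) and S = assms(5)
  define D where "D = \<alpha> * (real CARD('d) - 1 / 2)"
  have "1 \<le> real CARD('d)" by (simp add: Suc_le_eq)
  then have D: "0 \<le> D" unfolding D_def using \<alpha> by (intro mult_nonneg_nonneg) linarith+
  obtain A c \<epsilon>0 where A: "1 \<le> A" and c: "0 < c" and \<epsilon>0: "0 < \<epsilon>0" "\<epsilon>0 \<le> 1" and low: "\<And>\<epsilon>. 0 < \<epsilon> \<Longrightarrow> \<epsilon> < \<epsilon>0 \<Longrightarrow>
     exp (- c * (\<epsilon> powr (- \<alpha>) * ln (1 / \<epsilon>) powr D))
      \<le> measure M {\<omega> \<in> space M. (\<integral>\<^sup>+t\<in>unit_cube. ennreal (\<bar>Z t \<omega>\<bar> powr q) \<partial>lborel) \<le> ennreal (A * \<epsilon> powr q)}"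
    using stable_sheet_power_integral_small_ball[OF M S \<alpha> q] unfolding D_def by blast
  define I where "I \<omega> = (\<integral>\<^sup>+t\<in>unit_cube. ennreal (\<bar>Z t \<omega>\<bar> powr q) \<partial>lborel)" for \<omega>
  have [measurable]: "I \<in> borel_measurable M"
    unfolding I_def by (rule measurable_power_integral[OF M stable_sheet_measurable_pair(1)[OF S]])
  have Lq: "Lq_norm q (\<lambda>t. Z t \<omega>) = (if I \<omega> = \<infinity> then \<infinity> else ennreal (enn2real (I \<omega>) powr (1 / q)))" for \<omega>
    by (simp add: Lq_norm_def I_def Let_def)
  have Lqm[measurable]: "(\<lambda>\<omega>. Lq_norm q (\<lambda>t. Z t \<omega>)) \<in> borel_measurable M" unfolding Lq by measurable
  define b where "b = 2 * A powr (1 / q)"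
  have "1 \<le> A powr (1 / q)" using A q by (simp add: ge_one_powr_ge_zero)
  then have b: "2 \<le> b" by (simp add: b_def)
  define C where "C = c * (b powr \<alpha> * 2 powr D)"
  have bound: "neg_log (measure M {\<omega> \<in> space M. Lq_norm q (\<lambda>t. Z t \<omega>) < ennreal \<epsilon>}) / ereal (\<epsilon> powr (- \<alpha>) * ln (1 / \<epsilon>) powr D) \<le> ereal C"
    if \<epsilon>: "0 < \<epsilon>" "\<epsilon> < min \<epsilon>0 (1 / b)" for \<epsilon>
  proof -
    \<comment> \<open>the grid estimate is applied at a radius smaller by a constant factor, which changes the rate only by a factor\<close>
    define r where "r = \<epsilon> / b"
    have r: "0 < r" "r < \<epsilon>0" using \<epsilon> b by (auto simp: r_def divide_less_eq intro: less_le_trans)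
    let ?p = "measure M {\<omega> \<in> space M. Lq_norm q (\<lambda>t. Z t \<omega>) < ennreal \<epsilon>}"
    have "measure M {\<omega> \<in> space M. I \<omega> \<le> ennreal (A * r powr q)} \<le> ?p"
    proof (rule finite_measure_mono)
      show "{\<omega> \<in> space M. I \<omega> \<le> ennreal (A * r powr q)} \<subseteq> {\<omega> \<in> space M. Lq_norm q (\<lambda>t. Z t \<omega>) < ennreal \<epsilon>}"
      proof (intro Collect_mono impI conjI)
        fix \<omega> assume w: "\<omega> \<in> space M \<and> I \<omega> \<le> ennreal (A * r powr q)"
        then show "\<omega> \<in> space M" by simp
        have finite_I: "I \<omega> \<noteq> \<infinity>" using w by (auto simp: top_unique)
        have "enn2real (I \<omega>) \<le> A * r powr q" using w A by (intro enn2real_leI) auto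
        then have "enn2real (I \<omega>) powr (1 / q) \<le> (A * r powr q) powr (1 / q)" using q by (intro powr_mono2) auto
        also have "\<dots> = A powr (1 / q) * r" using A r q by (simp add: powr_mult powr_powr)
        also have "\<dots> = \<epsilon> / 2" using A by (simp add: r_def b_def)
        also have "\<dots> < \<epsilon>" using \<epsilon> by simp
        finally have "ennreal (enn2real (I \<omega>) powr (1 / q)) < ennreal \<epsilon>" using \<epsilon> by (intro ennreal_lessI)
        then show "Lq_norm q (\<lambda>t. Z t \<omega>) < ennreal \<epsilon>" using finite_I by (simp add: Lq)
      qed
    qed measurable
    with low[OF r] have p: "exp (- c * (r powr (- \<alpha>) * ln (1 / r) powr D)) \<le> ?p" unfolding I_def by linarith
    then have p0: "0 < ?p" using exp_gt_zero less_le_trans by blast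
    have "- c * (r powr (- \<alpha>) * ln (1 / r) powr D) \<le> ln ?p" using p p0 by (subst ln_ge_iff)
    then have nl: "- ln ?p \<le> c * (r powr (- \<alpha>) * ln (1 / r) powr D)" by simp
    have e1: "\<epsilon> < 1 / b" using \<epsilon> by simp
    have eb: "b < 1 / \<epsilon>" using e1 \<epsilon> b by (simp add: field_simps)
    have lnb: "0 < ln (1 / \<epsilon>)" using eb b by (intro ln_gt_zero) linarith
    have "ln (1 / r) = ln b + ln (1 / \<epsilon>)" using \<epsilon> b by (simp add: r_def ln_div ln_mult)
    also have "ln b \<le> ln (1 / \<epsilon>)" using eb b by (intro ln_mono) auto
    finally have lr: "ln (1 / r) \<le> 2 * ln (1 / \<epsilon>)" by simp
    have lr0: "0 \<le> ln (1 / r)" using r \<epsilon>0 by (intro ln_ge_zero) (simp add: field_simps)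
    have "ln (1 / r) powr D \<le> (2 * ln (1 / \<epsilon>)) powr D" using lr lr0 D by (intro powr_mono2) auto
    also have "\<dots> = 2 powr D * ln (1 / \<epsilon>) powr D" using lnb by (simp add: powr_mult)
    finally have "(c * r powr (- \<alpha>)) * ln (1 / r) powr D \<le> (c * r powr (- \<alpha>)) * (2 powr D * ln (1 / \<epsilon>) powr D)"
      using c by (intro mult_left_mono) auto
    moreover have rp: "r powr (- \<alpha>) = b powr \<alpha> * \<epsilon> powr (- \<alpha>)" using \<epsilon> b by (simp add: r_def powr_divide powr_minus_divide)
    ultimately have "c * (r powr (- \<alpha>) * ln (1 / r) powr D) \<le> C * (\<epsilon> powr (- \<alpha>) * ln (1 / \<epsilon>) powr D)"
      unfolding C_def rp by (simp only: mult_ac)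
    with nl have fin: "- ln ?p \<le> C * (\<epsilon> powr (- \<alpha>) * ln (1 / \<epsilon>) powr D)" by linarith
    have T0: "0 < \<epsilon> powr (- \<alpha>) * ln (1 / \<epsilon>) powr D" using \<epsilon> lnb by simp
    have "neg_log p / ereal T \<le> ereal C" if "0 < p" "0 < T" "- ln p \<le> C * T" for p T
    proof -
      have "- ln p / T \<le> C" using that by (simp only: pos_divide_le_eq)
      then show ?thesis using that by (simp add: neg_log_def)
    qed
    from this[OF p0 T0 fin] show ?thesis .
  qed
  have "\<forall>\<^sub>F \<epsilon> in at_right 0. 0 < \<epsilon> \<and> \<epsilon> < min \<epsilon>0 (1 / b)"
    using \<epsilon>0 b by (intro eventually_at_rightI[of 0 "min \<epsilon>0 (1 / b)"]) auto
  then have "\<forall>\<^sub>F \<epsilon> in at_right 0. neg_log (measure M {\<omega> \<in> space M. Lq_norm q (\<lambda>t. Z t \<omega>) < ennreal \<epsilon>}) / ereal (\<epsilon> powr (- \<alpha>) * ln (1 / \<epsilon>) powr D) \<le> ereal C"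
    by eventually_elim (use bound in blast)
  then have "Limsup (at_right 0) (\<lambda>\<epsilon>. neg_log (measure M {\<omega> \<in> space M. Lq_norm q (\<lambda>t. Z t \<omega>) < ennreal \<epsilon>}) / ereal (\<epsilon> powr (- \<alpha>) * ln (1 / \<epsilon>) powr D)) \<le> ereal C"
    by (rule Limsup_bounded)
  then show ?thesis unfolding asymp_le_def D_def by (rule order.strict_trans1) simp
qed

end
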